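(* Let $K$ be a finite separable extension of $\mathbb{F}_p(t)$, $p$ an odd prime, $S$ a finite set of primes of $K$ with $|S|\ge2$ containing all primes above the infinite prime of $\mathbb{F}_p(t)$, and $\mathcal{O}_{K,S}=\{x\in K:\operatorname{ord}_{\mathfrak{p}}(x)\ge0\text{ for all primes }\mathfrak{p}\notin S\}$. Then the set $$\mathrm{SQ}=\{(x,y)\in\mathcal{O}_{K,S}^2: y=x^2\}$$ is positive-existentially definable in the structure $\mathcal{M}_S=(\mathcal{O}_{K,S},0,1,+,\mid,\cdot t)$.
   Context: $\mid$ is divisibility in $\mathcal{O}_{K,S}$ and $\cdot t$ is multiplication by $t$. Positive-existentially definable means definable by a formula $\exists\bar y\,\theta$ with $\theta$ built from atomic formulas of the language $\{=,0,1,+,\mid,\cdot t\}$ using only $\wedge$ and $\vee$. *)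

theory Defs
  imports
    "Berlekamp_Zassenhaus.Finite_Field"
    "HOL-Computational_Algebra.Computational_Algebra"
    "HOL-Library.Extended"
begin

section \<open>Finite separable extensions\<close>

text \<open>
  A field extension is given by its embedding \<open>\<iota>\<close>, which makes the target a vector space over
  the source.
\<close>

definition finite_extension :: "('a::field \<Rightarrow> 'k::field) \<Rightarrow> bool" where
  "finite_extension \<iota> \<longleftrightarrow> (\<exists>B. finite_dimensional_vector_space (\<lambda>c x. \<iota> c * x) B)"

text \<open>
  An irreducible polynomial with root \<open>\<alpha>\<close> is, up to a unit, the minimal polynomial of \<open>\<alpha>\<close>.
\<close>

definition separable_element :: "('a::field \<Rightarrow> 'k::field) \<Rightarrow> 'k \<Rightarrow> bool" where
  "separable_element \<iota> \<alpha> \<longleftrightarrow>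
     (\<exists>f. irreducible f \<and> poly (map_poly \<iota> f) \<alpha> = 0 \<and> coprime f (pderiv f))"

definition finite_separable_extension :: "('a::field \<Rightarrow> 'k::field) \<Rightarrow> bool" where
  "finite_separable_extension \<iota> \<longleftrightarrow>
     field_hom \<iota> \<and> finite_extension \<iota> \<and> (\<forall>\<alpha>. separable_element \<iota> \<alpha>)"


section \<open>Primes\<close>

text \<open>
  A prime of a function field is a discrete valuation ring with that quotient field. It is
  represented here by its normalized order function, with which it is in bijection; a set of
  primes is thus a set of functions. The constant field being finite, no condition on constants
  is needed: a valuation vanishes on every root of unity.
\<close>

definition is_prime_place :: "('k::field \<Rightarrow> int extended) \<Rightarrow> bool" where
  "is_prime_place v \<longleftrightarrow>
     (\<forall>x. v x = Pinf \<longleftrightarrow> x = 0) \<and>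
     (\<forall>x. v x \<noteq> Minf) \<and>
     (\<forall>x y. v (x * y) = v x + v y) \<and>
     (\<forall>x y. v (x + y) \<ge> min (v x) (v y)) \<and>
     (\<exists>x. v x = Fin 1)"

text \<open>
  \<open>v\<close> lies above \<open>w\<close>: the valuation ring of \<open>v\<close> and its maximal ideal contract to those of \<open>w\<close>.
\<close>

definition lies_above ::
  "('a::field \<Rightarrow> 'k::field) \<Rightarrow> ('k \<Rightarrow> int extended) \<Rightarrow> ('a \<Rightarrow> int extended) \<Rightarrow> bool" where
  "lies_above \<iota> v w \<longleftrightarrow>
     (\<forall>a. (v (\<iota> a) \<ge> 0 \<longleftrightarrow> w a \<ge> 0) \<and> (v (\<iota> a) > 0 \<longleftrightarrow> w a > 0))"

text \<open>The infinite prime of \<open>F(t)\<close>: \<open>ord (f/g) = deg g - deg f\<close>.\<close>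

definition ord_infinity :: "'a::field poly fract \<Rightarrow> int extended" where
  "ord_infinity x =
     (if x = 0 then Pinf
      else Fin (THE n. \<exists>f g. g \<noteq> 0 \<and> x = Fract f g \<and> n = int (degree g) - int (degree f)))"

lemma ord_infinity_Fract:
  assumes "g \<noteq> 0"
  shows "ord_infinity (Fract f g) =
     (if f = 0 then Pinf else Fin (int (degree g) - int (degree f)))"
proof (cases "f = 0")
  case True
  then show ?thesis using assms by (simp add: ord_infinity_def eq_fract Zero_fract_def)
next
  case False
  have "int (degree g') - int (degree f') = int (degree g) - int (degree f)"
    if "g' \<noteq> 0" "Fract f g = Fract f' g'" for f' g'
  proof -
    have eq: "f * g' = f' * g" using that assms by (simp add: eq_fract)
    then have "f' \<noteq> 0" using that False by auto
    then have "degree f + degree g' = degree f' + degree g"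
      using eq that False assms by (metis degree_mult_eq)
    then show ?thesis by linarith
  qed
  then have "(THE n. \<exists>f' g'. g' \<noteq> 0 \<and> Fract f g = Fract f' g' \<and>
      n = int (degree g') - int (degree f')) = int (degree g) - int (degree f)"
    using assms by (intro the_equality) blast+
  moreover have "Fract f g \<noteq> 0"
    using False assms by (simp add: eq_fract Zero_fract_def)
  ultimately show ?thesis using False by (simp add: ord_infinity_def)
qed

lemma is_prime_place_ord_infinity:
  "is_prime_place (ord_infinity :: 'a::field poly fract \<Rightarrow> int extended)"
  unfolding is_prime_place_def
proof (intro conjI allI)
  fix x y :: "'a poly fract"
  obtain f g where x: "x = Fract f g" "g \<noteq> 0" by (cases x)
  obtain f' g' where y: "y = Fract f' g'" "g' \<noteq> 0" by (cases y)
  have gg: "g * g' \<noteq> 0" using x y by simp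
  show "ord_infinity x = Pinf \<longleftrightarrow> x = 0"
    using x by (simp add: ord_infinity_Fract eq_fract Zero_fract_def)
  show "ord_infinity x \<noteq> Minf"
    using x by (simp add: ord_infinity_Fract)
  show "ord_infinity (x * y) = ord_infinity x + ord_infinity y"
    using x y by (simp add: ord_infinity_Fract degree_mult_eq)
  have "degree (f * g' + f' * g) \<le> max (degree (f * g')) (degree (f' * g))"
    by (rule degree_add_le_max)
  then show "ord_infinity (x + y) \<ge> min (ord_infinity x) (ord_infinity y)"
    using x y gg
    by (cases "f = 0"; cases "f' = 0")
       (auto simp: ord_infinity_Fract degree_mult_eq min_def max_def split: if_splits)
next
  show "\<exists>x::'a poly fract. ord_infinity x = Fin 1"
    by (rule exI[of _ "Fract 1 [:0, 1:]"]) (simp add: ord_infinity_Fract)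
qed

definition S_integers :: "('k::field \<Rightarrow> int extended) set \<Rightarrow> 'k set" where
  "S_integers S = {x. \<forall>v. is_prime_place v \<and> v \<notin> S \<longrightarrow> v x \<ge> 0}"


section \<open>Positive-existential definability\<close>

datatype pe_term = Var nat | Zero | One | Add pe_term pe_term | MulT pe_term

datatype pos_formula =
    Eq pe_term pe_term
  | Divides pe_term pe_term
  | And pos_formula pos_formula
  | Or pos_formula pos_formula

primrec term_vars :: "pe_term \<Rightarrow> nat set" where
  "term_vars (Var i) = {i}"
| "term_vars Zero = {}"
| "term_vars One = {}"
| "term_vars (Add a b) = term_vars a \<union> term_vars b"
| "term_vars (MulT a) = term_vars a"

primrec formula_vars :: "pos_formula \<Rightarrow> nat set" where
  "formula_vars (Eq a b) = term_vars a \<union> term_vars b"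
| "formula_vars (Divides a b) = term_vars a \<union> term_vars b"
| "formula_vars (And \<phi> \<psi>) = formula_vars \<phi> \<union> formula_vars \<psi>"
| "formula_vars (Or \<phi> \<psi>) = formula_vars \<phi> \<union> formula_vars \<psi>"

record 'k div_structure =
  universe :: "'k set"
  zero_const :: 'k
  one_const :: 'k
  add_fun :: "'k \<Rightarrow> 'k \<Rightarrow> 'k"
  divides_rel :: "'k \<Rightarrow> 'k \<Rightarrow> bool"
  mult_t_fun :: "'k \<Rightarrow> 'k"

primrec term_value :: "'k div_structure \<Rightarrow> (nat \<Rightarrow> 'k) \<Rightarrow> pe_term \<Rightarrow> 'k" where
  "term_value M e (Var i) = e i"
| "term_value M e Zero = zero_const M"
| "term_value M e One = one_const M"
| "term_value M e (Add a b) = add_fun M (term_value M e a) (term_value M e b)"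
| "term_value M e (MulT a) = mult_t_fun M (term_value M e a)"

primrec satisfies :: "'k div_structure \<Rightarrow> (nat \<Rightarrow> 'k) \<Rightarrow> pos_formula \<Rightarrow> bool" where
  "satisfies M e (Eq a b) \<longleftrightarrow> term_value M e a = term_value M e b"
| "satisfies M e (Divides a b) \<longleftrightarrow> divides_rel M (term_value M e a) (term_value M e b)"
| "satisfies M e (And \<phi> \<psi>) \<longleftrightarrow> satisfies M e \<phi> \<and> satisfies M e \<psi>"
| "satisfies M e (Or \<phi> \<psi>) \<longleftrightarrow> satisfies M e \<phi> \<or> satisfies M e \<psi>"

text \<open>
  Definability of a binary relation by \<open>\<exists>y\<^sub>1 \<dots> y\<^sub>m. \<theta>\<close>, where the variables 0 and 1 of \<open>\<theta>\<close> are
  free and the variables \<open>2, \<dots>, m + 1\<close> are the quantified ones. The bound on the variables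
  keeps the list access in range.
\<close>

definition pos_ex_definable2 :: "'k div_structure \<Rightarrow> ('k \<times> 'k) set \<Rightarrow> bool" where
  "pos_ex_definable2 M R \<longleftrightarrow>
     (\<exists>m \<theta>. formula_vars \<theta> \<subseteq> {..<m + 2} \<and>
        R = {(x, y). x \<in> universe M \<and> y \<in> universe M \<and>
               (\<exists>ys. length ys = m \<and> set ys \<subseteq> universe M \<and>
                  satisfies M (\<lambda>i. (x # y # ys) ! i) \<theta>)})"

definition S_integer_structure ::
  "('k::field \<Rightarrow> int extended) set \<Rightarrow> 'k \<Rightarrow> 'k div_structure" where
  "S_integer_structure S t =
     \<lparr> universe = S_integers S, zero_const = 0, one_const = 1, add_fun = (+),
       divides_rel = (\<lambda>x y. \<exists>z\<in>S_integers S. y = x * z),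
       mult_t_fun = (\<lambda>x. t * x) \<rparr>"

end

theory Submission
  imports Defs
begin

text \<open>
  Three facts about the ring \<open>R\<close> of \<open>S\<close>-integers carry the proof. First, a form of the product formula:
  if \<open>x\<close> has all its poles in \<open>P\<close> and zeros in \<open>Z\<close>, then the total degree of the zeros is at most that of the poles.
  It follows by counting the sums of \<open>x ^ j * \<tau> j\<close> with \<open>j < J\<close>, where the \<open>\<tau> j\<close> run over representatives
  modulo \<open>x\<close>, and letting \<open>J\<close> tend to infinity. Consequently, an element of \<open>R\<close> whose poles at the places of \<open>S\<close> have
  order at most \<open>h\<close> has zeros of order at most \<open>c * h\<close> there. Second, places exist in abundance, because a valuation
  ring of the field has finite quotients by the same counting and is therefore discrete. Third, since \<open>S\<close>
  has at least two elements, the pigeonhole principle yields a unit that is not a root of unity.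

  For a unit \<open>u\<close> and an element \<open>a\<close> of \<open>F[t]\<close>, the elements \<open>u\<^sup>2 - a * u\<close> and \<open>u - a\<close> are associated, and both are linear in
  \<open>u\<close> and \<open>u\<^sup>2\<close>. If conversely \<open>y - a * u\<close> and \<open>u - a\<close> are associated for many \<open>a\<close>, then the
  height of \<open>y\<close> is bounded in terms of that of \<open>u\<close>, while \<open>y - u\<^sup>2\<close> is divisible by all \<open>u - a\<close>; hence \<open>y = u\<^sup>2\<close> once
  the height of \<open>u\<close> is large. For arbitrary \<open>x\<close> and \<open>y\<close>, take a unit \<open>v \<noteq> 1\<close> such that \<open>v - 1\<close> is divisible by many
  \<open>x - a\<close> and \<open>y - a\<close>, so that \<open>v\<close> dominates \<open>x\<close> and \<open>y\<close> in height, and a power \<open>u\<close> of \<open>v\<close> obtained by repeated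
  squaring. Then \<open>y = x\<^sup>2\<close> if \<open>x - a * u\<close> divides \<open>y - a\<^sup>2 * u\<^sup>2\<close> for many \<open>a\<close>.
\<close>

text \<open>Three limits of the language shape the formula. Without a product, its only closed terms
  are polynomials in \<open>t\<close>; the test points \<open>a i\<close> and the parameters
  \<open>b\<close>, \<open>Q\<close> are taken from these, and powers of a unit are reached only by
  repeated squaring. Without negation, it cannot say that a unit differs from 1, although every
  height bound needs this because everything divides 0. A positive certificate must use parameters
  independent of \<open>x\<close>, while the unit depends on \<open>x\<close>. This is resolved by
  taking the powers \<open>r ^ p ^ k\<close> of one fixed \<open>r\<close>: by Frobenius,
  \<open>r ^ p ^ k - 1\<close> equals \<open>(r - 1) ^ p ^ k\<close>, so raising a certificate for
  \<open>r\<close> to the same power gives one for each of them. Finally, divisibility is blind to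
  the places in \<open>S\<close>, where a quotient may have arbitrary poles. The product formula
  trades poles for zeros there, at the cost of a factor \<open>c\<close>. These losses do not
  accumulate beyond fixed factors, and each is outweighed by a parameter chosen for it: the number
  \<open>L\<close> of test points, the exponent \<open>M\<close> of \<open>b\<close>, the number
  \<open>e\<close> of squarings.\<close>

definition ord_at :: "('k::field \<Rightarrow> int extended) \<Rightarrow> 'k \<Rightarrow> int" where
  "ord_at v x = (case v x of Fin n \<Rightarrow> n | _ \<Rightarrow> 0)"

text \<open>The element 0 has infinite order, but \<open>ord_at\<close> gives it the default value
  0. The disjunction restores the right meaning, so that bounds can be added and multiplied without
  excluding 0.\<close>

definition ord_ge :: "('k::field \<Rightarrow> int extended) \<Rightarrow> int \<Rightarrow> 'k \<Rightarrow> bool" where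
  "ord_ge v k x \<longleftrightarrow> x = 0 \<or> k \<le> ord_at v x"

lemma place_Fin:
  assumes "is_prime_place v" "x \<noteq> 0"
  shows "v x = Fin (ord_at v x)"
  using assms by (cases "v x") (auto simp: is_prime_place_def ord_at_def)

lemma place_0: "is_prime_place v \<Longrightarrow> v 0 = Pinf"
  unfolding is_prime_place_def by blast

lemma place_ge_iff:
  assumes "is_prime_place v"
  shows "v x \<ge> Fin k \<longleftrightarrow> ord_ge v k x"
proof (cases "x = 0")
  case True
  then have "v x = Pinf" using assms by (auto simp: is_prime_place_def)
  then show ?thesis using True by (simp add: ord_ge_def)
next
  case False
  then show ?thesis using place_Fin[OF assms False] by (simp add: ord_ge_def)
qed

lemma ord_at_mult:
  assumes "is_prime_place v" "x \<noteq> 0" "y \<noteq> 0"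
  shows "ord_at v (x * y) = ord_at v x + ord_at v y"
proof -
  have "v (x * y) = v x + v y" using assms(1) unfolding is_prime_place_def by blast
  then show ?thesis using place_Fin[OF assms(1)] assms by simp
qed

lemma ord_at_1 [simp]: "is_prime_place v \<Longrightarrow> ord_at v 1 = 0"
  using ord_at_mult[of v 1 1] by simp

lemma ord_at_inverse:
  assumes "is_prime_place v" "x \<noteq> 0"
  shows "ord_at v (inverse x) = - ord_at v x"
  using ord_at_mult[of v x "inverse x"] assms by simp

lemma ord_at_divide:
  assumes "is_prime_place v" "x \<noteq> 0" "y \<noteq> 0"
  shows "ord_at v (x / y) = ord_at v x - ord_at v y"
  using ord_at_mult[of v x "inverse y"] assms by (simp add: divide_inverse ord_at_inverse)

lemma ord_at_power:
  assumes "is_prime_place v" "x \<noteq> 0"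
  shows "ord_at v (x ^ n) = int n * ord_at v x"
  by (induction n) (use assms in \<open>auto simp: ord_at_mult algebra_simps\<close>)

lemma ord_at_prod:
  assumes "is_prime_place v" "\<And>i. i \<in> I \<Longrightarrow> f i \<noteq> 0"
  shows "ord_at v (\<Prod>i\<in>I. f i) = (\<Sum>i\<in>I. ord_at v (f i))"
  using assms(2) by (induction I rule: infinite_finite_induct) (auto simp: ord_at_mult assms(1))

lemma ord_at_uminus [simp]:
  assumes "is_prime_place v"
  shows "ord_at v (- x) = ord_at v x"
proof (cases "x = 0")
  case False
  have "ord_at v ((-1) * (-1)) = 2 * ord_at v (-1)" using assms by (subst ord_at_mult) auto
  then have "ord_at v (-1) = 0" using assms by simp
  then show ?thesis using ord_at_mult[of v "-1" x] assms False by simp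
qed simp

lemma ord_ge_0 [simp]: "ord_ge v k 0"
  by (simp add: ord_ge_def)

lemma ord_ge_1 [simp]: "is_prime_place v \<Longrightarrow> ord_ge v 0 1"
  by (simp add: ord_ge_def)

lemma ord_ge_mono: "ord_ge v k x \<Longrightarrow> l \<le> k \<Longrightarrow> ord_ge v l x"
  by (auto simp: ord_ge_def)

lemma ord_ge_add:
  assumes "is_prime_place v" "ord_ge v k x" "ord_ge v k y"
  shows "ord_ge v k (x + y)"
proof -
  have "v (x + y) \<ge> min (v x) (v y)" using assms(1) unfolding is_prime_place_def by blast
  moreover have "v x \<ge> Fin k" "v y \<ge> Fin k" using assms by (auto simp: place_ge_iff)
  ultimately have "v (x + y) \<ge> Fin k" by (metis min_def order_trans)
  then show ?thesis using assms(1) by (simp add: place_ge_iff)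
qed

lemma ord_ge_uminus:
  assumes "is_prime_place v" "ord_ge v k x"
  shows "ord_ge v k (- x)"
  using assms by (auto simp: ord_ge_def)

lemma ord_ge_diff:
  assumes "is_prime_place v" "ord_ge v k x" "ord_ge v k y"
  shows "ord_ge v k (x - y)"
  using ord_ge_add[OF assms(1,2), of "- y"] ord_ge_uminus[OF assms(1,3)] by simp

lemma ord_ge_mult:
  assumes "is_prime_place v" "ord_ge v k x" "ord_ge v l y"
  shows "ord_ge v (k + l) (x * y)"
  using assms by (cases "x = 0 \<or> y = 0") (auto simp: ord_ge_def ord_at_mult)

lemma ord_ge_mult0:
  assumes "is_prime_place v" "ord_ge v k x" "ord_ge v 0 y"
  shows "ord_ge v k (x * y)" "ord_ge v k (y * x)"
  using ord_ge_mult[OF assms] by (simp_all add: mult.commute)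

lemma ord_ge_mult_iff:
  assumes "is_prime_place v" "x \<noteq> 0"
  shows "ord_ge v k (x * y) \<longleftrightarrow> ord_ge v (k - ord_at v x) y"
  using assms by (cases "y = 0") (auto simp: ord_ge_def ord_at_mult)

lemma ord_ge_power:
  assumes "is_prime_place v" "ord_ge v 0 x"
  shows "ord_ge v 0 (x ^ n)"
  by (induction n) (use assms ord_ge_mult[of v 0 _ 0] in auto)

lemma ord_ge_sum:
  assumes "is_prime_place v" "\<And>i. i \<in> I \<Longrightarrow> ord_ge v k (f i)"
  shows "ord_ge v k (\<Sum>i\<in>I. f i)"
  using assms(2) by (induction I rule: infinite_finite_induct) (auto intro: ord_ge_add assms(1))

text \<open>The strict case of the triangle inequality: were the order of the sum larger,
  subtracting \<open>y\<close> would make the order of \<open>x\<close> too large.\<close>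

lemma ord_at_add_eq:
  assumes "is_prime_place v" "x \<noteq> 0" "ord_ge v (ord_at v x + 1) y"
  shows "x + y \<noteq> 0" "ord_at v (x + y) = ord_at v x"
proof -
  show nz: "x + y \<noteq> 0"
  proof
    assume "x + y = 0"
    then have "x = - y" by (simp add: eq_neg_iff_add_eq_0)
    then show False using assms by (auto simp: ord_ge_def)
  qed
  have "ord_ge v (ord_at v x) (x + y)"
    using assms by (intro ord_ge_add) (auto simp: ord_ge_def)
  moreover have "\<not> ord_at v (x + y) \<ge> ord_at v x + 1"
  proof
    assume "ord_at v (x + y) \<ge> ord_at v x + 1"
    then have "ord_ge v (ord_at v x + 1) (x + y - y)"
      using assms by (intro ord_ge_diff) (auto simp: ord_ge_def)
    then show False using assms by (simp add: ord_ge_def)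
  qed
  ultimately show "ord_at v (x + y) = ord_at v x" using nz by (auto simp: ord_ge_def)
qed

lemma uniformizer_exists:
  assumes "is_prime_place v"
  obtains x where "x \<noteq> 0" "ord_at v x = 1"
proof -
  obtain x where x: "v x = Fin 1" using assms unfolding is_prime_place_def by blast
  then have "x \<noteq> 0" using place_0[OF assms] by auto
  then show ?thesis using that x by (simp add: ord_at_def)
qed

lemma ord_at_powi:
  assumes "is_prime_place v" "x \<noteq> 0"
  shows "ord_at v (x powi k) = k * ord_at v x"
proof (cases "k \<ge> 0")
  case True
  then show ?thesis using assms by (simp add: power_int_def ord_at_power)
next
  case False
  then show ?thesis using assms by (simp add: power_int_def ord_at_power ord_at_inverse)
qed

lemma member_le_double_sum:
  fixes f :: "'a \<Rightarrow> 'b \<Rightarrow> 'c::{semiring_1, ordered_comm_monoid_add}"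
  assumes "finite I" "finite J" "i \<in> I" "j \<in> J" "\<And>i j. f i j \<ge> 0"
  shows "f i j \<le> (\<Sum>i\<in>I. \<Sum>j\<in>J. f i j)"
proof -
  have "f i j \<le> (\<Sum>j\<in>J. f i j)" using assms by (intro member_le_sum) auto
  also have "\<dots> \<le> (\<Sum>i\<in>I. \<Sum>j\<in>J. f i j)"
    using assms by (intro member_le_sum[of i I "\<lambda>i. \<Sum>j\<in>J. f i j"] sum_nonneg) auto
  finally show ?thesis .
qed

section \<open>Weak approximation\<close>

text \<open>A discrete valuation ring is a maximal proper subring, so inclusion is already equality.
  Units at \<open>v\<close> are units at \<open>w\<close>, hence \<open>ord_at w\<close> is the
  multiple of \<open>ord_at v\<close> by \<open>ord_at w p\<close>; as \<open>w\<close> is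
  normalized, this factor is 1.\<close>

lemma place_eqI:
  assumes v: "is_prime_place v" and w: "is_prime_place w"
    and sub: "\<And>x. ord_ge v 0 x \<Longrightarrow> ord_ge w 0 x"
  shows "v = w"
proof -
  have units: "ord_at w x = 0" if "x \<noteq> 0" "ord_at v x = 0" for x
  proof -
    have "ord_ge w 0 x" "ord_ge w 0 (inverse x)"
      by (rule sub, use that v in \<open>simp add: ord_ge_def ord_at_inverse\<close>)+
    then show ?thesis using that w by (auto simp: ord_ge_def ord_at_inverse)
  qed
  obtain p where p: "p \<noteq> 0" "ord_at v p = 1" using uniformizer_exists[OF v] .
  have eq: "ord_at w x = ord_at v x * ord_at w p" if "x \<noteq> 0" for x
  proof -
    have "ord_at w (x / p powi (ord_at v x)) = 0"
      using that p v by (intro units) (auto simp: ord_at_divide ord_at_powi)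
    then show ?thesis using that p w by (simp add: ord_at_divide ord_at_powi)
  qed
  have "ord_ge w 0 p" using p by (intro sub) (simp add: ord_ge_def)
  then have pos: "ord_at w p \<ge> 0" using p by (simp add: ord_ge_def)
  obtain q where q: "q \<noteq> 0" "ord_at w q = 1" using uniformizer_exists[OF w] .
  have "ord_at v q * ord_at w p = 1" using eq[OF q(1)] q(2) by simp
  then have "ord_at w p = 1" using pos by (subst (asm) zmult_eq_1_iff) auto
  then have same: "ord_at w x = ord_at v x" if "x \<noteq> 0" for x using eq[OF that] by simp
  show ?thesis
  proof
    fix x show "v x = w x"
    proof (cases "x = 0")
      case True
      then show ?thesis using place_0[OF v] place_0[OF w] by simp
    next
      case False
      then show ?thesis using place_Fin[OF v False] place_Fin[OF w False] same by simp
    qed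
  qed
qed

text \<open>Neither valuation ring contains the other; an element of each that the other lacks gives
  the quotient.\<close>

lemma two_places:
  assumes v: "is_prime_place v" and w: "is_prime_place w" and "v \<noteq> w"
  obtains y where "y \<noteq> 0" "ord_at v y < 0" "ord_at w y > 0"
proof -
  obtain a where a: "ord_ge v 0 a" "\<not> ord_ge w 0 a" using place_eqI[OF v w] assms by blast
  obtain b where b: "ord_ge w 0 b" "\<not> ord_ge v 0 b" using place_eqI[OF w v] assms by blast
  have nz: "a \<noteq> 0" "b \<noteq> 0" using a b by auto
  then have "ord_at v (b / a) < 0" "ord_at w (b / a) > 0"
    using a b v w by (auto simp: ord_at_divide ord_ge_def)
  then show ?thesis using that[of "b / a"] nz by simp
qed

text \<open>The quotient \<open>y ^ m / (1 + y ^ m)\<close> is the classical switch: for large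
  \<open>m\<close> it is close to 1 where \<open>y\<close> has a pole and, by the next lemma, close
  to 0 where \<open>y\<close> has a zero.\<close>

lemma power_quotient_approx:
  assumes v: "is_prime_place v" and y: "y \<noteq> 0" "ord_at v y < 0" and "m > 0"
  shows "1 + y ^ m \<noteq> 0" "ord_at v (y ^ m / (1 + y ^ m)) = 0"
    "ord_ge v (int m) (y ^ m / (1 + y ^ m) - 1)"
proof -
  have "ord_ge v (ord_at v (y ^ m) + 1) 1"
    using assms mult_pos_neg[of "int m" "ord_at v y"] by (simp add: ord_ge_def ord_at_power)
  then have *: "y ^ m + 1 \<noteq> 0" "ord_at v (y ^ m + 1) = ord_at v (y ^ m)"
    using ord_at_add_eq[OF v, of "y ^ m" 1] y by auto
  then show nz: "1 + y ^ m \<noteq> 0" by (simp add: add.commute)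
  show "ord_at v (y ^ m / (1 + y ^ m)) = 0"
    using * y v nz by (simp add: ord_at_divide add.commute)
  have "y ^ m / (1 + y ^ m) - 1 = - (1 / (1 + y ^ m))"
    using nz by (simp add: field_simps)
  moreover have "ord_ge v (int m) (1 / (1 + y ^ m))"
  proof -
    have "ord_at v (1 / (1 + y ^ m)) = - (int m * ord_at v y)"
      using * y v nz by (simp add: ord_at_divide ord_at_power add.commute)
    moreover have "int m * (- ord_at v y) \<ge> int m * 1"
      using y by (intro mult_left_mono) auto
    ultimately show ?thesis by (simp add: ord_ge_def)
  qed
  ultimately show "ord_ge v (int m) (y ^ m / (1 + y ^ m) - 1)"
    using ord_ge_uminus[OF v] by simp
qed

lemma power_quotient_small:
  assumes v: "is_prime_place v" and y: "y \<noteq> 0" "ord_at v y > 0" and "m > 0"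
  shows "ord_ge v (int m) (y ^ m / (1 + y ^ m))"
proof -
  have pos: "int m * ord_at v y > 0" using assms by simp
  then have *: "1 + y ^ m \<noteq> 0" "ord_at v (1 + y ^ m) = 0"
    using ord_at_add_eq[OF v, of 1 "y ^ m"] v y by (auto simp: ord_ge_def ord_at_power)
  have "int m * ord_at v y \<ge> int m * 1"
    using y by (intro mult_left_mono) auto
  then show ?thesis using * y v by (auto simp: ord_ge_def ord_at_divide ord_at_power)
qed

lemma separating_element:
  assumes "finite Z" "\<forall>w\<in>Z. is_prime_place w" "is_prime_place v" "v \<notin> Z"
  shows "\<exists>y. y \<noteq> 0 \<and> ord_at v y < 0 \<and> (\<forall>w\<in>Z. ord_at w y > 0)"
  using assms
proof (induction Z rule: finite_induct)
  case empty
  obtain p where "p \<noteq> 0" "ord_at v p = 1" using uniformizer_exists empty by metis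
  then have "ord_at v (inverse p) < 0" using empty by (simp add: ord_at_inverse)
  then show ?case using \<open>p \<noteq> 0\<close> by (intro exI[of _ "inverse p"]) simp
next
  case (insert u Z)
  note v = \<open>is_prime_place v\<close>
  have u: "is_prime_place u" using insert by simp
  obtain y where y: "y \<noteq> 0" "ord_at v y < 0" "\<forall>w\<in>Z. ord_at w y > 0"
    using insert by auto
  obtain z where z: "z \<noteq> 0" "ord_at v z < 0" "ord_at u z > 0"
    using two_places[OF v u] insert by auto
  \<comment> \<open>Large enough for zeros of order \<open>m\<close> to outweigh the poles of
    \<open>z\<close> on \<open>Z\<close>.\<close>
  define m where "m = nat (1 + (\<Sum>w\<in>Z. \<bar>ord_at w z\<bar>))"
  have m0: "m > 0" unfolding m_def by (simp add: add_pos_nonneg sum_nonneg)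
  have m: "int m > \<bar>ord_at w z\<bar>" if "w \<in> Z" for w
  proof -
    have "\<bar>ord_at w z\<bar> \<le> (\<Sum>w\<in>Z. \<bar>ord_at w z\<bar>)"
      using insert(1) that by (intro member_le_sum) auto
    then show ?thesis unfolding m_def by (simp add: sum_nonneg)
  qed
  show ?case
  proof (cases "ord_at u y" "0::int" rule: linorder_cases)
    case greater
    then show ?thesis using y by auto
  next
    case equal
    have "ord_at w (y ^ m * z) > 0" if "w \<in> Z" for w
    proof -
      have w: "is_prime_place w" using insert that by simp
      have "int m * ord_at w y \<ge> int m * 1" using y that by (intro mult_left_mono) auto
      then show ?thesis using m[OF that] y z w by (simp add: ord_at_mult ord_at_power)
    qed
    moreover have "ord_at u (y ^ m * z) > 0"
      using equal y z u by (simp add: ord_at_mult ord_at_power)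
    moreover have "ord_at v (y ^ m * z) < 0"
      using y z v by (simp add: ord_at_mult ord_at_power add_nonpos_neg mult_nonneg_nonpos)
    ultimately show ?thesis using y z by (intro exI[of _ "y ^ m * z"]) auto
  next
    case less
    \<comment> \<open>Here \<open>y\<close> has a pole at \<open>u\<close> as well as at
      \<open>v\<close>. The switch has order 0 at both and preserves the signs that \<open>z\<close>
      has there, while still supplying zeros on \<open>Z\<close>.\<close>
    let ?q = "y ^ m / (1 + y ^ m)"
    have nz: "?q \<noteq> 0" using power_quotient_approx(1)[OF u y(1) less m0] y by simp
    have "ord_at w (?q * z) > 0" if "w \<in> Z" for w
    proof -
      have w: "is_prime_place w" using insert that by simp
      have "ord_at w ?q \<ge> int m"
        using power_quotient_small[OF w y(1) _ m0] y that nz by (simp add: ord_ge_def)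
      then show ?thesis using m[OF that] ord_at_mult[OF w nz z(1)] by linarith
    qed
    moreover have "ord_at u (?q * z) > 0"
      using power_quotient_approx(2)[OF u y(1) less m0] z ord_at_mult[OF u nz z(1)] by linarith
    moreover have "ord_at v (?q * z) < 0"
      using power_quotient_approx(2)[OF v y(1,2) m0] z ord_at_mult[OF v nz z(1)] by linarith
    ultimately show ?thesis using nz z by (intro exI[of _ "?q * z"]) auto
  qed
qed

text \<open>Each \<open>\<theta> v\<close> is close to 1 at \<open>v\<close> and close to 0 on the
  rest of \<open>Z\<close>, so the sum of the \<open>f v * \<theta> v\<close> interpolates. The
  exponent \<open>M\<close> exceeds \<open>N\<close> by enough to absorb the poles of all
  \<open>f v\<close>.\<close>

lemma weak_approximation:
  fixes f :: "('k::field \<Rightarrow> int extended) \<Rightarrow> 'k" and N :: int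
  assumes fin: "finite Z" and Z: "\<forall>v\<in>Z. is_prime_place v"
  shows "\<exists>y. \<forall>v\<in>Z. ord_ge v N (y - f v)"
proof -
  define M where "M = nat (1 + \<bar>N\<bar> + (\<Sum>v\<in>Z. \<Sum>w\<in>Z. \<bar>ord_at w (f v)\<bar>))"
  have nonneg: "(\<Sum>v\<in>Z. \<Sum>w\<in>Z. \<bar>ord_at w (f v)\<bar>) \<ge> 0" by (intro sum_nonneg) auto
  then have M0: "M > 0" unfolding M_def by linarith
  have M: "ord_ge w (N - int M) (f v)" if "v \<in> Z" "w \<in> Z" for v w
  proof -
    have "\<bar>ord_at w (f v)\<bar> \<le> (\<Sum>v\<in>Z. \<Sum>w\<in>Z. \<bar>ord_at w (f v)\<bar>)"
      using fin that by (intro member_le_double_sum) auto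
    then show ?thesis unfolding M_def ord_ge_def by linarith
  qed
  have "\<exists>y. y \<noteq> 0 \<and> ord_at v y < 0 \<and> (\<forall>w\<in>Z - {v}. ord_at w y > 0)" if "v \<in> Z" for v
    using fin Z that by (intro separating_element) auto
  then obtain y where y: "\<And>v. v \<in> Z \<Longrightarrow> y v \<noteq> 0 \<and> ord_at v (y v) < 0 \<and> (\<forall>w\<in>Z - {v}. ord_at w (y v) > 0)"
    by metis
  define \<theta> where "\<theta> v = y v ^ M / (1 + y v ^ M)" for v
  have near: "ord_ge v (int M) (\<theta> v - 1)" if "v \<in> Z" for v
    unfolding \<theta>_def using power_quotient_approx(3) y that Z M0 by blast
  have far: "ord_ge w (int M) (\<theta> v)" if "v \<in> Z" "w \<in> Z" "w \<noteq> v" for v w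
    unfolding \<theta>_def using power_quotient_small y[OF that(1)] that Z M0 by blast
  show ?thesis
  proof (intro exI[of _ "\<Sum>v\<in>Z. f v * \<theta> v"] ballI)
    fix w assume w: "w \<in> Z"
    then have pw: "is_prime_place w" using Z by simp
    have "(\<Sum>v\<in>Z. f v * \<theta> v) - f w = f w * (\<theta> w - 1) + (\<Sum>v\<in>Z - {w}. f v * \<theta> v)"
      using fin w by (subst sum.remove[of _ w]) (auto simp: algebra_simps)
    moreover have "ord_ge w N (f w * (\<theta> w - 1))"
      using ord_ge_mult[OF pw M[OF w w] near[OF w]] by simp
    moreover have "ord_ge w N (\<Sum>v\<in>Z - {w}. f v * \<theta> v)"
    proof (intro ord_ge_sum[OF pw])
      fix v assume "v \<in> Z - {w}"
      then show "ord_ge w N (f v * \<theta> v)"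
        using ord_ge_mult[OF pw M[of v w] far[of v w]] w by auto
    qed
    ultimately show "ord_ge w N ((\<Sum>v\<in>Z. f v * \<theta> v) - f w)"
      using ord_ge_add[OF pw] by simp
  qed
qed

section \<open>Counting in a finite extension of the rational function field\<close>

text \<open>Constant factors do not survive the passage to large powers. This is what turns the
  rough counts below into inequalities without constants.\<close>

lemma pow_growth_le:
  fixes a b c :: nat
  assumes "\<And>J. a ^ J \<le> c * b ^ J"
  shows "a \<le> b"
proof (rule ccontr)
  assume "\<not> a \<le> b"
  then have ab: "b < a" by simp
  show False
  proof (cases "b = 0")
    case True
    then show False using assms[of 1] ab by simp
  next
    case False
    then have "real a / real b > 1" using ab by simp
    then obtain J where J: "(real a / real b) ^ J > real c" using real_arch_pow by blast
    have "real (a ^ J) \<le> real (c * b ^ J)" using assms[of J] by (subst of_nat_le_iff)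
    then show False using J False by (simp add: power_divide field_simps)
  qed
qed

lemma card_degree_le:
  "finite {f :: 'p::prime_card mod_ring poly. degree f \<le> m}"
  "card {f :: 'p::prime_card mod_ring poly. degree f \<le> m} \<le> CARD('p) ^ (m + 1)"
proof -
  let ?L = "{xs :: 'p mod_ring list. set xs \<subseteq> UNIV \<and> length xs = m + 1}"
  have sub: "{f :: 'p mod_ring poly. degree f \<le> m} \<subseteq> Poly ` ?L"
  proof
    fix f :: "'p mod_ring poly" assume "f \<in> {f. degree f \<le> m}"
    then have "f = Poly (map (coeff f) [0..<m + 1])"
      by (intro poly_eqI) (auto simp: nth_default_def coeff_eq_0 simp del: upt_Suc)
    then show "f \<in> Poly ` ?L" by (intro image_eqI[of _ _ "map (coeff f) [0..<m + 1]"]) auto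
  qed
  have fin: "finite ?L" by (intro finite_lists_length_eq) simp
  show "finite {f :: 'p mod_ring poly. degree f \<le> m}"
    using finite_subset[OF sub] fin by simp
  have "card {f :: 'p mod_ring poly. degree f \<le> m} \<le> card (Poly ` ?L)"
    using sub fin by (intro card_mono) auto
  also have "\<dots> \<le> card ?L" using fin by (rule card_image_le)
  also have "\<dots> = CARD('p) ^ (m + 1)"
    by (subst card_lists_length_eq) auto
  finally show "card {f :: 'p mod_ring poly. degree f \<le> m} \<le> CARD('p) ^ (m + 1)" .
qed

section \<open>Subrings and expansions with digits in a set of representatives\<close>

definition is_subring :: "'k::field set \<Rightarrow> bool" where
  "is_subring A \<longleftrightarrow> 1 \<in> A \<and> (\<forall>x\<in>A. \<forall>y\<in>A. x - y \<in> A \<and> x * y \<in> A)"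

lemma is_subringD:
  assumes "is_subring A"
  shows "1 \<in> A" "0 \<in> A" "x \<in> A \<Longrightarrow> - x \<in> A"
    "x \<in> A \<Longrightarrow> y \<in> A \<Longrightarrow> x - y \<in> A" "x \<in> A \<Longrightarrow> y \<in> A \<Longrightarrow> x + y \<in> A"
    "x \<in> A \<Longrightarrow> y \<in> A \<Longrightarrow> x * y \<in> A" "x \<in> A \<Longrightarrow> x ^ n \<in> A"
proof -
  show 1: "1 \<in> A" and d: "\<And>x y. x \<in> A \<Longrightarrow> y \<in> A \<Longrightarrow> x - y \<in> A"
    and m: "\<And>x y. x \<in> A \<Longrightarrow> y \<in> A \<Longrightarrow> x * y \<in> A"
    using assms by (auto simp: is_subring_def)
  show 0: "0 \<in> A" using d[OF 1 1] by simp
  show n: "\<And>x. x \<in> A \<Longrightarrow> - x \<in> A" using d[OF 0] by fastforce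
  show "x \<in> A \<Longrightarrow> y \<in> A \<Longrightarrow> x + y \<in> A" using d[OF _ n, of x y] by simp
  show "x \<in> A \<Longrightarrow> x ^ n \<in> A" by (induction n) (use 1 m in auto)
qed

lemma is_subring_sum:
  assumes "is_subring A" "\<And>i. i \<in> I \<Longrightarrow> f i \<in> A"
  shows "(\<Sum>i\<in>I. f i) \<in> A"
  using assms(2) by (induction I rule: infinite_finite_induct) (auto intro: is_subringD assms(1))

lemma is_subring_prod:
  assumes "is_subring A" "\<And>i. i \<in> I \<Longrightarrow> f i \<in> A"
  shows "(\<Prod>i\<in>I. f i) \<in> A"
  using assms(2) by (induction I rule: infinite_finite_induct) (auto intro: is_subringD assms(1))

definition incongruent :: "'k::field set \<Rightarrow> 'k \<Rightarrow> 'k set \<Rightarrow> bool" where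
  "incongruent A z T \<longleftrightarrow> (\<forall>x\<in>T. \<forall>y\<in>T. x \<noteq> y \<longrightarrow> (\<forall>a\<in>A. x - y \<noteq> z * a))"

text \<open>Uniqueness of digits in base \<open>z\<close>: modulo \<open>z\<close> only the lowest
  digit remains, and incongruent digits are told apart by their classes. Cancelling it and dividing
  by \<open>z\<close> shortens the sum.\<close>

lemma expansion_unique:
  assumes A: "is_subring A" and z: "z \<in> A" "z \<noteq> 0" and T: "T \<subseteq> A" "incongruent A z T"
    and "\<forall>j<J. f j \<in> T" "\<forall>j<J. g j \<in> T"
    and "(\<Sum>j<J. z ^ j * f j) = (\<Sum>j<J. z ^ j * g j)"
  shows "\<forall>j<J. f j = g j"
  using assms(6-)
proof (induction J arbitrary: f g)
  case (Suc J)
  have shift: "(\<Sum>j<Suc J. z ^ j * h j) = h 0 + z * (\<Sum>j<J. z ^ j * h (Suc j))" for h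
    by (subst sum.lessThan_Suc_shift) (simp add: sum_distrib_left mult.assoc)
  let ?F = "\<Sum>j<J. z ^ j * f (Suc j)" and ?G = "\<Sum>j<J. z ^ j * g (Suc j)"
  have eq: "f 0 + z * ?F = g 0 + z * ?G" using Suc.prems(3) unfolding shift .
  have "?G - ?F \<in> A"
    using Suc.prems T z by (intro is_subringD(4,6,7)[OF A] is_subring_sum[OF A]) auto
  moreover have "f 0 - g 0 = z * (?G - ?F)" using eq by (simp add: algebra_simps)
  ultimately have 0: "f 0 = g 0" using T(2) Suc.prems unfolding incongruent_def by blast
  then have "?F = ?G" using eq z by simp
  then have "\<forall>j<J. f (Suc j) = g (Suc j)"
    using Suc.prems by (intro Suc.IH[of "\<lambda>j. f (Suc j)" "\<lambda>j. g (Suc j)"]) auto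
  then show ?case using 0 by (metis less_Suc_eq_0_disj)
qed simp

definition expansions :: "'k::field \<Rightarrow> 'k set \<Rightarrow> nat \<Rightarrow> 'k set" where
  "expansions z T J = (\<lambda>f. \<Sum>j<J. z ^ j * f j) ` ({..<J} \<rightarrow>\<^sub>E T)"

lemma card_expansions:
  assumes "is_subring A" "z \<in> A" "z \<noteq> 0" "T \<subseteq> A" "incongruent A z T" "finite T"
  shows "finite (expansions z T J)" "card (expansions z T J) = card T ^ J"
proof -
  show "finite (expansions z T J)"
    unfolding expansions_def using assms by (intro finite_imageI finite_PiE) auto
  have "inj_on (\<lambda>f. \<Sum>j<J. z ^ j * f j) ({..<J} \<rightarrow>\<^sub>E T)"
  proof (rule inj_onI)
    fix f g assume f: "f \<in> {..<J} \<rightarrow>\<^sub>E T" and g: "g \<in> {..<J} \<rightarrow>\<^sub>E T"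
      and eq: "(\<Sum>j<J. z ^ j * f j) = (\<Sum>j<J. z ^ j * g j)"
    have "\<forall>j<J. f j = g j"
      using f g by (intro expansion_unique[OF assms(1-5) _ _ eq]) (auto simp: PiE_def)
    then show "f = g" using f g by (intro PiE_ext[OF f g]) auto
  qed
  then have "card (expansions z T J) = card ({..<J} \<rightarrow>\<^sub>E T)"
    unfolding expansions_def by (rule card_image)
  then show "card (expansions z T J) = card T ^ J" by (simp add: card_PiE)
qed

section \<open>Finite extensions of the rational function field, counted by degrees of
  polynomials\<close>

locale function_field = comm_ring_hom \<phi>
  for \<phi> :: "'p::prime_card mod_ring poly \<Rightarrow> 'k::field" +
  fixes B :: "'k set"
  assumes emb_eq_0: "\<phi> f = 0 \<Longrightarrow> f = 0"
    and finite_B: "finite B"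
    and span_B: "\<exists>D c. D \<noteq> 0 \<and> \<phi> D * y = (\<Sum>b\<in>B. \<phi> (c b) * b)"
begin

lemma emb_eq_0_iff [simp]: "\<phi> f = 0 \<longleftrightarrow> f = 0"
  using emb_eq_0 by auto

lemma emb_inj: "\<phi> f = \<phi> g \<longleftrightarrow> f = g"
  using emb_eq_0_iff[of "f - g"] by (simp add: hom_minus)

lemma emb_pCons: "\<phi> (pCons c f) = \<phi> [:c:] + \<phi> [:0, 1:] * \<phi> f"
proof -
  have "pCons c f = [:c:] + [:0, 1:] * f" by simp
  then show ?thesis by (metis hom_add hom_mult)
qed

text \<open>A finite box of elements with common denominator \<open>D\<close>. It stands in for a
  Riemann-Roch space; only an upper bound on its size is ever used.\<close>

definition lattice :: "'p mod_ring poly \<Rightarrow> nat \<Rightarrow> 'k set" where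
  "lattice D m = {y. \<exists>c. (\<forall>b\<in>B. degree (c b) \<le> m) \<and> \<phi> D * y = (\<Sum>b\<in>B. \<phi> (c b) * b)}"

lemma latticeI:
  "(\<And>b. b \<in> B \<Longrightarrow> degree (c b) \<le> m) \<Longrightarrow> \<phi> D * y = (\<Sum>b\<in>B. \<phi> (c b) * b) \<Longrightarrow> y \<in> lattice D m"
  by (auto simp: lattice_def)

lemma latticeE:
  assumes "y \<in> lattice D m"
  obtains c where "\<forall>b\<in>B. degree (c b) \<le> m" "\<phi> D * y = (\<Sum>b\<in>B. \<phi> (c b) * b)"
  using assms by (auto simp: lattice_def)

lemma card_lattice:
  assumes "D \<noteq> 0"
  shows "finite (lattice D m)" "card (lattice D m) \<le> CARD('p) ^ (card B * (m + 1))"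
proof -
  let ?P = "{f :: 'p mod_ring poly. degree f \<le> m}"
  let ?F = "\<lambda>c. (\<Sum>b\<in>B. \<phi> (c b) * b) / \<phi> D"
  have sub: "lattice D m \<subseteq> ?F ` (B \<rightarrow>\<^sub>E ?P)"
  proof
    fix y assume "y \<in> lattice D m"
    then obtain c where c: "\<forall>b\<in>B. degree (c b) \<le> m" "\<phi> D * y = (\<Sum>b\<in>B. \<phi> (c b) * b)"
      by (rule latticeE)
    have "y = ?F (restrict c B)" using c assms by (simp add: field_simps)
    then show "y \<in> ?F ` (B \<rightarrow>\<^sub>E ?P)" using c by (intro image_eqI[of _ _ "restrict c B"]) auto
  qed
  have fin: "finite (B \<rightarrow>\<^sub>E ?P)" using finite_B card_degree_le(1) by (intro finite_PiE) auto
  then show "finite (lattice D m)" using sub by (meson finite_imageI finite_subset)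
  have "card (lattice D m) \<le> card (B \<rightarrow>\<^sub>E ?P)"
    using sub fin by (meson card_image_le card_mono finite_imageI le_trans)
  also have "\<dots> = card ?P ^ card B" using finite_B by (simp add: card_PiE)
  also have "\<dots> \<le> (CARD('p) ^ (m + 1)) ^ card B"
    by (intro power_mono card_degree_le(2)) simp
  finally show "card (lattice D m) \<le> CARD('p) ^ (card B * (m + 1))"
    by (simp only: power_mult[symmetric] mult.commute)
qed

lemma lattice_mono: "m \<le> n \<Longrightarrow> lattice D m \<subseteq> lattice D n"
  unfolding lattice_def by (intro Collect_mono) (metis le_trans)

lemma lattice_0: "0 \<in> lattice D m"
  unfolding lattice_def by (auto intro!: exI[of _ "\<lambda>_. 0"])

lemma lattice_add:
  assumes "x \<in> lattice D m" "y \<in> lattice D m"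
  shows "x + y \<in> lattice D m"
proof -
  obtain c where c: "\<forall>b\<in>B. degree (c b) \<le> m" "\<phi> D * x = (\<Sum>b\<in>B. \<phi> (c b) * b)"
    using assms(1) by (rule latticeE)
  obtain d where d: "\<forall>b\<in>B. degree (d b) \<le> m" "\<phi> D * y = (\<Sum>b\<in>B. \<phi> (d b) * b)"
    using assms(2) by (rule latticeE)
  show ?thesis using c d
    by (intro latticeI[of "\<lambda>b. c b + d b"])
       (auto simp: degree_add_le hom_add distrib_left distrib_right sum.distrib)
qed

lemma lattice_sum: "(\<And>i. i \<in> I \<Longrightarrow> f i \<in> lattice D m) \<Longrightarrow> (\<Sum>i\<in>I. f i) \<in> lattice D m"
  by (induction I rule: infinite_finite_induct) (auto intro: lattice_0 lattice_add)

lemma lattice_denom: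
  assumes "y \<in> lattice D m"
  shows "y \<in> lattice (E * D) (m + degree E)"
proof -
  obtain c where c: "\<forall>b\<in>B. degree (c b) \<le> m" "\<phi> D * y = (\<Sum>b\<in>B. \<phi> (c b) * b)"
    using assms by (rule latticeE)
  have "degree (E * c b) \<le> m + degree E" if "b \<in> B" for b
    using degree_mult_le[of E "c b"] c that by fastforce
  moreover have "\<phi> (E * D) * y = (\<Sum>b\<in>B. \<phi> (E * c b) * b)"
    using c by (simp add: hom_mult mult.assoc sum_distrib_left)
  ultimately show ?thesis by (rule latticeI)
qed

text \<open>The \<open>M b b'\<close> form the matrix of multiplication by \<open>x\<close> on
  \<open>B\<close>, cleared of the common denominator \<open>E\<close>. Since \<open>E\<close> and
  \<open>a\<close> depend on \<open>x\<close> alone, the box needed for \<open>x ^ j\<close> grows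
  linearly in \<open>j\<close>.\<close>

lemma lattice_mult:
  fixes x :: 'k
  shows "\<exists>E a. E \<noteq> 0 \<and> (\<forall>D m y. y \<in> lattice D m \<longrightarrow> x * y \<in> lattice (E * D) (m + a))"
proof -
  obtain D c where Dc: "\<And>y. D y \<noteq> 0 \<and> \<phi> (D y) * y = (\<Sum>b\<in>B. \<phi> (c y b) * b)"
    using span_B by metis
  define E where "E = (\<Prod>b\<in>B. D (x * b))"
  define M where "M b b' = (\<Prod>b\<in>B - {b}. D (x * b)) * c (x * b) b'" for b b'
  define a where "a = (\<Sum>b\<in>B. \<Sum>b'\<in>B. degree (M b b'))"
  have E: "E \<noteq> 0" unfolding E_def using Dc finite_B by simp
  have degM: "degree (M b b') \<le> a" if "b \<in> B" "b' \<in> B" for b b'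
    unfolding a_def using finite_B that by (intro member_le_double_sum) auto
  have M: "\<phi> E * (x * b) = (\<Sum>b'\<in>B. \<phi> (M b b') * b')" if "b \<in> B" for b
  proof -
    have "E = (\<Prod>b\<in>B - {b}. D (x * b)) * D (x * b)"
      unfolding E_def using finite_B that by (subst prod.remove[of _ b]) auto
    then show ?thesis using Dc[of "x * b"]
      by (simp add: M_def hom_mult mult.assoc sum_distrib_left)
  qed
  have "x * y \<in> lattice (E * D') (m + a)" if y: "y \<in> lattice D' m" for D' m y
  proof -
    obtain d where d: "\<forall>b\<in>B. degree (d b) \<le> m" "\<phi> D' * y = (\<Sum>b\<in>B. \<phi> (d b) * b)"
      using y by (rule latticeE)
    define e where "e b' = (\<Sum>b\<in>B. d b * M b b')" for b'
    have "degree (e b') \<le> m + a" if "b' \<in> B" for b'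
      unfolding e_def
    proof (intro degree_sum_le finite_B)
      fix b assume "b \<in> B"
      then show "degree (d b * M b b') \<le> m + a"
        using degree_mult_le[of "d b" "M b b'"] d(1) degM[of b b'] that by fastforce
    qed
    moreover have "\<phi> (E * D') * (x * y) = (\<Sum>b'\<in>B. \<phi> (e b') * b')"
    proof -
      have "\<phi> (E * D') * (x * y) = \<phi> E * x * (\<phi> D' * y)" by (simp add: hom_mult algebra_simps)
      also have "\<dots> = (\<Sum>b\<in>B. \<phi> (d b) * (\<phi> E * (x * b)))"
        unfolding d(2) by (simp add: sum_distrib_left mult_ac)
      also have "\<dots> = (\<Sum>b\<in>B. \<Sum>b'\<in>B. \<phi> (d b * M b b') * b')"
        by (intro sum.cong refl) (simp only: M sum_distrib_left hom_mult mult.assoc)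
      also have "\<dots> = (\<Sum>b'\<in>B. \<Sum>b\<in>B. \<phi> (d b * M b b') * b')" by (rule sum.swap)
      also have "\<dots> = (\<Sum>b'\<in>B. \<phi> (e b') * b')"
        by (simp add: e_def hom_sum sum_distrib_right)
      finally show ?thesis .
    qed
    ultimately show ?thesis by (rule latticeI)
  qed
  then show ?thesis using E by blast
qed

lemma lattice_finite_subset:
  assumes "finite T"
  shows "\<exists>D m. D \<noteq> 0 \<and> T \<subseteq> lattice D m"
  using assms
proof (induction T rule: finite_induct)
  case (insert x T)
  then obtain D m where D: "D \<noteq> 0" "T \<subseteq> lattice D m" by blast
  obtain E c where E: "E \<noteq> 0" "\<phi> E * x = (\<Sum>b\<in>B. \<phi> (c b) * b)" using span_B by blast
  define n where "n = (\<Sum>b\<in>B. degree (c b))"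
  have "degree (c b) \<le> n" if "b \<in> B" for b
    unfolding n_def using finite_B that by (intro member_le_sum) auto
  then have "x \<in> lattice E n" using E(2) by (rule latticeI)
  then have "x \<in> lattice (D * E) (n + degree D)" by (rule lattice_denom)
  moreover have "T \<subseteq> lattice (D * E) (m + degree E)"
    using D lattice_denom[of _ D m E] by (auto simp: mult.commute)
  ultimately have "insert x T \<subseteq> lattice (D * E) (max (n + degree D) (m + degree E))"
    using lattice_mono by (meson insert_subset max.cobounded1 max.cobounded2 subset_iff)
  then show ?case using D E by (intro exI[of _ "D * E"]) auto
qed (auto intro: exI[of _ 1])

text \<open>The order of the quantifiers matters: the rate \<open>C\<close> comes from
  \<open>x\<close> alone, whereas the digits \<open>T\<close> only affect the additive constant
  \<open>C'\<close>, which is lost for large \<open>J\<close>.\<close>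

lemma expansion_growth:
  fixes x :: 'k
  shows "\<exists>C. \<forall>T. finite T \<longrightarrow> (\<exists>C'. \<forall>J. \<exists>E. finite E \<and> card E \<le> CARD('p) ^ (C * J + C') \<and>
     expansions x T J \<subseteq> E)"
proof -
  obtain E a where E: "E \<noteq> 0" "\<And>D m y. y \<in> lattice D m \<Longrightarrow> x * y \<in> lattice (E * D) (m + a)"
    using lattice_mult[of x] by blast
  \<comment> \<open>The cost of one factor \<open>x\<close>: \<open>a\<close> for the numerators,
    and \<open>degree E\<close> for bringing all terms to the common denominator
    \<open>E ^ J * D\<close>.\<close>
  define d where "d = a + degree E"
  show ?thesis
  proof (rule exI[of _ "card B * d"], intro allI impI)
    fix T :: "'k set" assume "finite T"
    then obtain D m where D: "D \<noteq> 0" "T \<subseteq> lattice D m" using lattice_finite_subset by blast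
    have pow: "x ^ j * y \<in> lattice (E ^ j * D) (m + j * a)" if "y \<in> T" for j y
    proof (induction j)
      case 0
      then show ?case using D that by auto
    next
      case (Suc j)
      show ?case using E(2)[OF Suc] by (simp add: mult.assoc add_ac)
    qed
    have pow': "x ^ j * y \<in> lattice (E ^ J * D) (m + J * d)" if "y \<in> T" "j < J" for j J y
    proof -
      have "x ^ j * y \<in> lattice (E ^ (J - j) * (E ^ j * D)) (m + j * a + degree (E ^ (J - j)))"
        using pow[OF that(1)] by (rule lattice_denom)
      moreover have "E ^ (J - j) * (E ^ j * D) = E ^ J * D"
        using that by (simp flip: mult.assoc power_add)
      moreover have "m + j * a + degree (E ^ (J - j)) \<le> m + J * d"
      proof -
        have "degree (E ^ (J - j)) \<le> degree E * (J - j)" by (rule degree_power_le)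
        also have "\<dots> \<le> degree E * J" by simp
        finally have "degree (E ^ (J - j)) \<le> degree E * J" .
        moreover have "j * a \<le> J * a" using that by (intro mult_right_mono) auto
        ultimately have "j * a + degree (E ^ (J - j)) \<le> J * a + degree E * J" by (rule add_mono[rotated])
        then show ?thesis unfolding d_def by (simp add: algebra_simps)
      qed
      ultimately show ?thesis by (metis lattice_mono subsetD)
    qed
    show "\<exists>C'. \<forall>J. \<exists>E. finite E \<and> card E \<le> CARD('p) ^ (card B * d * J + C') \<and> expansions x T J \<subseteq> E"
    proof (intro exI[of _ "card B * (m + 1)"] allI)
      fix J
      have "expansions x T J \<subseteq> lattice (E ^ J * D) (m + J * d)"
        unfolding expansions_def by (auto intro!: lattice_sum pow')
      moreover have "E ^ J * D \<noteq> 0" using E D by simp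
      moreover have "card B * (m + J * d + 1) = card B * d * J + card B * (m + 1)"
        by (simp add: algebra_simps)
      ultimately show "\<exists>E. finite E \<and> card E \<le> CARD('p) ^ (card B * d * J + card B * (m + 1)) \<and>
          expansions x T J \<subseteq> E"
        using card_lattice[of "E ^ J * D" "m + J * d"] by metis
    qed
  qed
qed

text \<open>There are \<open>card T ^ J\<close> expansions in a set of size at most
  \<open>CARD('p) ^ (C * J + C')\<close>, which forces \<open>card T \<le> CARD('p) ^ C\<close>. The
  bound is uniform in \<open>A\<close>, so it applies to intersections of many valuation rings and
  to valuation rings not yet known to be discrete.\<close>

lemma incongruent_bound:
  fixes z :: 'k
  assumes "z \<noteq> 0"
  shows "\<exists>C. \<forall>A T. is_subring A \<longrightarrow> z \<in> A \<longrightarrow> T \<subseteq> A \<longrightarrow> incongruent A z T \<longrightarrow> finite T \<and> card T \<le> C"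
proof -
  obtain C where C: "\<And>T. finite T \<Longrightarrow> (\<exists>C'. \<forall>J. \<exists>E. finite E \<and> card E \<le> CARD('p) ^ (C * J + C') \<and>
     expansions z T J \<subseteq> E)"
    using expansion_growth[of z] by blast
  have bound: "card T \<le> CARD('p) ^ C"
    if A: "is_subring A" "z \<in> A" and T: "T \<subseteq> A" "incongruent A z T" "finite T" for A T
  proof -
    obtain C' where C': "\<And>J. \<exists>E. finite E \<and> card E \<le> CARD('p) ^ (C * J + C') \<and> expansions z T J \<subseteq> E"
      using C[OF T(3)] by blast
    have "card T ^ J \<le> CARD('p) ^ C' * (CARD('p) ^ C) ^ J" for J
    proof -
      obtain E where E: "finite E" "card E \<le> CARD('p) ^ (C * J + C')" "expansions z T J \<subseteq> E"
        using C' by blast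
      have "card T ^ J = card (expansions z T J)"
        using card_expansions(2)[OF A assms T] by simp
      also have "\<dots> \<le> card E" using E by (intro card_mono)
      also have "\<dots> \<le> CARD('p) ^ (C * J + C')" using E by simp
      finally show ?thesis by (simp add: power_add power_mult mult.commute)
    qed
    then show ?thesis by (rule pow_growth_le)
  qed
  have "finite T \<and> card T \<le> CARD('p) ^ C"
    if A: "is_subring A" "z \<in> A" and T: "T \<subseteq> A" "incongruent A z T" for A T
  proof (cases "finite T")
    case False
    obtain U where U: "U \<subseteq> T" "finite U" "card U = CARD('p) ^ C + 1"
      using infinite_arbitrarily_large[OF False] by blast
    then have "incongruent A z U" using T unfolding incongruent_def by blast
    then have "card U \<le> CARD('p) ^ C" using bound[OF A] U T by blast
    then show ?thesis using U by simp
  qed (use bound[OF A T] in simp)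
  then show ?thesis by blast
qed

end

section \<open>Existence of places\<close>

definition adjoin :: "'k::field set \<Rightarrow> 'k \<Rightarrow> 'k set" where
  "adjoin A y = {poly p y | p. \<forall>i. coeff p i \<in> A}"

lemma is_subring_adjoin:
  assumes "is_subring A"
  shows "is_subring (adjoin A y)" "A \<subseteq> adjoin A y" "y \<in> adjoin A y"
proof -
  note A = is_subringD[OF assms]
  have c: "poly p y \<in> adjoin A y" if "\<And>i. coeff p i \<in> A" for p
    using that unfolding adjoin_def by blast
  show "is_subring (adjoin A y)"
    unfolding is_subring_def
  proof (intro conjI ballI)
    show "1 \<in> adjoin A y" using c[of 1] A by (simp add: coeff_1)
    fix u v assume "u \<in> adjoin A y" "v \<in> adjoin A y"
    then obtain p q where pq: "u = poly p y" "v = poly q y" "\<forall>i. coeff p i \<in> A" "\<forall>i. coeff q i \<in> A"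
      unfolding adjoin_def by blast
    show "u - v \<in> adjoin A y" using c[of "p - q"] pq A by simp
    show "u * v \<in> adjoin A y" using c[of "p * q"] pq A
      by (simp add: coeff_mult is_subring_sum[OF assms])
  qed
  show "A \<subseteq> adjoin A y"
  proof
    fix a assume "a \<in> A"
    then show "a \<in> adjoin A y" using c[of "[:a:]"] A by (simp add: coeff_pCons split: nat.split)
  qed
  show "y \<in> adjoin A y" using c[of "[:0, 1:]"] A by (simp add: coeff_pCons split: nat.split)
qed

section \<open>Chevalley's argument: a subring maximal among those avoiding \<open>x\<close> is a
  valuation ring\<close>

context
  fixes A :: "'k::field set" and x :: 'k
  assumes A: "is_subring A" and x_nin: "x \<notin> A" and inv_x: "inverse x \<in> A"
    and maximal: "\<And>A'. is_subring A' \<Longrightarrow> A \<subseteq> A' \<Longrightarrow> x \<notin> A' \<Longrightarrow> A' = A"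
begin

lemma max_x_nonzero: "x \<noteq> 0"
  using x_nin is_subringD(2)[OF A] by auto

lemma max_no_inverse: "c \<in> A \<Longrightarrow> 1 \<noteq> inverse x * c"
  using max_x_nonzero x_nin by (auto simp: field_simps)

text \<open>Inverting \<open>1 + inverse x * c\<close> does not bring in \<open>x\<close>: its
  powers are congruent to 1 modulo \<open>inverse x\<close>, while \<open>x = d / ?b ^ k\<close>
  would make one of them a multiple of \<open>inverse x\<close>. By maximality the inverse already
  lies in \<open>A\<close>.\<close>

lemma max_one_plus_unit:
  assumes c: "c \<in> A"
  shows "1 + inverse x * c \<noteq> 0" "inverse (1 + inverse x * c) \<in> A"
proof -
  let ?b = "1 + inverse x * c"
  note AD = is_subringD[OF A]
  have b: "?b \<in> A" by (intro AD inv_x c)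
  show nz: "?b \<noteq> 0"
  proof
    assume "?b = 0"
    then have "1 = inverse x * (- c)" by (simp add: eq_neg_iff_add_eq_0)
    then show False using max_no_inverse[OF AD(3)[OF c]] by blast
  qed
  define A' where "A' = {d / ?b ^ k | d k. d \<in> A}"
  have in_A': "d / ?b ^ k \<in> A'" if "d \<in> A" for d k using that unfolding A'_def by blast
  have "is_subring A'"
    unfolding is_subring_def
  proof (intro conjI ballI)
    show "1 \<in> A'" using in_A'[OF AD(1), of 0] by simp
    fix u v assume "u \<in> A'" "v \<in> A'"
    then obtain d k e l where uv: "d \<in> A" "e \<in> A" "u = d / ?b ^ k" "v = e / ?b ^ l"
      unfolding A'_def by blast
    have "u - v = (d * ?b ^ l - e * ?b ^ k) / ?b ^ (k + l)"
      unfolding uv(3,4) power_add by (rule diff_frac_eq) (use nz in auto)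
    moreover have "d * ?b ^ l - e * ?b ^ k \<in> A" by (intro AD b uv)
    ultimately show "u - v \<in> A'" using in_A' by simp
    have "u * v = (d * e) / ?b ^ (k + l)" using uv by (simp add: power_add)
    then show "u * v \<in> A'" using in_A'[OF AD(6)[OF uv(1,2)]] by simp
  qed
  moreover have "A \<subseteq> A'" using in_A'[of _ 0] by auto
  moreover have "x \<notin> A'"
  proof
    assume "x \<in> A'"
    then obtain d k where d: "d \<in> A" "x = d / ?b ^ k" unfolding A'_def by blast
    then have bk: "?b ^ k = inverse x * d" using nz max_x_nonzero by (simp add: field_simps)
    have "\<exists>e\<in>A. ?b ^ k = 1 + inverse x * e" for k
    proof (induction k)
      case (Suc k)
      then obtain e where e: "e \<in> A" "?b ^ k = 1 + inverse x * e" by blast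
      have "?b ^ Suc k = 1 + inverse x * (c + ?b * e)" using e(2) by (simp add: algebra_simps)
      moreover have "c + ?b * e \<in> A" by (intro AD b c e)
      ultimately show ?case by blast
    qed (use AD(2) in \<open>auto intro!: bexI[of _ 0]\<close>)
    then obtain e where "e \<in> A" "?b ^ k = 1 + inverse x * e" by blast
    then have "1 = inverse x * (d - e)" using bk by (simp add: algebra_simps)
    then show False using max_no_inverse[OF AD(4)[OF d(1) \<open>e \<in> A\<close>]] by blast
  qed
  ultimately have "A' = A" by (rule maximal)
  then show "inverse ?b \<in> A" using in_A'[OF AD(1), of 1] by (simp add: inverse_eq_divide)
qed

text \<open>Equivalently, \<open>x\<close> is a polynomial in \<open>y\<close> of degree at most
  \<open>n\<close> over \<open>A\<close>. In the divided form, all coefficients carry the factor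
  \<open>inverse x\<close>, as \<open>max_one_plus_unit\<close> needs.\<close>

definition max_rep :: "'k \<Rightarrow> nat \<Rightarrow> bool" where
  "max_rep y n \<longleftrightarrow> (\<exists>c. (\<forall>i. c i \<in> A) \<and> 1 = inverse x * (\<Sum>i\<le>n. c i * y ^ i))"

lemma max_rep_exists:
  assumes "y \<notin> A"
  shows "\<exists>n. max_rep y n"
proof -
  have "x \<in> adjoin A y"
    using maximal[OF is_subring_adjoin(1)[OF A, of y] is_subring_adjoin(2)[OF A]] is_subring_adjoin(3)[OF A] assms
    by metis
  then obtain p where p: "x = poly p y" "\<forall>i. coeff p i \<in> A" unfolding adjoin_def by blast
  then have "1 = inverse x * (\<Sum>i\<le>degree p. coeff p i * y ^ i)"
    using max_x_nonzero by (simp add: poly_altdef[symmetric])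
  then show ?thesis using p unfolding max_rep_def by blast
qed

text \<open>In the relation for \<open>inverse y\<close>, move the constant term to the left, where
  1 becomes the unit \<open>w\<close>, and multiply by \<open>y ^ n\<close>. This expresses
  \<open>y ^ n\<close> by lower powers and removes the leading term from the relation for
  \<open>y\<close>.\<close>

lemma max_rep_step:
  assumes "max_rep y n" "max_rep (inverse y) m" "m \<le> n" "m > 0" "y \<noteq> 0"
  shows "max_rep y (n - 1)"
proof -
  note AD = is_subringD[OF A]
  obtain c where c: "\<And>i. c i \<in> A" "1 = inverse x * (\<Sum>i\<le>n. c i * y ^ i)"
    using assms(1) unfolding max_rep_def by blast
  obtain d where d: "\<And>i. d i \<in> A" "1 = inverse x * (\<Sum>i\<le>m. d i * inverse y ^ i)"
    using assms(2) unfolding max_rep_def by blast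
  obtain n' where n: "n = Suc n'" using assms by (cases n) auto
  define w where "w = 1 + inverse x * (- d 0)"
  have w: "w \<noteq> 0" "inverse w \<in> A"
    using max_one_plus_unit[of "- d 0"] AD(3)[OF d(1)] unfolding w_def by auto
  define d' where "d' j = (if j \<le> m then d j else 0)" for j
  have "(\<Sum>i\<le>m. d i * inverse y ^ i) = d 0 + (\<Sum>i\<in>{1..m}. d i * inverse y ^ i)"
    using sum.atLeast_Suc_atMost[of 0 m "\<lambda>i. d i * inverse y ^ i"] by (simp add: atLeast0AtMost)
  also have "(\<Sum>i\<in>{1..m}. d i * inverse y ^ i) = (\<Sum>i\<in>{1..n}. d' i * inverse y ^ i)"
    using assms(3) by (intro sum.mono_neutral_cong_left) (auto simp: d'_def)
  finally have "w = inverse x * (\<Sum>i\<in>{1..n}. d' i * inverse y ^ i)"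
    using d(2) unfolding w_def by (simp add: algebra_simps)
  then have "y ^ n * w = inverse x * (\<Sum>i\<in>{1..n}. d' i * (y ^ n * inverse y ^ i))"
    by (simp add: sum_distrib_left mult_ac)
  also have "(\<Sum>i\<in>{1..n}. d' i * (y ^ n * inverse y ^ i)) = (\<Sum>i\<in>{1..n}. d' i * y ^ (n - i))"
    using assms(5) by (intro sum.cong refl) (simp add: power_diff field_simps)
  also have "\<dots> = (\<Sum>i\<le>n'. d' (n - i) * y ^ i)"
    by (rule sum.reindex_bij_witness[of _ "\<lambda>i. n - i" "\<lambda>i. n - i"]) (auto simp: n)
  finally have *: "y ^ n * w = inverse x * (\<Sum>i\<le>n'. d' (n - i) * y ^ i)" .
  have "y ^ n = inverse w * (y ^ n * w)" using w by simp
  also have "\<dots> = inverse x * (\<Sum>i\<le>n'. inverse w * d' (n - i) * y ^ i)"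
    unfolding * by (simp add: sum_distrib_left mult_ac)
  finally have yn: "y ^ n = inverse x * (\<Sum>i\<le>n'. inverse w * d' (n - i) * y ^ i)" .
  have "1 = inverse x * ((\<Sum>i\<le>n'. c i * y ^ i) + c n * y ^ n)"
    using c(2) unfolding n by simp
  also have "(\<Sum>i\<le>n'. c i * y ^ i) + c n * y ^ n =
      (\<Sum>i\<le>n'. (c i + c n * inverse x * (inverse w * d' (n - i))) * y ^ i)"
    by (simp add: yn sum_distrib_left sum.distrib distrib_right mult.assoc)
  finally have "1 = inverse x * (\<Sum>i\<le>n'. (c i + c n * inverse x * (inverse w * d' (n - i))) * y ^ i)" .
  moreover have "c i + c n * inverse x * (inverse w * d' (n - i)) \<in> A" for i
    unfolding d'_def by (intro AD c d w inv_x) (simp add: d AD)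
  ultimately have "\<exists>c. (\<forall>i. c i \<in> A) \<and> 1 = inverse x * (\<Sum>i\<le>n'. c i * y ^ i)"
    by (intro exI[of _ "\<lambda>i. c i + c n * inverse x * (inverse w * d' (n - i))"] conjI allI)
  then show ?thesis unfolding max_rep_def n by simp
qed

text \<open>If both failed, maximality would give relations for \<open>y\<close> and for
  \<open>inverse y\<close>. The larger of the two degrees can always be lowered, but degree 0 is
  impossible.\<close>

lemma max_valuation_ring: "y \<in> A \<or> inverse y \<in> A"
proof (rule ccontr)
  assume "\<not> ?thesis"
  then have y: "y \<notin> A" "inverse y \<notin> A" by auto
  have y0: "y \<noteq> 0" using y is_subringD(2)[OF A] by auto
  have zero: "\<not> max_rep z 0" for z
    unfolding max_rep_def using max_no_inverse by auto
  have "False" if "max_rep y n" "max_rep (inverse y) m" for n m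
    using that
  proof (induction "n + m" arbitrary: n m rule: less_induct)
    case less
    have pos: "n > 0" "m > 0" using less.prems zero by (metis gr0I)+
    show False
    proof (cases "m \<le> n")
      case True
      then show False using less.hyps[of "n - 1" m] max_rep_step[OF less.prems(1,2) True pos(2) y0] less.prems pos
        by auto
    next
      case False
      then have "max_rep (inverse y) (m - 1)"
        using max_rep_step[of "inverse y" m n] less.prems pos y0 by auto
      then show False using less.hyps[of n "m - 1"] less.prems pos by auto
    qed
  qed
  then show False using max_rep_exists y by blast
qed

end

lemma valuation_ring_exists:
  assumes A0: "is_subring A0" "x \<notin> A0" "inverse x \<in> A0"
  shows "\<exists>A. is_subring A \<and> A0 \<subseteq> A \<and> x \<notin> A \<and> (\<forall>y. y \<in> A \<or> inverse y \<in> A)"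
proof -
  let ?F = "{A. is_subring A \<and> A0 \<subseteq> A \<and> x \<notin> A}"
  have "\<exists>M\<in>?F. \<forall>X\<in>?F. M \<subseteq> X \<longrightarrow> X = M"
  proof (rule subset_Zorn_nonempty)
    show "?F \<noteq> {}" using A0 by blast
    fix \<C> assume ne: "\<C> \<noteq> {}" and chain: "subset.chain ?F \<C>"
    have C: "is_subring X" "A0 \<subseteq> X" "x \<notin> X" if "X \<in> \<C>" for X
      using chain that unfolding subset.chain_def by blast+
    have "is_subring (\<Union>\<C>)"
      unfolding is_subring_def
    proof (intro conjI ballI)
      show "1 \<in> \<Union>\<C>" using ne C is_subringD(1) by blast
      fix u v assume "u \<in> \<Union>\<C>" "v \<in> \<Union>\<C>"
      then obtain X Y where XY: "X \<in> \<C>" "Y \<in> \<C>" "u \<in> X" "v \<in> Y" by blast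
      then have "X \<subseteq> Y \<or> Y \<subseteq> X" using chain unfolding subset.chain_def by blast
      then obtain Z where "Z \<in> \<C>" "u \<in> Z" "v \<in> Z" using XY by blast
      then show "u - v \<in> \<Union>\<C>" "u * v \<in> \<Union>\<C>" using C(1) is_subringD(4,6) by blast+
    qed
    moreover have "A0 \<subseteq> \<Union>\<C>" "x \<notin> \<Union>\<C>" using ne C by blast+
    ultimately show "\<Union>\<C> \<in> ?F" by blast
  qed
  then obtain M where MF: "M \<in> ?F" and max: "\<forall>X\<in>?F. M \<subseteq> X \<longrightarrow> X = M" by (rule bexE)
  have M: "is_subring M" "A0 \<subseteq> M" "x \<notin> M" using MF by auto
  have "y \<in> M \<or> inverse y \<in> M" for y
  proof (rule max_valuation_ring[OF M(1,3)])
    show "inverse x \<in> M" using M A0 by auto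
    fix A' assume "is_subring A'" "M \<subseteq> A'" "x \<notin> A'"
    then show "A' = M" using max M by auto
  qed
  then show ?thesis using M by (intro exI[of _ M]) auto
qed

context function_field
begin

text \<open>A sequence must repeat a class modulo \<open>z\<close>, because there are finitely many.
  The proof of discreteness rests on this pigeonhole.\<close>

lemma congruent_terms:
  fixes f :: "nat \<Rightarrow> 'k"
  assumes "is_subring A" "z \<in> A" "z \<noteq> 0" "\<And>n. f n \<in> A"
  shows "\<exists>i j. i < j \<and> (\<exists>a\<in>A. f i - f j = z * a)"
proof (rule ccontr)
  assume no: "\<not> ?thesis"
  have "0 \<in> A" using is_subringD(2)[OF assms(1)] .
  have neq: "f i \<noteq> f j" if "i < j" for i j
  proof
    assume "f i = f j"
    then have "f i - f j = z * 0" by simp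
    then show False using no that \<open>0 \<in> A\<close> by blast
  qed
  have "inj f" by (metis injI neq linorder_neqE_nat)
  have "incongruent A z (range f)"
    unfolding incongruent_def
  proof (intro ballI impI)
    fix x y a assume "x \<in> range f" "y \<in> range f" "x \<noteq> y" "a \<in> A"
    then obtain i j where ij: "x = f i" "y = f j" "i \<noteq> j" by blast
    show "x - y \<noteq> z * a"
    proof
      assume eq: "x - y = z * a"
      then have "f j - f i = z * (- a)" using ij by (simp add: algebra_simps)
      moreover have "- a \<in> A" using is_subringD(3)[OF assms(1) \<open>a \<in> A\<close>] .
      ultimately show False using no ij eq \<open>a \<in> A\<close> by (metis linorder_neqE_nat)
    qed
  qed
  then have "finite (range f)" using incongruent_bound[OF assms(3)] assms by blast
  then show False using \<open>inj f\<close> finite_imageD by blast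
qed

end

section \<open>Valuation rings of a function field are discrete\<close>

locale valuation_ring = function_field \<phi> B
  for \<phi> :: "'p::prime_card mod_ring poly \<Rightarrow> 'k::field" and B :: "'k set" +
  fixes A :: "'k set"
  assumes subring: "is_subring A" and dich: "y \<in> A \<or> inverse y \<in> A" and proper: "A \<noteq> UNIV"
begin

lemmas AD = is_subringD[OF subring]

definition unit :: "'k \<Rightarrow> bool" where
  "unit u \<longleftrightarrow> u \<noteq> 0 \<and> u \<in> A \<and> inverse u \<in> A"

lemma unit_mult: "unit u \<Longrightarrow> unit v \<Longrightarrow> unit (u * v)"
  unfolding unit_def using AD by auto

lemma unit_inverse: "unit u \<Longrightarrow> unit (inverse u)"
  unfolding unit_def by auto

lemma unit_factor:
  assumes "a \<in> A" "b \<in> A" "unit (a * b)"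
  shows "unit a"
proof -
  have nz: "a \<noteq> 0" "b \<noteq> 0" and "b * inverse (a * b) \<in> A" using assms AD(6) unfolding unit_def by auto
  moreover have "b * inverse (a * b) = inverse a" using nz by (simp add: field_simps)
  ultimately have "inverse a \<in> A" by metis
  then show ?thesis using assms(1) nz unfolding unit_def by blast
qed

text \<open>Of \<open>a\<close> and \<open>1 - a\<close>, one divides the other and hence their sum
  1, so it is a unit; it cannot be \<open>a\<close>.\<close>

lemma one_minus_nonunit:
  assumes "a \<in> A" "\<not> unit a"
  shows "unit (1 - a)"
proof (rule ccontr)
  assume nu: "\<not> unit (1 - a)"
  have in_A: "1 - a \<in> A" using AD assms by blast
  have u1: "unit 1" unfolding unit_def using AD by simp
  have nz: "a \<noteq> 0" "1 - a \<noteq> 0" using assms nu u1 by auto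
  have "a / (1 - a) \<in> A \<or> (1 - a) / a \<in> A" using dich[of "a / (1 - a)"] by (simp add: inverse_eq_divide)
  then show False
  proof
    assume *: "a / (1 - a) \<in> A"
    have "(1 - a) * (a / (1 - a) + 1) = 1" using nz by (simp add: field_simps)
    then show False using unit_factor[OF in_A AD(5)[OF * AD(1)]] u1 nu by simp
  next
    assume *: "(1 - a) / a \<in> A"
    have "a * ((1 - a) / a + 1) = 1" using nz by (simp add: field_simps)
    then show False using unit_factor[OF assms(1) AD(5)[OF * AD(1)]] u1 assms by simp
  qed
qed

lemma nonunit_exists: "\<exists>y\<in>A. y \<noteq> 0 \<and> \<not> unit y"
proof -
  obtain x where "x \<notin> A" using proper by blast
  then have "inverse x \<in> A" "x \<noteq> 0" "\<not> unit (inverse x)" using dich AD(2) unfolding unit_def by auto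
  then show ?thesis by (intro bexI[of _ "inverse x"]) auto
qed

text \<open>Otherwise there is an infinite chain \<open>P\<close>, starting at \<open>y\<close>, in
  which each term is a proper multiple of the next. Two terms are congruent modulo \<open>y\<close>,
  and their difference is a unit times the later one. So \<open>y\<close> divides that term,
  although \<open>y\<close> is itself a proper multiple of it.\<close>

lemma uniformizer:
  "\<exists>\<pi>\<in>A. \<pi> \<noteq> 0 \<and> \<not> unit \<pi> \<and> (\<forall>x\<in>A. \<not> unit x \<longrightarrow> x / \<pi> \<in> A)"
proof (rule ccontr)
  assume no: "\<not> ?thesis"
  define N where "N y \<longleftrightarrow> y \<in> A \<and> y \<noteq> 0 \<and> \<not> unit y" for y
  have step: "\<exists>x. N x \<and> N (p / x)" if p: "N p" for p
  proof -
    obtain x where x: "x \<in> A" "\<not> unit x" "x / p \<notin> A" using no p unfolding N_def by blast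
    have nz: "x \<noteq> 0" "p \<noteq> 0" using x p AD(2) unfolding N_def by auto
    have "inverse (x / p) = p / x" by simp
    then have "p / x \<in> A" "\<not> unit (p / x)" using x dich[of "x / p"] unfolding unit_def by auto
    then show ?thesis using x nz unfolding N_def by auto
  qed
  obtain y where y: "N y" using nonunit_exists unfolding N_def by blast
  obtain P where P: "\<And>n. N (P n)" "\<And>n. N (P n / P (Suc n))" "P 0 = y"
    using dependent_nat_choice[of "\<lambda>n p. N p \<and> (n = 0 \<longrightarrow> p = y)" "\<lambda>_ p x. N (p / x)"] step y by auto
  have P_nz: "P n \<noteq> 0" for n using P(1) unfolding N_def by blast
  have quot: "N (P i / P j)" if "i < j" for i j
    using that
  proof (induction j)
    case (Suc j)
    show ?case
    proof (cases "i = j")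
      case False
      then have 1: "N (P i / P j)" using Suc by simp
      have eq: "P i / P (Suc j) = (P i / P j) * (P j / P (Suc j))" using P_nz by simp
      have "P i / P j \<in> A" "P j / P (Suc j) \<in> A" using 1 P(2) unfolding N_def by blast+
      then have "P i / P (Suc j) \<in> A" "\<not> unit (P i / P (Suc j))"
        using 1 unit_factor[of "P i / P j" "P j / P (Suc j)"] AD(6) unfolding N_def eq by metis+
      then show ?thesis using P_nz unfolding N_def by simp
    qed (use P in simp)
  qed simp
  obtain i j a where ij: "i < j" "a \<in> A" "P i - P j = y * a"
    using congruent_terms[OF subring, of y P] y P unfolding N_def by blast
  define b where "b = P i / P j"
  have b: "N b" using quot[OF ij(1)] unfolding b_def .
  then have u: "unit (1 - b)" using one_minus_nonunit unfolding N_def by blast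
  have "P j * (1 - b) = y * (- a)" using ij P_nz unfolding b_def by (simp add: field_simps)
  then have "P j = y * (- a * inverse (1 - b))" using u unfolding unit_def by (auto simp: field_simps)
  then have "inverse (y / P j) = - a * inverse (1 - b)"
    using y unfolding N_def by simp
  moreover have "- a * inverse (1 - b) \<in> A"
    using u ij AD(3)[of a] AD(6) unfolding unit_def by blast
  ultimately have "inverse (y / P j) \<in> A" by metis
  moreover have "N (y / P j)" using quot[of 0 j] ij P by auto
  ultimately show False unfolding N_def unit_def by blast
qed

definition unif :: 'k where
  "unif = (SOME \<pi>. \<pi> \<in> A \<and> \<pi> \<noteq> 0 \<and> \<not> unit \<pi> \<and> (\<forall>x\<in>A. \<not> unit x \<longrightarrow> x / \<pi> \<in> A))"

lemma unif: "unif \<in> A" "unif \<noteq> 0" "\<not> unit unif" "x \<in> A \<Longrightarrow> \<not> unit x \<Longrightarrow> x / unif \<in> A"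
  using someI_ex[of "\<lambda>\<pi>. \<pi> \<in> A \<and> \<pi> \<noteq> 0 \<and> \<not> unit \<pi> \<and> (\<forall>x\<in>A. \<not> unit x \<longrightarrow> x / \<pi> \<in> A)"] uniformizer
  unfolding unif_def by blast+

lemma unif_power_in: "unif powi k \<in> A \<longleftrightarrow> k \<ge> 0"
proof
  show "k \<ge> 0 \<Longrightarrow> unif powi k \<in> A" by (simp add: power_int_def AD unif)
  assume in_A: "unif powi k \<in> A"
  show "k \<ge> 0"
  proof (rule ccontr)
    assume "\<not> k \<ge> 0"
    then obtain n where n: "k = - int (Suc n)"
      by (metis negative_eq_positive not_le nonneg_int_cases neg_int_cases of_nat_Suc Suc_pred)
    have "unif powi k = inverse (unif ^ Suc n)" by (simp only: n power_int_minus power_int_of_nat)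
    then have "inverse unif = unif powi k * unif ^ n" using unif by simp
    then have "inverse unif \<in> A" using AD(6)[OF in_A AD(7)[OF unif(1)]] by simp
    then show False using unif unfolding unit_def by blast
  qed
qed

text \<open>The valuation has rank one: no nonzero element is divisible by all powers of
  \<open>unif\<close>. Two powers are congruent modulo \<open>z\<close>, and their difference is a
  unit times the lower power.\<close>

lemma unif_power_divisible:
  assumes "z \<in> A" "z \<noteq> 0"
  shows "\<exists>i. unif ^ i / z \<in> A"
proof -
  obtain i j a where ij: "i < j" "a \<in> A" "unif ^ i - unif ^ j = z * a"
    using congruent_terms[OF subring assms, of "\<lambda>n. unif ^ n"] AD(7)[OF unif(1)] by blast
  obtain n where n: "j - i = Suc n" using ij(1) by (metis Suc_diff_Suc)
  have "\<not> unit (unif ^ (j - i))"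
    using unit_factor[OF unif(1) AD(7)[OF unif(1)], of n] unif(3) unfolding n by auto
  then have u: "unit (1 - unif ^ (j - i))" using one_minus_nonunit[OF AD(7)[OF unif(1)]] by blast
  have "unif ^ j = unif ^ i * unif ^ (j - i)" using ij by (simp flip: power_add)
  then have "unif ^ i * (1 - unif ^ (j - i)) = z * a" using ij by (simp add: algebra_simps)
  then have "unif ^ i / z = a * inverse (1 - unif ^ (j - i))"
    using u assms unfolding unit_def by (simp add: field_simps)
  moreover have "a * inverse (1 - unif ^ (j - i)) \<in> A" using u ij(2) AD(6) unfolding unit_def by blast
  ultimately show ?thesis by metis
qed

lemma order_exists_integral:
  assumes "x \<in> A" "x \<noteq> 0"
  shows "\<exists>k. unit (x / unif powi k)"
proof -
  obtain i where i: "unif ^ i / x \<in> A" using unif_power_divisible[OF assms] by blast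
  have bound: "k \<le> i" if "x / unif ^ k \<in> A" for k
  proof -
    have "unif powi (int i - int k) = (unif ^ i / x) * (x / unif ^ k)"
      using assms unif by (simp add: power_int_diff)
    then have "unif powi (int i - int k) \<in> A" using AD(6)[OF i that] by simp
    then show ?thesis using unif_power_in by simp
  qed
  define k where "k = (GREATEST k. x / unif ^ k \<in> A)"
  have ex: "x / unif ^ 0 \<in> A" using assms by simp
  have k: "x / unif ^ k \<in> A" unfolding k_def
    by (rule GreatestI_nat[where k = 0 and b = i]) (use ex bound in auto)
  have "unit (x / unif ^ k)"
  proof (rule ccontr)
    assume "\<not> ?thesis"
    then have "x / unif ^ k / unif \<in> A" using unif(4) k by blast
    then have "x / unif ^ Suc k \<in> A" by (simp add: mult.commute)
    then have "Suc k \<le> k" unfolding k_def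
      by (rule Greatest_le_nat[where b = i]) (use bound in auto)
    then show False by simp
  qed
  then show ?thesis by (intro exI[of _ "int k"]) simp
qed

lemma order_exists:
  assumes "x \<noteq> 0"
  shows "\<exists>k. unit (x / unif powi k)"
proof (cases "x \<in> A")
  case False
  then obtain k where "unit (inverse x / unif powi k)"
    using order_exists_integral[of "inverse x"] dich assms by auto
  then have "unit (inverse (inverse x / unif powi k))" by (rule unit_inverse)
  moreover have "inverse (inverse x / unif powi k) = x / unif powi (- k)"
    by (simp add: power_int_minus field_simps)
  ultimately show ?thesis by metis
qed (use order_exists_integral assms in blast)

lemma order_unique:
  assumes "unit (x / unif powi k)" "unit (x / unif powi l)"
  shows "k = l"
proof -
  have x: "x \<noteq> 0" using assms unfolding unit_def by auto
  have "k \<le> l" if "unit (x / unif powi k)" "unit (x / unif powi l)" for k l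
  proof -
    have "unit (x / unif powi k * inverse (x / unif powi l))" using that unit_mult unit_inverse by blast
    moreover have "x / unif powi k * inverse (x / unif powi l) = unif powi (l - k)"
      using x unif by (simp add: power_int_diff)
    ultimately show ?thesis using unif_power_in unfolding unit_def by auto
  qed
  from this[OF assms] this[OF assms(2,1)] show ?thesis by simp
qed

definition order :: "'k \<Rightarrow> int" where
  "order x = (THE k. unit (x / unif powi k))"

lemma order_unit: "x \<noteq> 0 \<Longrightarrow> unit (x / unif powi (order x))"
  unfolding order_def using order_exists order_unique by (metis (mono_tags, lifting) theI')

lemma order_eqI: "unit (x / unif powi k) \<Longrightarrow> order x = k"
  unfolding order_def using order_unique by blast

lemma order_mult: "x \<noteq> 0 \<Longrightarrow> y \<noteq> 0 \<Longrightarrow> order (x * y) = order x + order y"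
proof (rule order_eqI)
  assume "x \<noteq> 0" "y \<noteq> 0"
  then have "unit (x / unif powi (order x) * (y / unif powi (order y)))" using unit_mult order_unit by blast
  then show "unit (x * y / unif powi (order x + order y))" using unif by (simp add: power_int_add)
qed

lemma order_ge_iff:
  assumes "x \<noteq> 0"
  shows "order x \<ge> k \<longleftrightarrow> x / unif powi k \<in> A"
proof -
  have u: "unit (x / unif powi (order x))" using order_unit assms by simp
  have "x / unif powi k = x / unif powi (order x) * unif powi (order x - k)"
    "unif powi (order x - k) = x / unif powi k * inverse (x / unif powi (order x))"
    using unif assms by (simp_all add: power_int_diff)
  then have "x / unif powi k \<in> A \<longleftrightarrow> unif powi (order x - k) \<in> A"
    using u AD(6) unfolding unit_def by metis
  then show ?thesis using unif_power_in by simp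
qed

definition place :: "'k \<Rightarrow> int extended" where
  "place x = (if x = 0 then Pinf else Fin (order x))"

lemma is_prime_place_place: "is_prime_place place"
  unfolding is_prime_place_def
proof (intro conjI allI)
  fix x y
  show "place x = Pinf \<longleftrightarrow> x = 0" "place x \<noteq> Minf" by (simp_all add: place_def)
  show "place (x * y) = place x + place y" by (simp add: place_def order_mult)
  show "place (x + y) \<ge> min (place x) (place y)"
  proof (cases "x = 0 \<or> y = 0 \<or> x + y = 0")
    case False
    define k where "k = min (order x) (order y)"
    have "x / unif powi k \<in> A" "y / unif powi k \<in> A"
      using order_ge_iff[of x k] order_ge_iff[of y k] False unfolding k_def by auto
    then have "(x + y) / unif powi k \<in> A" using AD(5) by (simp add: add_divide_distrib)
    then have "order (x + y) \<ge> k" using order_ge_iff False by simp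
    then show ?thesis using False by (simp add: place_def k_def)
  qed (auto simp: place_def)
next
  have "unit 1" using AD by (simp add: unit_def)
  then have "order unif = 1" using unif by (intro order_eqI) simp
  then show "\<exists>x. place x = Fin 1" using unif by (intro exI[of _ unif]) (simp add: place_def)
qed

lemma place_integral: "ord_at place x \<ge> 0 \<longleftrightarrow> x \<in> A" if "x \<noteq> 0"
  using order_ge_iff[OF that, of 0] that by (simp add: ord_at_def place_def)

end

section \<open>Places at which a given element has a pole\<close>

context function_field
begin

abbreviation (input) t :: 'k where "t \<equiv> \<phi> [:0, 1:]"

definition const_field :: "'k set" where
  "const_field = range (\<lambda>c. \<phi> [:c:])"

lemma is_subring_const: "is_subring const_field"
  unfolding is_subring_def const_field_def
proof (intro conjI ballI)
  show "1 \<in> range (\<lambda>c. \<phi> [:c:])" by (rule range_eqI[of _ _ 1]) (simp flip: one_pCons)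
  fix x y assume "x \<in> range (\<lambda>c. \<phi> [:c:])" "y \<in> range (\<lambda>c. \<phi> [:c:])"
  then obtain c d where "x = \<phi> [:c:]" "y = \<phi> [:d:]" by blast
  then show "x - y \<in> range (\<lambda>c. \<phi> [:c:])" "x * y \<in> range (\<lambda>c. \<phi> [:c:])"
    by (auto simp flip: hom_minus hom_mult)
qed

text \<open>Constants come from the prime field, so they and their inverses are sums of ones and
  hence integral.\<close>

lemma const_ord:
  assumes v: "is_prime_place v" and c: "c \<in> const_field" "c \<noteq> 0"
  shows "ord_at v c = 0"
proof -
  have int: "ord_ge v 0 (\<phi> [:a:])" for a
  proof -
    obtain i where "a = of_nat i" using surj_of_nat_mod_ring by blast
    then have "\<phi> [:a:] = of_nat i" by (metis hom_of_nat of_nat_poly)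
    moreover have "ord_ge v 0 (of_nat i)" by (induction i) (auto intro: ord_ge_add[OF v] simp: v)
    ultimately show ?thesis by simp
  qed
  obtain a where a: "c = \<phi> [:a:]" using c unfolding const_field_def by blast
  then have a0: "a \<noteq> 0" using c by auto
  have "c * \<phi> [:inverse a:] = 1" using a0 unfolding a by (simp flip: hom_mult one_pCons)
  then have "inverse c = \<phi> [:inverse a:]" by (metis inverse_unique)
  then have "ord_ge v 0 c" "ord_ge v 0 (inverse c)" using int a by auto
  then show ?thesis using c v by (auto simp: ord_ge_def ord_at_inverse)
qed

text \<open>Nonzero coefficients have order 0, so at a pole of \<open>y\<close> the leading term
  dominates.\<close>

lemma ord_poly_neg:
  assumes v: "is_prime_place v" and y: "y \<noteq> 0" "ord_at v y < 0"
    and "\<forall>i. coeff G i \<in> const_field" "G \<noteq> 0"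
  shows "poly G y \<noteq> 0 \<and> ord_at v (poly G y) = int (degree G) * ord_at v y"
  using assms(4,5)
proof (induction G)
  case (pCons a G)
  have a: "a \<in> const_field" using pCons.prems(1) by (metis coeff_pCons_0)
  have G: "\<forall>i. coeff G i \<in> const_field" using pCons.prems(1) by (metis coeff_pCons_Suc)
  show ?case
  proof (cases "G = 0")
    case True
    then show ?thesis using pCons const_ord[OF v a] by auto
  next
    case False
    then have IH: "poly G y \<noteq> 0" "ord_at v (poly G y) = int (degree G) * ord_at v y"
      using pCons.IH G by auto
    then have *: "ord_at v (y * poly G y) = int (Suc (degree G)) * ord_at v y"
      using y v by (simp add: ord_at_mult algebra_simps)
    then have "ord_at v (y * poly G y) < 0" using y by (simp add: mult_pos_neg)
    then have "ord_ge v (ord_at v (y * poly G y) + 1) a"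
      using const_ord[OF v a] by (cases "a = 0") (auto simp: ord_ge_def)
    then have "y * poly G y + a \<noteq> 0 \<and> ord_at v (y * poly G y + a) = ord_at v (y * poly G y)"
      using ord_at_add_eq[OF v, of "y * poly G y" a] IH y by simp
    then show ?thesis using * False by (simp add: add.commute)
  qed
qed simp

text \<open>Chevalley's argument starts from the ring generated by \<open>inverse x\<close> over the
  constants. The valuation ring that it yields is discrete and omits \<open>x\<close>.\<close>

lemma place_with_pole:
  assumes "x \<notin> adjoin const_field (inverse x)"
  shows "\<exists>v. is_prime_place v \<and> ord_at v x < 0"
proof -
  obtain A where A: "is_subring A" "x \<notin> A" "\<forall>y. y \<in> A \<or> inverse y \<in> A"
    using valuation_ring_exists[OF is_subring_adjoin(1)[OF is_subring_const] assms is_subring_adjoin(3)[OF is_subring_const]]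
    by blast
  interpret V: valuation_ring \<phi> B A by unfold_locales (use A in auto)
  have "x \<noteq> 0" using A V.AD(2) by auto
  then show ?thesis using V.place_integral A V.is_prime_place_place by (metis not_le)
qed

text \<open>At a zero of \<open>x\<close>, every nonzero polynomial in \<open>inverse x\<close> has
  order at most 0, so \<open>x\<close> is not such a polynomial.\<close>

lemma pole_exists:
  fixes x :: 'k
  assumes v: "is_prime_place v" and x: "x \<noteq> 0" "ord_at v x > 0"
  shows "\<exists>v. is_prime_place v \<and> ord_at v x < 0"
proof (rule place_with_pole, rule notI)
  assume "x \<in> adjoin const_field (inverse x)"
  then obtain G where G: "x = poly G (inverse x)" "\<forall>i. coeff G i \<in> const_field"
    unfolding adjoin_def by blast
  then have "G \<noteq> 0" using x by auto
  then have "ord_at v x = int (degree G) * ord_at v (inverse x)"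
    using ord_poly_neg[OF v, of "inverse x" G] G x v by (simp add: ord_at_inverse)
  then have "ord_at v x = - (int (degree G) * ord_at v x)" using x v by (simp add: ord_at_inverse)
  moreover have "int (degree G) * ord_at v x \<ge> 0" using x by simp
  ultimately show False using x by linarith
qed

lemma t_nonzero: "t \<noteq> 0" by simp

text \<open>Multiplied by \<open>t ^ n\<close>, an identity \<open>t = poly G (inverse t)\<close>
  would equate polynomials of degree \<open>n + 1\<close> and of degree at most
  \<open>n\<close>.\<close>

lemma t_pole: "\<exists>v. is_prime_place v \<and> ord_at v t < 0"
proof (rule place_with_pole, rule notI)
  assume "t \<in> adjoin const_field (inverse t)"
  then obtain G where G: "t = poly G (inverse t)" "\<forall>i. coeff G i \<in> const_field"
    unfolding adjoin_def by blast
  then have "\<forall>i. \<exists>c. coeff G i = \<phi> [:c:]" unfolding const_field_def by blast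
  then obtain c where c: "\<And>i. coeff G i = \<phi> [:c i:]" by metis
  define n where "n = degree G"
  have "t ^ Suc n = (\<Sum>i\<le>n. \<phi> [:c i:] * (t ^ n * inverse t ^ i))"
  proof -
    have "t ^ Suc n = poly G (inverse t) * t ^ n" using G(1) by (metis power_Suc)
    then show ?thesis
      by (simp add: poly_altdef c sum_distrib_left sum_distrib_right n_def mult_ac)
  qed
  also have "\<dots> = (\<Sum>i\<le>n. \<phi> ([:c i:] * [:0, 1:] ^ (n - i)))"
  proof (intro sum.cong refl)
    fix i assume i: "i \<in> {..n}"
    have "t ^ n * inverse t ^ i = t ^ (n - i)" using t_nonzero i by (simp add: power_diff field_simps)
    then show "\<phi> [:c i:] * (t ^ n * inverse t ^ i) = \<phi> ([:c i:] * [:0, 1:] ^ (n - i))"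
      by (simp only: hom_mult hom_power)
  qed
  finally have "\<phi> ([:0, 1:] ^ Suc n) = \<phi> (\<Sum>i\<le>n. [:c i:] * [:0, 1:] ^ (n - i))"
    by (simp only: hom_power hom_sum)
  then have eq: "[:0, 1:] ^ Suc n = (\<Sum>i\<le>n. [:c i:] * [:0, 1:] ^ (n - i))"
    by (simp only: emb_inj)
  have "degree (\<Sum>i\<le>n. [:c i:] * [:0, 1:] ^ (n - i)) \<le> n"
  proof (intro degree_sum_le)
    fix i
    have "degree ([:c i:] * [:0, 1:] ^ (n - i)) \<le> degree ([:0, 1:] ^ (n - i) :: 'p mod_ring poly)"
      using degree_mult_le[of "[:c i:]" "[:0, 1:] ^ (n - i)"] by simp
    also have "\<dots> \<le> n" by (simp add: degree_power_eq)
    finally show "degree ([:c i:] * [:0, 1:] ^ (n - i)) \<le> n" .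
  qed simp
  moreover have "degree ([:0, 1:] ^ Suc n :: 'p mod_ring poly) = Suc n"
    by (subst degree_power_eq) simp_all
  ultimately show False using eq by (metis Suc_n_not_le_n)
qed

end

section \<open>Residue fields and the product formula inequality\<close>

context function_field
begin

lemma is_subring_integral:
  assumes "\<forall>v\<in>Z. is_prime_place v"
  shows "is_subring {y. \<forall>v\<in>Z. ord_ge v 0 y}"
  unfolding is_subring_def using assms by (auto intro: ord_ge_diff ord_ge_mult0)

lemma incongruent_integral:
  assumes "\<forall>v\<in>Z. is_prime_place v" "x \<noteq> 0" "\<forall>v\<in>Z. ord_at v x \<ge> 0"
    and "\<And>\<tau> \<sigma>. \<tau> \<in> T \<Longrightarrow> \<sigma> \<in> T \<Longrightarrow> \<tau> \<noteq> \<sigma> \<Longrightarrow> \<exists>v\<in>Z. \<not> ord_ge v (ord_at v x) (\<tau> - \<sigma>)"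
  shows "incongruent {y. \<forall>v\<in>Z. ord_ge v 0 y} x T"
  unfolding incongruent_def
proof (intro ballI impI notI)
  fix \<tau> \<sigma> a assume *: "\<tau> \<in> T" "\<sigma> \<in> T" "\<tau> \<noteq> \<sigma>" "a \<in> {y. \<forall>v\<in>Z. ord_ge v 0 y}" "\<tau> - \<sigma> = x * a"
  then have "ord_ge v (ord_at v x) (\<tau> - \<sigma>)" if "v \<in> Z" for v
    using that assms by (simp add: ord_ge_mult_iff)
  then show False using assms(4)[OF *(1-3)] by blast
qed

text \<open>Incongruent sets modulo a uniformizer have bounded size; one of largest size represents
  every class, since otherwise it could be enlarged.\<close>

lemma residues_exist:
  fixes v :: "'k \<Rightarrow> int extended"
  assumes v: "is_prime_place v"
  shows "\<exists>T. finite T \<and> (\<forall>\<tau>\<in>T. ord_ge v 0 \<tau>) \<and> (\<forall>x. ord_ge v 0 x \<longrightarrow> (\<exists>\<tau>\<in>T. ord_ge v 1 (x - \<tau>)))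
    \<and> (\<forall>\<tau>\<in>T. \<forall>\<sigma>\<in>T. \<tau> \<noteq> \<sigma> \<longrightarrow> \<not> ord_ge v 1 (\<tau> - \<sigma>))"
proof -
  obtain z where z: "z \<noteq> 0" "ord_at v z = 1" using uniformizer_exists[OF v] .
  define Q where "Q T \<longleftrightarrow> finite T \<and> (\<forall>\<tau>\<in>T. ord_ge v 0 \<tau>) \<and> (\<forall>\<tau>\<in>T. \<forall>\<sigma>\<in>T. \<tau> \<noteq> \<sigma> \<longrightarrow> \<not> ord_ge v 1 (\<tau> - \<sigma>))" for T
  obtain C where C: "\<And>A T. is_subring A \<Longrightarrow> z \<in> A \<Longrightarrow> T \<subseteq> A \<Longrightarrow> incongruent A z T \<Longrightarrow> card T \<le> C"
    using incongruent_bound[OF z(1)] by blast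
  have bound: "card T \<le> C" if "Q T" for T
  proof (rule C[of "{y. \<forall>v\<in>{v}. ord_ge v 0 y}"])
    show "incongruent {y. \<forall>v\<in>{v}. ord_ge v 0 y} z T"
      by (rule incongruent_integral) (use v z that in \<open>auto simp: Q_def\<close>)
  qed (use is_subring_integral[of "{v}"] v z that in \<open>auto simp: Q_def ord_ge_def\<close>)
  have "Q {}" unfolding Q_def by simp
  moreover have "\<forall>T. Q T \<longrightarrow> card T < Suc C" using bound by (auto simp: less_Suc_eq_le)
  ultimately obtain T where T: "Q T" "\<And>U. Q U \<Longrightarrow> card U \<le> card T"
    using ex_has_greatest_nat[of Q "{}" card "Suc C"] by blast
  have "\<exists>\<tau>\<in>T. ord_ge v 1 (x - \<tau>)" if x: "ord_ge v 0 x" for x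
  proof (rule ccontr)
    assume no: "\<not> ?thesis"
    have sym: "\<not> ord_ge v 1 (\<tau> - x)" if "\<tau> \<in> T" for \<tau>
      using no that ord_ge_uminus[OF v, of 1 "\<tau> - x"] by auto
    have "x \<notin> T" using no by force
    moreover have "Q (insert x T)" using T(1) no sym x unfolding Q_def by auto
    ultimately show False using T(2)[of "insert x T"] T(1) unfolding Q_def by auto
  qed
  then show ?thesis using T(1) unfolding Q_def by blast
qed

definition residues :: "('k \<Rightarrow> int extended) \<Rightarrow> 'k set" where
  "residues v = (SOME T. finite T \<and> (\<forall>\<tau>\<in>T. ord_ge v 0 \<tau>) \<and> (\<forall>x. ord_ge v 0 x \<longrightarrow> (\<exists>\<tau>\<in>T. ord_ge v 1 (x - \<tau>)))
    \<and> (\<forall>\<tau>\<in>T. \<forall>\<sigma>\<in>T. \<tau> \<noteq> \<sigma> \<longrightarrow> \<not> ord_ge v 1 (\<tau> - \<sigma>)))"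

text \<open>The norm of the place \<open>v\<close>: the number of elements of its residue
  field.\<close>

definition q :: "('k \<Rightarrow> int extended) \<Rightarrow> nat" where
  "q v = card (residues v)"

lemma residues:
  assumes v: "is_prime_place v"
  shows "finite (residues v)" "\<And>\<tau>. \<tau> \<in> residues v \<Longrightarrow> ord_ge v 0 \<tau>"
    "\<And>x. ord_ge v 0 x \<Longrightarrow> \<exists>\<tau>\<in>residues v. ord_ge v 1 (x - \<tau>)"
    "\<And>\<tau> \<sigma>. \<tau> \<in> residues v \<Longrightarrow> \<sigma> \<in> residues v \<Longrightarrow> \<tau> \<noteq> \<sigma> \<Longrightarrow> \<not> ord_ge v 1 (\<tau> - \<sigma>)"
  using someI_ex[OF residues_exist[OF v]] unfolding residues_def[symmetric] by blast+

lemma q_ge_2: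
  assumes v: "is_prime_place v"
  shows "q v \<ge> 2"
proof -
  obtain a b where ab: "a \<in> residues v" "b \<in> residues v" "ord_ge v 1 (0 - a)" "ord_ge v 1 (1 - b)"
    using residues(3)[OF v, of 0] residues(3)[OF v, of 1] v by auto
  have "a \<noteq> b"
  proof
    assume "a = b"
    then have "ord_ge v 1 ((1 - b) - (0 - a))" using ab ord_ge_diff[OF v] by blast
    then show False using \<open>a = b\<close> v by (simp add: ord_ge_def)
  qed
  then have "card {a, b} = 2" by simp
  moreover have "card {a, b} \<le> q v" unfolding q_def using residues(1)[OF v] ab by (intro card_mono) auto
  ultimately show ?thesis by simp
qed

text \<open>Truncated expansions in a uniformizer, with digits in \<open>residues v\<close>.\<close>

lemma digits_exist:
  assumes v: "is_prime_place v"
  shows "\<exists>T. finite T \<and> card T = q v ^ n \<and> (\<forall>\<tau>\<in>T. ord_ge v 0 \<tau>) \<and>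
    (\<forall>\<tau>\<in>T. \<forall>\<sigma>\<in>T. \<tau> \<noteq> \<sigma> \<longrightarrow> \<not> ord_ge v (int n) (\<tau> - \<sigma>))"
proof (induction n)
  case 0
  show ?case by (rule exI[of _ "{0}"]) simp
next
  case (Suc n)
  then obtain T where T: "finite T" "card T = q v ^ n" "\<And>\<tau>. \<tau> \<in> T \<Longrightarrow> ord_ge v 0 \<tau>"
    "\<And>\<tau> \<sigma>. \<tau> \<in> T \<Longrightarrow> \<sigma> \<in> T \<Longrightarrow> \<tau> \<noteq> \<sigma> \<Longrightarrow> \<not> ord_ge v (int n) (\<tau> - \<sigma>)" by blast
  note R = residues[OF v]
  obtain z where z: "z \<noteq> 0" "ord_at v z = 1" using uniformizer_exists[OF v] .
  define F where "F = (\<lambda>(\<tau>, \<rho>). \<tau> + z ^ n * \<rho>)"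
  have zn: "ord_ge v (int n) (z ^ n * \<rho>)" if "ord_ge v 0 \<rho>" for \<rho>
    using that z v by (simp add: ord_ge_mult_iff ord_at_power)
  have sep: "\<not> ord_ge v (int (Suc n)) (F a - F b)" if ab: "a \<in> T \<times> residues v" "b \<in> T \<times> residues v" "a \<noteq> b" for a b
  proof
    assume *: "ord_ge v (int (Suc n)) (F a - F b)"
    obtain \<tau> \<rho> \<sigma> \<eta> where e: "a = (\<tau>, \<rho>)" "b = (\<sigma>, \<eta>)" by (cases a, cases b)
    show False
    proof (cases "\<tau> = \<sigma>")
      case True
      then have "F a - F b = z ^ n * (\<rho> - \<eta>)" unfolding F_def e by (simp add: algebra_simps)
      then have "ord_ge v 1 (\<rho> - \<eta>)" using * z v by (simp add: ord_ge_mult_iff ord_at_power)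
      then show False using R(4)[of \<rho> \<eta>] ab True unfolding e by auto
    next
      case False
      have "\<tau> - \<sigma> = (F a - F b) - z ^ n * (\<rho> - \<eta>)" unfolding F_def e by (simp add: algebra_simps)
      moreover have "ord_ge v (int n) (F a - F b)" using * by (rule ord_ge_mono) simp
      moreover have "ord_ge v (int n) (z ^ n * (\<rho> - \<eta>))"
        using ab R(2) by (intro zn ord_ge_diff[OF v]) (auto simp: e)
      ultimately have "ord_ge v (int n) (\<tau> - \<sigma>)" using ord_ge_diff[OF v] by metis
      then show False using T(4)[of \<tau> \<sigma>] ab False unfolding e by auto
    qed
  qed
  have "inj_on F (T \<times> residues v)"
    by (rule inj_onI) (use sep in \<open>metis diff_self ord_ge_0\<close>)
  then have "card (F ` (T \<times> residues v)) = q v ^ Suc n"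
    using T(2) by (simp add: card_image card_cartesian_product q_def)
  moreover have "ord_ge v 0 y" if "y \<in> F ` (T \<times> residues v)" for y
    using that T(3) R(2) ord_ge_mono[OF zn, of _ 0] unfolding F_def
    by (auto intro!: ord_ge_add[OF v])
  moreover have "\<not> ord_ge v (int (Suc n)) (x - y)"
    if "x \<in> F ` (T \<times> residues v)" "y \<in> F ` (T \<times> residues v)" "x \<noteq> y" for x y
    using that sep by blast
  moreover have "finite (F ` (T \<times> residues v))" using T(1) R(1) by simp
  ultimately show ?case by blast
qed

text \<open>A Chinese remainder statement: weak approximation glues one local digit set per place,
  to a precision \<open>N\<close> beyond every \<open>k v\<close>.\<close>

lemma residue_vectors_exist:
  assumes fin: "finite Z" and Z: "\<forall>v\<in>Z. is_prime_place v"
  shows "\<exists>T. finite T \<and> card T = (\<Prod>v\<in>Z. q v ^ k v) \<and> (\<forall>\<tau>\<in>T. \<forall>v\<in>Z. ord_ge v 0 \<tau>) \<and>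
    (\<forall>\<tau>\<in>T. \<forall>\<sigma>\<in>T. \<tau> \<noteq> \<sigma> \<longrightarrow> (\<exists>v\<in>Z. \<not> ord_ge v (int (k v)) (\<tau> - \<sigma>)))"
proof -
  have "\<forall>v\<in>Z. \<exists>T. finite T \<and> card T = q v ^ k v \<and> (\<forall>\<tau>\<in>T. ord_ge v 0 \<tau>) \<and>
    (\<forall>\<tau>\<in>T. \<forall>\<sigma>\<in>T. \<tau> \<noteq> \<sigma> \<longrightarrow> \<not> ord_ge v (int (k v)) (\<tau> - \<sigma>))"
    using Z by (intro ballI digits_exist) blast
  from bchoice[OF this] obtain D where D: "\<And>v. v \<in> Z \<Longrightarrow> finite (D v) \<and> card (D v) = q v ^ k v \<and>
    (\<forall>\<tau>\<in>D v. ord_ge v 0 \<tau>) \<and>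
    (\<forall>\<tau>\<in>D v. \<forall>\<sigma>\<in>D v. \<tau> \<noteq> \<sigma> \<longrightarrow> \<not> ord_ge v (int (k v)) (\<tau> - \<sigma>))" by blast
  define N where "N = (\<Sum>v\<in>Z. int (k v))"
  have N: "int (k v) \<le> N" if "v \<in> Z" for v
    unfolding N_def using fin that by (intro member_le_sum[of v Z "\<lambda>v. int (k v)"]) auto
  obtain Y where Y: "\<And>f v. v \<in> Z \<Longrightarrow> ord_ge v N (Y f - f v)"
    using weak_approximation[OF fin Z, of N] by metis
  let ?P = "PiE Z D"
  have near: "ord_ge v (int (k v)) (Y f - f v)" if "v \<in> Z" for f v
    using ord_ge_mono[OF Y[OF that] N[OF that]] .
  have sep: "\<exists>v\<in>Z. \<not> ord_ge v (int (k v)) (Y f - Y g)" if fg: "f \<in> ?P" "g \<in> ?P" "f \<noteq> g" for f g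
  proof -
    obtain v where v: "v \<in> Z" "f v \<noteq> g v" using PiE_ext[OF fg(1,2)] fg(3) by blast
    have pv: "is_prime_place v" using Z v by blast
    have "\<not> ord_ge v (int (k v)) (Y f - Y g)"
    proof
      assume *: "ord_ge v (int (k v)) (Y f - Y g)"
      have "ord_ge v (int (k v)) ((Y f - Y g) - (Y f - f v) + (Y g - g v))"
        by (rule ord_ge_add[OF pv ord_ge_diff[OF pv * near[OF v(1)]] near[OF v(1)]])
      then show False using D[OF v(1)] fg v by (auto simp: PiE_def Pi_def)
    qed
    then show ?thesis using v by blast
  qed
  define U where "U = Y ` ?P"
  have "inj_on Y ?P" by (rule inj_onI) (use sep in \<open>metis diff_self ord_ge_0\<close>)
  then have "card (Y ` ?P) = (\<Prod>v\<in>Z. q v ^ k v)"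
    using D fin by (simp add: card_image card_PiE)
  moreover have "finite (Y ` ?P)" using fin D by (intro finite_imageI finite_PiE) auto
  moreover have "ord_ge v 0 y" if y: "y \<in> Y ` ?P" and v: "v \<in> Z" for y v
  proof -
    obtain f where f: "f \<in> ?P" "y = Y f" using y by blast
    have pv: "is_prime_place v" using Z v by blast
    have "ord_ge v 0 (Y f - f v)" using near[OF v] by (rule ord_ge_mono) simp
    moreover have "ord_ge v 0 (f v)" using D[OF v] f v by (auto simp: PiE_def Pi_def)
    ultimately have "ord_ge v 0 ((Y f - f v) + f v)" by (rule ord_ge_add[OF pv])
    then show ?thesis using f by simp
  qed
  moreover have "\<exists>v\<in>Z. \<not> ord_ge v (int (k v)) (x - y)" if "x \<in> Y ` ?P" "y \<in> Y ` ?P" "x \<noteq> y" for x y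
    using that sep by blast
  ultimately show ?thesis unfolding U_def[symmetric] by (intro exI[of _ U]) simp
qed

lemma representatives_exist:
  assumes Z: "finite Z" "\<forall>v\<in>Z. is_prime_place v" "\<forall>v\<in>Z. ord_at v x > 0" and x: "x \<noteq> 0"
    and A: "A = {y. \<forall>v\<in>Z. ord_ge v 0 y}"
  shows "is_subring A" "x \<in> A"
    "\<exists>T\<subseteq>A. finite T \<and> card T = (\<Prod>v\<in>Z. q v ^ nat (ord_at v x)) \<and> incongruent A x T"
proof -
  have nonneg: "\<forall>v\<in>Z. ord_at v x \<ge> 0" using Z(3) by (simp add: less_imp_le)
  then show "x \<in> A" unfolding A by (simp add: ord_ge_def)
  show "is_subring A" unfolding A by (rule is_subring_integral[OF Z(2)])
  obtain T where T: "finite T" "card T = (\<Prod>v\<in>Z. q v ^ nat (ord_at v x))" "\<forall>\<tau>\<in>T. \<forall>v\<in>Z. ord_ge v 0 \<tau>"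
    "\<forall>\<tau>\<in>T. \<forall>\<sigma>\<in>T. \<tau> \<noteq> \<sigma> \<longrightarrow> (\<exists>v\<in>Z. \<not> ord_ge v (int (nat (ord_at v x))) (\<tau> - \<sigma>))"
    using residue_vectors_exist[OF Z(1,2), of "\<lambda>v. nat (ord_at v x)"] by (elim exE conjE) (rule that)
  have "incongruent A x T"
    unfolding A using T(4) nonneg by (intro incongruent_integral[OF Z(2) x]) auto
  moreover have "T \<subseteq> A" unfolding A using T(3) by blast
  ultimately show "\<exists>T\<subseteq>A. finite T \<and> card T = (\<Prod>v\<in>Z. q v ^ nat (ord_at v x)) \<and> incongruent A x T"
    using T(1,2) by blast
qed

text \<open>Since every norm is at least 2, \<open>C\<close> zeros give at least
  \<open>2 ^ C\<close> classes modulo \<open>x\<close>. The bound \<open>C\<close> on the number of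
  classes does not depend on the set of zeros, so this is too many.\<close>

lemma finite_zeros:
  assumes "x \<noteq> 0"
  shows "finite {v :: 'k \<Rightarrow> int extended. is_prime_place v \<and> ord_at v x > 0}" (is "finite ?Z")
proof (rule ccontr)
  assume inf: "infinite ?Z"
  obtain C where C: "\<And>A T. is_subring A \<Longrightarrow> x \<in> A \<Longrightarrow> T \<subseteq> A \<Longrightarrow> incongruent A x T \<Longrightarrow> card T \<le> C"
    using incongruent_bound[OF assms] by blast
  obtain Z where Z: "Z \<subseteq> ?Z" "finite Z" "card Z = C"
    using infinite_arbitrarily_large[OF inf] by blast
  have pZ: "\<forall>v\<in>Z. is_prime_place v" and pos: "\<forall>v\<in>Z. ord_at v x > 0" using Z by blast+
  note rep = representatives_exist[OF Z(2) pZ pos assms refl]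
  obtain T where T: "T \<subseteq> {y. \<forall>v\<in>Z. ord_ge v 0 y}" "card T = (\<Prod>v\<in>Z. q v ^ nat (ord_at v x))"
    "incongruent {y. \<forall>v\<in>Z. ord_ge v 0 y} x T"
    using rep(3) by (elim exE conjE) (rule that)
  have "card T \<le> C" using C[OF rep(1,2) T(1,3)] .
  moreover have "card T \<ge> 2 ^ C"
  proof -
    have "(\<Prod>v\<in>Z. 2) \<le> (\<Prod>v\<in>Z. q v ^ nat (ord_at v x))"
    proof (intro prod_mono conjI)
      fix v assume v: "v \<in> Z"
      have "2 \<le> q v ^ 1" using q_ge_2 pZ v by simp
      also have "\<dots> \<le> q v ^ nat (ord_at v x)"
        using q_ge_2[of v] pZ v pos by (intro power_increasing) auto
      finally show "2 \<le> q v ^ nat (ord_at v x)" .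
    qed simp
    then show ?thesis using T(2) Z(3) by simp
  qed
  ultimately show False using less_exp[of C] by linarith
qed

lemma finite_poles:
  "finite {v :: 'k \<Rightarrow> int extended. is_prime_place v \<and> ord_at v x < 0}"
proof (cases "x = 0")
  case True
  have "ord_at v 0 = 0" if "is_prime_place v" for v :: "'k \<Rightarrow> int extended"
    using place_0[OF that] by (simp add: ord_at_def)
  then have "{v :: 'k \<Rightarrow> int extended. is_prime_place v \<and> ord_at v x < 0} = {}" using True by auto
  then show ?thesis by (simp only: finite.emptyI)
next
  case False
  have "{v :: 'k \<Rightarrow> int extended. is_prime_place v \<and> ord_at v x < 0} = {v. is_prime_place v \<and> ord_at v (inverse x) > 0}"
    using False by (auto simp: ord_at_inverse)
  then show ?thesis using finite_zeros[of "inverse x"] False by (simp only: inverse_nonzero_iff_nonzero not_False_eq_True)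
qed

text \<open>Making all elements agree to one more order at \<open>v\<close> costs at most a factor
  \<open>q v\<close> in size: after dividing the differences from \<open>g\<close> by
  \<open>z powi k\<close>, keep the most frequent residue.\<close>

lemma fiber_step:
  assumes v: "is_prime_place v" and G: "finite G" "\<And>a b. a \<in> G \<Longrightarrow> b \<in> G \<Longrightarrow> ord_ge v k (a - b)"
  shows "\<exists>G'\<subseteq>G. card G \<le> q v * card G' \<and> (\<forall>a\<in>G'. \<forall>b\<in>G'. ord_ge v (k + 1) (a - b))"
proof (cases "G = {}")
  case False
  then obtain g where g: "g \<in> G" by blast
  note R = residues[OF v]
  obtain z where z: "z \<noteq> 0" "ord_at v z = 1" using uniformizer_exists[OF v] .
  have "\<exists>\<rho>\<in>residues v. ord_ge v 1 ((a - g) / z powi k - \<rho>)" if "a \<in> G" for a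
  proof (rule R(3))
    have "ord_ge v k (z powi k * ((a - g) / z powi k))" using G(2)[OF that g] z by simp
    then show "ord_ge v 0 ((a - g) / z powi k)"
      using z v ord_ge_mult_iff[OF v, of "z powi k" k "(a - g) / z powi k"] by (simp add: ord_at_powi)
  qed
  then obtain \<rho> where \<rho>: "\<And>a. a \<in> G \<Longrightarrow> \<rho> a \<in> residues v"
    "\<And>a. a \<in> G \<Longrightarrow> ord_ge v 1 ((a - g) / z powi k - \<rho> a)" by metis
  define F where "F r = {a \<in> G. \<rho> a = r}" for r
  let ?M = "(\<lambda>s. card (F s)) ` residues v"
  have M: "finite ?M" "?M \<noteq> {}" using R(1) \<rho>(1)[OF g] by blast+
  obtain r where r: "r \<in> residues v" "card (F r) = Max ?M" using Max_in[OF M] by auto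
  have r_max: "card (F s) \<le> card (F r)" if "s \<in> residues v" for s
    unfolding r(2) using M(1) that by (intro Max_ge) auto
  have "G = (\<Union>s\<in>residues v. F s)" using \<rho>(1) unfolding F_def by blast
  then have "card G \<le> (\<Sum>s\<in>residues v. card (F s))" using card_UN_le[OF R(1), of F] by simp
  also have "\<dots> \<le> q v * card (F r)" unfolding q_def using r_max sum_bounded_above[of "residues v" "\<lambda>s. card (F s)"] by simp
  finally have "card G \<le> q v * card (F r)" .
  moreover have "ord_ge v (k + 1) (a - b)" if "a \<in> F r" "b \<in> F r" for a b
  proof -
    have ab: "a \<in> G" "b \<in> G" "\<rho> a = \<rho> b" using that unfolding F_def by auto
    have "ord_ge v 1 (((a - g) / z powi k - \<rho> a) - ((b - g) / z powi k - \<rho> b))"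
      by (rule ord_ge_diff[OF v \<rho>(2)[OF ab(1)] \<rho>(2)[OF ab(2)]])
    then have "ord_ge v 1 ((a - b) / z powi k)" using ab(3) by (simp add: diff_divide_distrib)
    then have "ord_ge v (k + 1) (z powi k * ((a - b) / z powi k))"
      using z v by (subst ord_ge_mult_iff) (auto simp: ord_at_powi)
    then show ?thesis using z by simp
  qed
  moreover have "F r \<subseteq> G" unfolding F_def by blast
  ultimately show ?thesis by blast
qed auto

lemma fiber_steps:
  assumes v: "is_prime_place v" and G: "finite G" "\<And>a b. a \<in> G \<Longrightarrow> b \<in> G \<Longrightarrow> ord_ge v k (a - b)"
  shows "\<exists>G'\<subseteq>G. card G \<le> q v ^ m * card G' \<and> (\<forall>a\<in>G'. \<forall>b\<in>G'. ord_ge v (k + int m) (a - b))"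
proof (induction m)
  case 0
  show ?case using G by (intro exI[of _ G]) simp
next
  case (Suc m)
  then obtain H where H: "H \<subseteq> G" "card G \<le> q v ^ m * card H" "\<And>a b. a \<in> H \<Longrightarrow> b \<in> H \<Longrightarrow> ord_ge v (k + int m) (a - b)"
    by blast
  obtain G' where G': "G' \<subseteq> H" "card H \<le> q v * card G'" "\<forall>a\<in>G'. \<forall>b\<in>G'. ord_ge v (k + int m + 1) (a - b)"
    using fiber_step[OF v finite_subset[OF H(1) G(1)] H(3)] by blast
  have "card G \<le> q v ^ m * (q v * card G')"
    using H(2) G'(2) by (meson le_trans mult_le_mono2)
  then have "card G \<le> q v ^ Suc m * card G'" by (simp add: mult_ac)
  moreover have "\<forall>a\<in>G'. \<forall>b\<in>G'. ord_ge v (k + int (Suc m)) (a - b)" using G'(3) by (simp add: add_ac)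
  ultimately show ?case using G'(1) H(1) by blast
qed

lemma fiber_multi:
  assumes "finite P" "\<forall>v\<in>P. is_prime_place v" "finite G"
    and "\<And>v a b. v \<in> P \<Longrightarrow> a \<in> G \<Longrightarrow> b \<in> G \<Longrightarrow> ord_ge v (k v) (a - b)"
  shows "\<exists>G'\<subseteq>G. card G \<le> (\<Prod>v\<in>P. q v ^ m v) * card G' \<and>
    (\<forall>v\<in>P. \<forall>a\<in>G'. \<forall>b\<in>G'. ord_ge v (k v + int (m v)) (a - b))"
  using assms(1,2,4)
proof (induction P rule: finite_induct)
  case empty
  show ?case by (intro exI[of _ G]) simp
next
  case (insert u P)
  obtain H where H: "H \<subseteq> G" "card G \<le> (\<Prod>v\<in>P. q v ^ m v) * card H"
    "\<And>v a b. v \<in> P \<Longrightarrow> a \<in> H \<Longrightarrow> b \<in> H \<Longrightarrow> ord_ge v (k v + int (m v)) (a - b)"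
    using insert.IH insert.prems by (metis insertCI)
  have "ord_ge u (k u) (a - b)" if "a \<in> H" "b \<in> H" for a b
    using insert.prems(2) H(1) that by blast
  then obtain G' where G': "G' \<subseteq> H" "card H \<le> q u ^ m u * card G'"
    "\<forall>a\<in>G'. \<forall>b\<in>G'. ord_ge u (k u + int (m u)) (a - b)"
    using fiber_steps[of u H "k u" "m u"] insert.prems(1) finite_subset[OF H(1) assms(3)] by blast
  have "card G \<le> (\<Prod>v\<in>P. q v ^ m v) * (q u ^ m u * card G')"
    using H(2) G'(2) by (meson le_trans mult_le_mono2)
  then have "card G \<le> (\<Prod>v\<in>insert u P. q v ^ m v) * card G'"
    using insert(1,2) by (simp add: mult_ac)
  moreover have "\<forall>v\<in>insert u P. \<forall>a\<in>G'. \<forall>b\<in>G'. ord_ge v (k v + int (m v)) (a - b)"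
    using G'(1,3) H(3) by blast
  moreover have "G' \<subseteq> G" using G'(1) H(1) by (rule subset_trans)
  ultimately show ?case by blast
qed

text \<open>The exponents from 0 to \<open>q v\<close> are one more than there are residues. The
  bound on \<open>j\<close> later shows that places of bounded norm are finite in number.\<close>

lemma residue_pigeonhole:
  assumes v: "is_prime_place v" and x: "ord_ge v 0 x"
  shows "\<exists>i j. i < j \<and> j \<le> q v \<and> ord_ge v 1 (x ^ i - x ^ j)"
proof -
  note R = residues[OF v]
  have "\<forall>n. \<exists>r. r \<in> residues v \<and> ord_ge v 1 (x ^ n - r)"
    using R(3)[OF ord_ge_power[OF v x]] by blast
  from choice[OF this] obtain \<rho> where \<rho>: "\<And>n. \<rho> n \<in> residues v" "\<And>n. ord_ge v 1 (x ^ n - \<rho> n)"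
    by blast
  have "card (\<rho> ` {0..q v}) \<le> q v"
    unfolding q_def using R(1) \<rho>(1) by (intro card_mono) auto
  then have "\<not> inj_on \<rho> {0..q v}"
    using card_image by fastforce
  then obtain i j where "i \<le> q v" "j \<le> q v" "i \<noteq> j" "\<rho> i = \<rho> j" unfolding inj_on_def by auto
  then obtain i j where ij: "i < j" "j \<le> q v" "\<rho> i = \<rho> j" by (metis linorder_neqE_nat)
  have "ord_ge v 1 ((x ^ i - \<rho> i) - (x ^ j - \<rho> j))" by (rule ord_ge_diff[OF v \<rho>(2) \<rho>(2)])
  then show ?thesis using ij by auto
qed

end

section \<open>Clearing poles, and the product formula inequality\<close>

context function_field
begin

lemma power_inj_of_ord:
  assumes v: "is_prime_place v" and x: "x \<noteq> 0" "ord_at v x \<noteq> 0" and "i < j"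
  shows "x ^ i \<noteq> x ^ j"
proof
  assume "x ^ i = x ^ j"
  then have "int i * ord_at v x = int j * ord_at v x" using ord_at_power[OF v x(1)] by metis
  then show False using assms by simp
qed

text \<open>A product of differences \<open>x ^ i - x ^ j\<close>, one vanishing at each place.
  Membership in every subring containing \<open>x\<close> records that \<open>h\<close> is an
  integer polynomial in \<open>x\<close>: it is integral wherever \<open>x\<close> is and, for
  \<open>x = t\<close>, comes from a polynomial in \<open>t\<close>.\<close>

lemma kill_places:
  fixes x :: 'k
  assumes x: "\<forall>i j. i < j \<longrightarrow> x ^ i \<noteq> x ^ j"
    and P: "\<forall>v. is_prime_place v \<longrightarrow> v \<notin> P \<longrightarrow> ord_ge v 0 x"
    and U: "finite U" "\<forall>u\<in>U. is_prime_place u"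
  shows "\<exists>h. h \<noteq> 0 \<and> (\<forall>A. is_subring A \<longrightarrow> x \<in> A \<longrightarrow> h \<in> A) \<and> (\<forall>u\<in>U - P. ord_ge u (int n) h)"
proof -
  have "\<forall>u\<in>U - P. \<exists>y. y \<noteq> 0 \<and> (\<forall>A. is_subring A \<longrightarrow> x \<in> A \<longrightarrow> y \<in> A) \<and> ord_ge u 1 y"
  proof
    fix u assume u: "u \<in> U - P"
    then obtain i j where ij: "i < j" "ord_ge u 1 (x ^ i - x ^ j)"
      using residue_pigeonhole[of u x] P U(2) by blast
    then show "\<exists>y. y \<noteq> 0 \<and> (\<forall>A. is_subring A \<longrightarrow> x \<in> A \<longrightarrow> y \<in> A) \<and> ord_ge u 1 y"
      using x ij(1) by (intro exI[of _ "x ^ i - x ^ j"]) (simp add: is_subringD)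
  qed
  from bchoice[OF this] obtain y where y: "\<And>u. u \<in> U - P \<Longrightarrow> y u \<noteq> 0"
    "\<And>u A. u \<in> U - P \<Longrightarrow> is_subring A \<Longrightarrow> x \<in> A \<Longrightarrow> y u \<in> A" "\<And>u. u \<in> U - P \<Longrightarrow> ord_ge u 1 (y u)"
    by blast
  define h where "h = (\<Prod>u\<in>U - P. y u ^ n)"
  have fin: "finite (U - P)" using U by simp
  have "h \<noteq> 0" unfolding h_def using y(1) fin by simp
  moreover have "h \<in> A" if "is_subring A" "x \<in> A" for A
    unfolding h_def by (rule is_subring_prod[OF that(1)]) (use y(2) that in \<open>simp add: is_subringD\<close>)
  moreover have "ord_ge u (int n) h" if u: "u \<in> U - P" for u
  proof -
    have pu: "is_prime_place u" using U u by blast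
    have "h = y u ^ n * (\<Prod>u\<in>U - P - {u}. y u ^ n)"
      unfolding h_def using fin u by (rule prod.remove)
    moreover have "ord_ge u (int n) (y u ^ n)"
      using y(1,3)[OF u] pu mult_left_mono[of 1 "ord_at u (y u)" "int n"] by (simp add: ord_ge_def ord_at_power)
    moreover have "(\<Prod>u\<in>U - P - {u}. y u ^ n) \<in> {z. \<forall>v\<in>{u}. ord_ge v 0 z}"
    proof (rule is_subring_prod[OF is_subring_integral])
      show sub: "\<forall>v\<in>{u}. is_prime_place v" using pu by simp
      fix w assume "w \<in> U - P - {u}"
      then show "y w ^ n \<in> {z. \<forall>v\<in>{u}. ord_ge v 0 z}"
        using y(2)[of w "{z. \<forall>v\<in>{u}. ord_ge v 0 z}"] is_subring_integral[OF sub] P pu u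
        by (auto intro: ord_ge_power[OF pu])
    qed
    ultimately show ?thesis using ord_ge_mult0(1)[OF pu] by simp
  qed
  ultimately show ?thesis by blast
qed

lemma subring_member_integral:
  assumes "\<And>A. is_subring A \<Longrightarrow> x \<in> A \<Longrightarrow> h \<in> A" "is_prime_place v" "ord_ge v 0 x"
  shows "ord_ge v 0 h"
  using assms(1)[OF is_subring_integral[of "{v}"]] assms(2,3) by simp

lemma place_bound:
  assumes "finite T" "finite P"
  shows "\<exists>C :: nat. \<forall>\<tau>\<in>T. \<forall>v\<in>P. ord_ge v (- int C) \<tau>"
proof (intro exI ballI)
  fix \<tau> v assume "\<tau> \<in> T" "v \<in> P"
  then have "nat \<bar>ord_at v \<tau>\<bar> \<le> (\<Sum>\<tau>\<in>T. \<Sum>u\<in>P. nat \<bar>ord_at u \<tau>\<bar>)"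
    using assms by (intro member_le_double_sum) auto
  then show "ord_ge v (- int (\<Sum>\<tau>\<in>T. \<Sum>u\<in>P. nat \<bar>ord_at u \<tau>\<bar>)) \<tau>"
    unfolding ord_ge_def by linarith
qed

lemma kill_poles:
  fixes x :: 'k
  assumes x: "\<forall>i j. i < j \<longrightarrow> x ^ i \<noteq> x ^ j"
    and P: "\<forall>v. is_prime_place v \<longrightarrow> v \<notin> P \<longrightarrow> ord_ge v 0 x"
    and T: "finite T"
  shows "\<exists>h. h \<noteq> 0 \<and> (\<forall>A. is_subring A \<longrightarrow> x \<in> A \<longrightarrow> h \<in> A) \<and>
    (\<forall>\<tau>\<in>T. \<forall>v. is_prime_place v \<longrightarrow> v \<notin> P \<longrightarrow> ord_ge v 0 (h * \<tau>))"
proof -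
  define U where "U = (\<Union>\<tau>\<in>T. {v :: 'k \<Rightarrow> int extended. is_prime_place v \<and> ord_at v \<tau> < 0})"
  have U: "finite U" "\<forall>u\<in>U. is_prime_place u"
    unfolding U_def using T finite_poles by auto
  obtain n :: nat where n: "\<forall>\<tau>\<in>T. \<forall>u\<in>U. ord_ge u (- int n) \<tau>"
    using place_bound[OF T U(1)] by (rule exE)
  obtain h where h: "h \<noteq> 0" "\<forall>A. is_subring A \<longrightarrow> x \<in> A \<longrightarrow> h \<in> A" "\<forall>u\<in>U - P. ord_ge u (int n) h"
    using kill_places[OF x P U, where n = n] by (elim exE conjE) (rule that)
  have "ord_ge v 0 (h * \<tau>)" if "\<tau> \<in> T" "is_prime_place v" "v \<notin> P" for \<tau> v
  proof (cases "v \<in> U")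
    case True
    have "ord_ge v (- int n) \<tau>" using n that(1) True by blast
    then have "ord_ge v (int n + - int n) (h * \<tau>)" using h(3) True that by (intro ord_ge_mult) simp_all
    then show ?thesis by simp
  next
    case False
    then have "ord_ge v 0 \<tau>" using that unfolding U_def ord_ge_def by force
    moreover have "ord_ge v 0 h"
      by (rule subring_member_integral[of x, OF _ that(2)]) (use h(2) P that(2,3) in simp_all)
    ultimately show ?thesis using ord_ge_mult0(2)[OF that(2)] by metis
  qed
  then show ?thesis using h(1,2) by (intro exI[of _ h]) simp
qed

lemma no_poles_with_zero:
  assumes "is_prime_place v" "ord_ge v 1 d" "\<And>u. is_prime_place u \<Longrightarrow> ord_ge u 0 d"
  shows "d = (0 :: 'k)"
  using pole_exists[of v d] assms unfolding ord_ge_def by force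

text \<open>The digits may have poles outside \<open>P\<close>; the factor \<open>h\<close> clears
  them. The expansions times \<open>h\<close> then have poles only in \<open>P\<close>, of order at
  most \<open>n v * J + C\<close>. If two of them agree to positive order on \<open>P\<close>, their
  difference has a zero and no poles, so it is 0.\<close>

theorem product_formula_le:
  fixes x :: 'k
  assumes x: "x \<noteq> 0"
    and Z: "finite Z" "\<forall>v\<in>Z. is_prime_place v" "\<forall>v\<in>Z. ord_at v x > 0"
    and P: "finite P" "\<forall>v\<in>P. is_prime_place v" "\<forall>v. is_prime_place v \<longrightarrow> v \<notin> P \<longrightarrow> ord_ge v 0 x"
  shows "(\<Prod>v\<in>Z. q v ^ nat (ord_at v x)) \<le> (\<Prod>v\<in>P. q v ^ nat (- ord_at v x))"
proof (cases "Z = {}")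
  case True
  have "q v \<ge> 1" if "v \<in> P" for v using q_ge_2[of v] P(2) that by force
  then have "(\<Prod>v\<in>P. q v ^ nat (- ord_at v x)) \<ge> 1" by (intro prod_ge_1) (simp add: one_le_power)
  then show ?thesis using True by simp
next
  case False
  then obtain v0 where v0: "v0 \<in> Z" "is_prime_place v0" "ord_at v0 x > 0" using Z by blast
  obtain w0 where w0: "is_prime_place w0" "ord_at w0 x < 0" using pole_exists[OF v0(2) x v0(3)] by blast
  then have w0P: "w0 \<in> P" using P(3) w0(1) x by (auto simp: ord_ge_def)
  define A where "A = {y. \<forall>v\<in>Z. ord_ge v 0 y}"
  note A = representatives_exist(1,2)[OF Z x A_def]
  obtain T where TA: "T \<subseteq> A" and T: "finite T" "card T = (\<Prod>v\<in>Z. q v ^ nat (ord_at v x))"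
    and inc: "incongruent A x T"
    using representatives_exist(3)[OF Z x A_def] by (elim exE conjE) (rule that)
  have nontorsion: "\<forall>i j. i < j \<longrightarrow> x ^ i \<noteq> x ^ j"
    using power_inj_of_ord[OF v0(2) x] v0(3) by simp
  obtain h where h: "h \<noteq> 0" "\<forall>\<tau>\<in>T. \<forall>v. is_prime_place v \<longrightarrow> v \<notin> P \<longrightarrow> ord_ge v 0 (h * \<tau>)"
    using kill_poles[OF nontorsion P(3) T(1)] by (elim exE conjE) (rule that)
  obtain C where C: "\<forall>\<tau>\<in>(*) h ` T. \<forall>v\<in>P. ord_ge v (- int C) \<tau>"
    using place_bound[of "(*) h ` T" P] T(1) P(1) by blast
  define n where "n v = nat (- ord_at v x)" for v
  have "card T ^ J \<le> (\<Prod>v\<in>P. q v ^ (C + 1)) * (\<Prod>v\<in>P. q v ^ n v) ^ J" for J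
  proof -
    define G where "G = (*) h ` expansions x T J"
    have finG: "finite G" unfolding G_def using card_expansions(1)[OF A x TA inc T(1)] by simp
    have "card G = card (expansions x T J)" unfolding G_def using h(1) by (intro card_image inj_onI) auto
    then have cardG: "card G = card T ^ J" using card_expansions(2)[OF A x TA inc T(1)] by simp
    have rep: "\<exists>f. (\<forall>j<J. f j \<in> T) \<and> a = (\<Sum>j<J. x ^ j * (h * f j))" if a: "a \<in> G" for a
    proof -
      obtain f where f: "f \<in> {..<J} \<rightarrow>\<^sub>E T" "a = h * (\<Sum>j<J. x ^ j * f j)"
        using a unfolding G_def expansions_def by blast
      have "a = (\<Sum>j<J. x ^ j * (h * f j))" unfolding f(2) by (simp add: sum_distrib_left mult_ac)
      then show ?thesis using f(1) by (intro exI[of _ f]) auto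
    qed
    have poles: "ord_ge v (- int (n v * J + C)) a" if a: "a \<in> G" and v: "v \<in> P" for a v
    proof -
      have pv: "is_prime_place v" using P v by blast
      obtain f where f: "\<forall>j<J. f j \<in> T" "a = (\<Sum>j<J. x ^ j * (h * f j))" using rep[OF a] by blast
      show ?thesis unfolding f(2)
      proof (rule ord_ge_sum[OF pv])
        fix j assume j: "j \<in> {..<J}"
        have "ord_ge v (- int (n v * J)) (x ^ j)"
        proof -
          have "int j * ord_at v x \<ge> int j * (- int (n v))" unfolding n_def by (intro mult_left_mono) auto
          moreover have "int j * int (n v) \<le> int J * int (n v)" using j by (intro mult_right_mono) auto
          ultimately have "ord_at v (x ^ j) \<ge> - int (n v * J)"
            using ord_at_power[OF pv x] by (simp add: mult.commute)
          then show ?thesis by (simp add: ord_ge_def)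
        qed
        moreover have "ord_ge v (- int C) (h * f j)" using C f j v by auto
        ultimately have "ord_ge v (- int (n v * J) + - int C) (x ^ j * (h * f j))" by (rule ord_ge_mult[OF pv])
        then show "ord_ge v (- int (n v * J + C)) (x ^ j * (h * f j))" by simp
      qed
    qed
    have others: "ord_ge v 0 a" if a: "a \<in> G" and v: "is_prime_place v" "v \<notin> P" for a v
    proof -
      obtain f where f: "\<forall>j<J. f j \<in> T" "a = (\<Sum>j<J. x ^ j * (h * f j))" using rep[OF a] by blast
      show ?thesis unfolding f(2)
      proof (rule ord_ge_sum[OF v(1)])
        fix j assume "j \<in> {..<J}"
        then have 1: "ord_ge v 0 (h * f j)" using h(2) f(1) v by simp
        have "ord_ge v 0 (x ^ j)" using P(3) v by (simp add: ord_ge_power)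
        then show "ord_ge v 0 (x ^ j * (h * f j))" by (rule ord_ge_mult0(2)[OF v(1) 1])
      qed
    qed
    have diffs: "ord_ge v (- int (n v * J + C)) (a - b)" if "v \<in> P" "a \<in> G" "b \<in> G" for v a b
      using that P(2) by (intro ord_ge_diff poles) auto
    \<comment> \<open>The extra 1 makes differences vanish on \<open>P\<close> instead of merely
      being integral there; \<open>w0\<close> ensures that \<open>P\<close> is nonempty, so a zero
      really arises.\<close>
    obtain G' where G': "G' \<subseteq> G" "card G \<le> (\<Prod>v\<in>P. q v ^ (n v * J + C + 1)) * card G'"
      "\<forall>v\<in>P. \<forall>a\<in>G'. \<forall>b\<in>G'. ord_ge v (- int (n v * J + C) + int (n v * J + C + 1)) (a - b)"
      using fiber_multi[OF P(1,2) finG diffs, where m = "\<lambda>v. n v * J + C + 1"] by blast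
    have "a = b" if ab: "a \<in> G'" "b \<in> G'" for a b
    proof -
      have P1: "ord_ge v 1 (a - b)" if "v \<in> P" for v using G'(3) that ab by simp
      have "a - b = 0"
      proof (rule no_poles_with_zero[OF w0(1) P1[OF w0P]])
        fix u :: "'k \<Rightarrow> int extended" assume u: "is_prime_place u"
        show "ord_ge u 0 (a - b)"
        proof (cases "u \<in> P")
          case True
          then show ?thesis using ord_ge_mono[OF P1] by simp
        next
          case False
          then show ?thesis using others u ab G'(1) by (intro ord_ge_diff) auto
        qed
      qed
      then show ?thesis by simp
    qed
    then have "card G' \<le> 1" using card_le_Suc0_iff_eq[OF finite_subset[OF G'(1) finG]] by auto
    then have "card G \<le> (\<Prod>v\<in>P. q v ^ (n v * J + C + 1)) * 1" using G'(2) by (meson le_trans mult_le_mono2)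
    also have "\<dots> = (\<Prod>v\<in>P. q v ^ (C + 1)) * (\<Prod>v\<in>P. q v ^ n v) ^ J"
    proof -
      have "q v ^ (n v * J + C + 1) = q v ^ (C + 1) * (q v ^ n v) ^ J" for v
        by (simp add: power_add power_mult)
      then show ?thesis by (simp only: prod.distrib prod_power_distrib mult_1_right)
    qed
    finally show ?thesis using cardG by simp
  qed
  then have "card T \<le> (\<Prod>v\<in>P. q v ^ n v)" by (rule pow_growth_le)
  then show ?thesis using T(2) by (simp add: n_def)
qed

end

section \<open>Units\<close>

context function_field
begin

lemma t_power_neq: "\<forall>i j. i < j \<longrightarrow> t ^ i \<noteq> t ^ j"
proof (intro allI impI notI)
  fix i j :: nat assume ij: "i < j" "t ^ i = t ^ j"
  then have "[:0, 1:] ^ i = ([:0, 1:] ^ j :: 'p mod_ring poly)"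
    by (metis emb_inj hom_power)
  then have "degree ([:0, 1:] ^ i :: 'p mod_ring poly) = degree ([:0, 1:] ^ j :: 'p mod_ring poly)" by simp
  then show False using ij by (simp add: degree_power_eq)
qed

text \<open>A substitute for Riemann-Roch. Expansions in \<open>inverse t\<close>, multiplied by
  \<open>h * t ^ J\<close>, give a family with poles only at the poles of \<open>t\<close>. Once it
  outnumbers the classes to be distinguished at \<open>v\<close> and at the poles of
  \<open>t\<close> other than \<open>w\<close>, a difference of two members has the required orders.
  The least such \<open>J\<close> keeps the pole at \<open>w\<close> small.\<close>

lemma small_norm_element:
  assumes v: "is_prime_place v" and w: "is_prime_place w" "ord_at w t < 0" and "v \<noteq> w"
  shows "\<exists>K. \<forall>M. \<exists>x. x \<noteq> 0 \<and> ord_ge v (int M) x \<and>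
    (\<forall>u. is_prime_place u \<longrightarrow> u \<noteq> w \<longrightarrow> ord_ge u 0 x) \<and> q w ^ nat (- ord_at w x) \<le> K * q v ^ M"
proof -
  define I where "I = {u :: 'k \<Rightarrow> int extended. is_prime_place u \<and> ord_at u t < 0}"
  have I: "finite I" "\<forall>u\<in>I. is_prime_place u" "w \<in> I"
    unfolding I_def using finite_poles w by auto
  have notI: "\<forall>u. is_prime_place u \<longrightarrow> u \<notin> I \<longrightarrow> ord_ge u 0 t"
    unfolding I_def ord_ge_def by auto
  define e where "e u = nat (- ord_at u t)" for u
  have e: "int (e u) = - ord_at u t" if "u \<in> I" for u using that unfolding I_def e_def by simp
  have e_inv: "ord_at u (inverse t) = int (e u)" if "u \<in> I" for u
    using e[OF that] I(2) that by (simp add: ord_at_inverse)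
  have it: "inverse t \<noteq> 0" by simp
  have pos: "\<forall>u\<in>I. ord_at u (inverse t) > 0" unfolding I_def by (simp add: ord_at_inverse)
  define A where "A = {y. \<forall>v\<in>I. ord_ge v 0 y}"
  note A = representatives_exist(1,2)[OF I(1,2) pos it A_def]
  obtain T where TA: "T \<subseteq> A" and T: "finite T" "card T = (\<Prod>u\<in>I. q u ^ nat (ord_at u (inverse t)))"
    and inc: "incongruent A (inverse t) T"
    using representatives_exist(3)[OF I(1,2) pos it A_def] by (elim exE conjE) (rule that)
  have cardT: "card T = (\<Prod>u\<in>I. q u ^ e u)" unfolding T(2) by (intro prod.cong refl) (simp add: e_inv)
  obtain h where h: "h \<noteq> 0" "\<forall>\<tau>\<in>T. \<forall>u. is_prime_place u \<longrightarrow> u \<notin> I \<longrightarrow> ord_ge u 0 (h * \<tau>)"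
    using kill_poles[OF t_power_neq notI T(1)] by (elim exE conjE) (rule that)
  obtain C where C: "\<forall>\<tau>\<in>(*) h ` T. \<forall>u\<in>I. ord_ge u (- int C) \<tau>"
    using place_bound[OF finite_imageI[OF T(1), of "(*) h"] I(1)] by (elim exE) (rule that)
  define G where "G J = (*) (h * t ^ J) ` expansions (inverse t) T J" for J
  have finG: "finite (G J)" for J
    unfolding G_def using card_expansions(1)[OF A it TA inc T(1)] by simp
  have cardG: "card (G J) = card T ^ J" for J
  proof -
    have "card (G J) = card (expansions (inverse t) T J)"
      unfolding G_def using h(1) by (intro card_image inj_onI) auto
    then show ?thesis using card_expansions(2)[OF A it TA inc T(1)] by simp
  qed
  have rep: "\<exists>f. (\<forall>j<J. f j \<in> T) \<and> a = (\<Sum>j<J. t ^ (J - j) * (h * f j))" if a: "a \<in> G J" for a J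
  proof -
    obtain f where f: "f \<in> {..<J} \<rightarrow>\<^sub>E T" "a = h * t ^ J * (\<Sum>j<J. inverse t ^ j * f j)"
      using a unfolding G_def expansions_def by blast
    have "h * t ^ J * (inverse t ^ j * f j) = t ^ (J - j) * (h * f j)" if j: "j < J" for j
    proof -
      have "t ^ J * inverse t ^ j = t ^ (J - j)" using j t_nonzero by (simp add: power_diff field_simps)
      then show ?thesis by (simp add: mult_ac)
    qed
    then have "a = (\<Sum>j<J. t ^ (J - j) * (h * f j))"
      unfolding f(2) sum_distrib_left by (intro sum.cong refl) simp
    then show ?thesis using f(1) by (intro exI[of _ f]) auto
  qed
  have poles: "ord_ge u (- int (e u * J + C)) a" if a: "a \<in> G J" and u: "u \<in> I" for a u J
  proof -
    have pu: "is_prime_place u" using I u by blast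
    obtain f where f: "\<forall>j<J. f j \<in> T" "a = (\<Sum>j<J. t ^ (J - j) * (h * f j))" using rep[OF a] by blast
    show ?thesis unfolding f(2)
    proof (rule ord_ge_sum[OF pu])
      fix j assume j: "j \<in> {..<J}"
      have "ord_at u (t ^ (J - j)) = - (int (J - j) * int (e u))"
        using e[OF u] by (simp only: ord_at_power[OF pu t_nonzero] mult_minus_right minus_minus)
      moreover have "int (J - j) * int (e u) \<le> int J * int (e u)" by (intro mult_right_mono) auto
      ultimately have "ord_ge u (- int (e u * J)) (t ^ (J - j))" by (simp add: ord_ge_def mult.commute)
      moreover have "ord_ge u (- int C) (h * f j)" using C f j u by auto
      ultimately have "ord_ge u (- int (e u * J) + - int C) (t ^ (J - j) * (h * f j))" by (rule ord_ge_mult[OF pu])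
      then show "ord_ge u (- int (e u * J + C)) (t ^ (J - j) * (h * f j))" by simp
    qed
  qed
  have others: "ord_ge u 0 a" if a: "a \<in> G J" and u: "is_prime_place u" "u \<notin> I" for a u J
  proof -
    obtain f where f: "\<forall>j<J. f j \<in> T" "a = (\<Sum>j<J. t ^ (J - j) * (h * f j))" using rep[OF a] by blast
    show ?thesis unfolding f(2)
    proof (rule ord_ge_sum[OF u(1)])
      fix j assume "j \<in> {..<J}"
      then have 1: "ord_ge u 0 (h * f j)" using h(2) f(1) u by simp
      have "ord_ge u 0 (t ^ (J - j))" using notI u by (simp add: ord_ge_power)
      then show "ord_ge u 0 (t ^ (J - j) * (h * f j))" by (rule ord_ge_mult0(2)[OF u(1) 1])
    qed
  qed
  define K0 where "K0 = (\<Prod>u\<in>I - {w}. q u ^ C)"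
  have q1: "q u \<ge> 2" if "u \<in> I" for u using q_ge_2 I(2) that by blast
  have qw: "q w \<ge> 2" "q v \<ge> 2" using q_ge_2 v w by auto
  have K0: "K0 \<ge> 1" unfolding K0_def by (intro prod_ge_1) (use q1 in \<open>force simp: one_le_power\<close>)
  have ew: "e w \<ge> 1" using e[OF I(3)] w by simp
  have "\<exists>x. x \<noteq> 0 \<and> ord_ge v (int M) x \<and> (\<forall>u. is_prime_place u \<longrightarrow> u \<noteq> w \<longrightarrow> ord_ge u 0 x) \<and>
      q w ^ nat (- ord_at w x) \<le> K0 * q w ^ (e w + C) * q v ^ M" for M
  proof -
    \<comment> \<open>The family and the classes receive the same contribution from
      \<open>I - {w}\<close>, up to the factor \<open>K0\<close>. What remains is to compare the
      contribution of \<open>w\<close> with \<open>K0 * q v ^ M\<close>.\<close>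
    define N where "N J \<longleftrightarrow> q w ^ (e w * J) > K0 * q v ^ M" for J
    have "\<exists>J. N J"
    proof
      have "K0 * q v ^ M < 2 ^ (K0 * q v ^ M)" by (rule less_exp)
      also have "\<dots> \<le> q w ^ (K0 * q v ^ M)" using qw by (intro power_mono) auto
      also have "\<dots> \<le> q w ^ (e w * (K0 * q v ^ M))" using qw ew by (intro power_increasing) auto
      finally show "N (K0 * q v ^ M)" unfolding N_def .
    qed
    define J where "J = (LEAST J. N J)"
    have NJ: "N J" unfolding J_def using \<open>\<exists>J. N J\<close> by (rule LeastI_ex)
    have "\<not> N 0" unfolding N_def using K0 qw by (simp add: not_less Suc_le_eq)
    then obtain J' where J': "J = Suc J'" using NJ by (cases J) auto
    have "\<not> N J'" using not_less_Least[of J' N] J' unfolding J_def by simp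
    define k where "k u = (if u \<in> I then - int (e u * J + C) else 0)" for u
    \<comment> \<open>Steps that undo the poles on \<open>I - {w}\<close> and produce a zero of
      order \<open>M\<close> at \<open>v\<close>.\<close>
    define m where "m u = (if u \<in> I then e u * J + C else 0) + (if u = v then M else 0)" for u
    let ?P = "insert v (I - {w})"
    have P: "finite ?P" "\<forall>u\<in>?P. is_prime_place u" using I v by auto
    have diffs: "ord_ge u (k u) (a - b)" if "is_prime_place u" "a \<in> G J" "b \<in> G J" for u a b
      using that poles others unfolding k_def by (auto intro!: ord_ge_diff)
    have diffsP: "ord_ge u (k u) (a - b)" if "u \<in> ?P" "a \<in> G J" "b \<in> G J" for u a b
      using diffs P(2) that by blast
    have "\<exists>G'\<subseteq>G J. card (G J) \<le> (\<Prod>u\<in>?P. q u ^ m u) * card G' \<and>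
      (\<forall>u\<in>?P. \<forall>a\<in>G'. \<forall>b\<in>G'. ord_ge u (k u + int (m u)) (a - b))"
      by (rule fiber_multi[OF P finG]) (rule diffsP)
    then obtain G' where G': "G' \<subseteq> G J" "card (G J) \<le> (\<Prod>u\<in>?P. q u ^ m u) * card G'"
      "\<forall>u\<in>?P. \<forall>a\<in>G'. \<forall>b\<in>G'. ord_ge u (k u + int (m u)) (a - b)"
      by (elim exE conjE) (rule that)
    have prodP: "(\<Prod>u\<in>?P. q u ^ m u) = (\<Prod>u\<in>I - {w}. q u ^ (e u * J)) * K0 * q v ^ M"
    proof -
      have "(\<Prod>u\<in>?P. q u ^ m u) = (\<Prod>u\<in>?P. q u ^ (if u \<in> I then e u * J + C else 0)) * (\<Prod>u\<in>?P. q u ^ (if u = v then M else 0))"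
        by (simp only: m_def power_add prod.distrib)
      also have "(\<Prod>u\<in>?P. q u ^ (if u = v then M else 0)) = q v ^ M"
        using P(1) by (subst prod.mono_neutral_cong_right[of ?P "{v}" _ "\<lambda>u. q u ^ M"]) auto
      also have "(\<Prod>u\<in>?P. q u ^ (if u \<in> I then e u * J + C else 0)) = (\<Prod>u\<in>I - {w}. q u ^ (e u * J + C))"
        using P(1) \<open>v \<noteq> w\<close> by (intro prod.mono_neutral_cong_right) auto
      also have "\<dots> = (\<Prod>u\<in>I - {w}. q u ^ (e u * J)) * K0"
        unfolding K0_def by (simp only: power_add prod.distrib)
      finally show ?thesis .
    qed
    have "card G' > 1"
    proof (rule ccontr)
      assume "\<not> card G' > 1"
      then have "card (G J) \<le> (\<Prod>u\<in>?P. q u ^ m u) * 1"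
        using G'(2) by (meson le_trans mult_le_mono2 not_less)
      moreover have "card (G J) = (\<Prod>u\<in>I. q u ^ (e u * J))"
        unfolding cardG cardT by (simp only: prod_power_distrib power_mult)
      then have "card (G J) = q w ^ (e w * J) * (\<Prod>u\<in>I - {w}. q u ^ (e u * J))"
        using I by (simp add: prod.remove)
      ultimately have "(\<Prod>u\<in>I - {w}. q u ^ (e u * J)) * q w ^ (e w * J) \<le> (\<Prod>u\<in>I - {w}. q u ^ (e u * J)) * (K0 * q v ^ M)"
        unfolding prodP by (simp add: mult_ac)
      moreover have "(\<Prod>u\<in>I - {w}. q u ^ (e u * J)) > 0" using q1 by (intro prod_pos) force
      ultimately have "q w ^ (e w * J) \<le> K0 * q v ^ M" by simp
      then show False using NJ unfolding N_def by simp
    qed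
    then obtain a b where ab: "a \<in> G'" "b \<in> G'" "a \<noteq> b"
      by (metis One_nat_def card_le_Suc0_iff_eq card.infinite not_less zero_le_one)
    define x where "x = a - b"
    have x0: "x \<noteq> 0" unfolding x_def using ab by simp
    have xP: "ord_ge u (k u + int (m u)) x" if "u \<in> ?P" for u unfolding x_def using G'(3) ab that by blast
    have xk: "ord_ge u (k u) x" if "is_prime_place u" for u
      unfolding x_def using diffs[OF that] ab G'(1) by blast
    have "ord_ge v (int M) x" using xP[of v] unfolding k_def m_def by (auto split: if_splits)
    moreover have "ord_ge u 0 x" if "is_prime_place u" "u \<noteq> w" for u
    proof (cases "u \<in> ?P")
      case True
      show ?thesis by (rule ord_ge_mono[OF xP[OF True]]) (simp add: k_def m_def)
    next
      case False
      then have "k u = 0" using that unfolding k_def by auto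
      then show ?thesis using xk[OF that(1)] by simp
    qed
    moreover have "q w ^ nat (- ord_at w x) \<le> K0 * q w ^ (e w + C) * q v ^ M"
    proof -
      have "- ord_at w x \<le> int (e w * J + C)" using xk[OF w(1)] I(3) x0 unfolding k_def ord_ge_def by auto
      then have "nat (- ord_at w x) \<le> e w * J + C" by (simp only: nat_le_iff)
      then have "q w ^ nat (- ord_at w x) \<le> q w ^ (e w * J + C)" using qw by (intro power_increasing) auto
      also have "\<dots> = q w ^ (e w * J') * q w ^ (e w + C)" unfolding J' by (simp add: power_add mult_ac)
      also have "\<dots> \<le> (K0 * q v ^ M) * q w ^ (e w + C)"
        using \<open>\<not> N J'\<close> unfolding N_def by (intro mult_right_mono) auto
      finally show ?thesis by (simp add: mult_ac)
    qed
    ultimately show ?thesis using x0 by blast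
  qed
  then show ?thesis by (intro exI[of _ "K0 * q w ^ (e w + C)"]) simp
qed

text \<open>The zero of \<open>x M\<close> at \<open>v\<close> uses up its pole at \<open>w\<close>
  except for a factor \<open>K\<close>, so the zeros outside \<open>S\<close> have norms at most
  \<open>K\<close>. Only finitely many patterns of orders outside \<open>S\<close> are possible. Two
  elements with the same pattern have a unit as quotient, and its order at \<open>v\<close> is
  positive if the second is chosen with a higher zero there.\<close>

theorem nontrivial_unit:
  assumes v: "is_prime_place v" and w: "is_prime_place w" "ord_at w t < 0" and vw: "v \<noteq> w"
    and S: "v \<in> S" "w \<in> S" "\<forall>u. is_prime_place u \<longrightarrow> u \<notin> S \<longrightarrow> ord_ge u 0 t"
  shows "\<exists>r. r \<noteq> 0 \<and> (\<forall>u. is_prime_place u \<longrightarrow> u \<notin> S \<longrightarrow> ord_at u r = 0) \<and> ord_at v r \<noteq> 0"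
proof -
  from small_norm_element[OF v w vw]
  obtain K where "\<forall>M. \<exists>x. x \<noteq> 0 \<and> ord_ge v (int M) x \<and>
    (\<forall>u. is_prime_place u \<longrightarrow> u \<noteq> w \<longrightarrow> ord_ge u 0 x) \<and> q w ^ nat (- ord_at w x) \<le> K * q v ^ M" by (rule exE)
  from choice[OF this] obtain x where x: "\<forall>M. x M \<noteq> 0 \<and> ord_ge v (int M) (x M) \<and>
    (\<forall>u. is_prime_place u \<longrightarrow> u \<noteq> w \<longrightarrow> ord_ge u 0 (x M)) \<and> q w ^ nat (- ord_at w (x M)) \<le> K * q v ^ M" by (rule exE)
  have x0: "x M \<noteq> 0" and xv: "ord_at v (x M) \<ge> int M" for M
    using x unfolding ord_ge_def by blast+
  have xu: "ord_at u (x M) \<ge> 0" if "is_prime_place u" "u \<noteq> w" for u M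
    using x x0 that unfolding ord_ge_def by blast
  have small: "q u ^ nat (ord_at u (x M)) \<le> K" if u: "is_prime_place u" "u \<notin> S" "ord_at u (x M) > 0" and M: "M > 0" for u M
  proof -
    have uv: "u \<noteq> v" "u \<noteq> w" using u S by auto
    have "(\<Prod>z\<in>{v, u}. q z ^ nat (ord_at z (x M))) \<le> (\<Prod>z\<in>{w}. q z ^ nat (- ord_at z (x M)))"
    proof (rule product_formula_le[OF x0])
      show "\<forall>z\<in>{v, u}. ord_at z (x M) > 0" using xv[of M] M u(3) by auto
      show "\<forall>z. is_prime_place z \<longrightarrow> z \<notin> {w} \<longrightarrow> ord_ge z 0 (x M)" using x by blast
    qed (use u v w in auto)
    then have "q v ^ nat (ord_at v (x M)) * q u ^ nat (ord_at u (x M)) \<le> q w ^ nat (- ord_at w (x M))"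
      using uv by simp
    also have "\<dots> \<le> K * q v ^ M" using x by blast
    also have "\<dots> \<le> K * q v ^ nat (ord_at v (x M))"
      using xv[of M] q_ge_2[OF v] by (intro mult_left_mono power_increasing) auto
    finally have "q v ^ nat (ord_at v (x M)) * q u ^ nat (ord_at u (x M)) \<le> q v ^ nat (ord_at v (x M)) * K"
      by (simp add: mult.commute)
    moreover have "q v ^ nat (ord_at v (x M)) > 0" using q_ge_2[OF v] by simp
    ultimately show ?thesis by (simp only: nat_mult_le_cancel1)
  qed
  define F where "F = {u :: 'k \<Rightarrow> int extended. is_prime_place u \<and> u \<notin> S \<and> q u \<le> K}"
  \<comment> \<open>A place of norm at most \<open>K\<close> is a zero of some
    \<open>t ^ i - t ^ j\<close> with \<open>i < j \<le> K\<close>.\<close>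
  have "F \<subseteq> (\<Union>j\<le>K. \<Union>i<j. {u. is_prime_place u \<and> ord_at u (t ^ i - t ^ j) > 0})"
  proof
    fix u assume u: "u \<in> F"
    then have "is_prime_place u" "ord_ge u 0 t" "q u \<le> K" using S(3) unfolding F_def by auto
    then obtain i j where ij: "i < j" "j \<le> K" "ord_ge u 1 (t ^ i - t ^ j)"
      using residue_pigeonhole[of u t] by fastforce
    moreover have "t ^ i - t ^ j \<noteq> 0" using t_power_neq ij(1) by simp
    ultimately show "u \<in> (\<Union>j\<le>K. \<Union>i<j. {u. is_prime_place u \<and> ord_at u (t ^ i - t ^ j) > 0})"
      using u unfolding F_def ord_ge_def by (intro UN_I[of j] UN_I[of i]) auto
  qed
  moreover have "finite (\<Union>j\<le>K. \<Union>i<j. {u :: 'k \<Rightarrow> int extended. is_prime_place u \<and> ord_at u (t ^ i - t ^ j) > 0})"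
    using t_power_neq by (intro finite_UN_I finite_zeros) auto
  ultimately have finF: "finite F" by (rule finite_subset)
  define sig where "sig M = restrict (\<lambda>u. nat (ord_at u (x M))) F" for M
  have sig: "sig M \<in> F \<rightarrow>\<^sub>E {..K}" if "M > 0" for M
  proof -
    have "nat (ord_at u (x M)) \<le> K" if u: "u \<in> F" for u
    proof (cases "ord_at u (x M) > 0")
      case True
      have "nat (ord_at u (x M)) < 2 ^ nat (ord_at u (x M))" by (rule less_exp)
      also have "\<dots> \<le> q u ^ nat (ord_at u (x M))" using q_ge_2 u unfolding F_def by (intro power_mono) auto
      also have "\<dots> \<le> K" using small[OF _ _ True \<open>M > 0\<close>] u unfolding F_def by simp
      finally show ?thesis by simp
    qed simp
    then show ?thesis unfolding sig_def by auto
  qed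
  have "finite (sig ` {0<..})"
    using sig finF by (intro finite_subset[of "sig ` {0<..}" "F \<rightarrow>\<^sub>E {..K}"] finite_PiE) auto
  then obtain M0 where M0: "M0 \<in> {0<..}" "infinite {M \<in> {0<..}. sig M = sig M0}"
    using pigeonhole_infinite[of "{0<..} :: nat set" sig] infinite_Ioi by blast
  obtain M where M: "M \<in> {M \<in> {0<..}. sig M = sig M0}" "M > nat (ord_at v (x M0))"
    using M0(2) by (meson finite_nat_set_iff_bounded_le not_le)
  have "ord_at v (x M / x M0) > 0"
    using xv[of M] M(2) x0 v by (simp add: ord_at_divide)
  moreover have "ord_at u (x M / x M0) = 0" if u: "is_prime_place u" "u \<notin> S" for u
  proof -
    have uw: "u \<noteq> w" using u S by auto
    have "ord_at u (x M) = ord_at u (x M0)"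
    proof (cases "u \<in> F")
      case True
      then have "nat (ord_at u (x M)) = nat (ord_at u (x M0))"
        using M(1) unfolding sig_def by (simp add: fun_eq_iff restrict_def) metis
      then show ?thesis using xu[OF u(1) uw] by (metis nat_0_le)
    next
      case False
      have "ord_at u (x L) = 0" if "L > 0" for L
      proof (rule ccontr)
        assume "ord_at u (x L) \<noteq> 0"
        then have pos: "ord_at u (x L) > 0" using xu[OF u(1) uw, of L] by simp
        have "q u ^ 1 \<le> q u ^ nat (ord_at u (x L))" using pos q_ge_2[OF u(1)] by (intro power_increasing) auto
        then have "q u \<le> K" using small[OF u pos that] by simp
        then show False using False u unfolding F_def by simp
      qed
      then show ?thesis using M M0 by simp
    qed
    then show ?thesis using x0 u by (simp add: ord_at_divide)
  qed
  ultimately show ?thesis using x0 by (intro exI[of _ "x M / x M0"]) auto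
qed

end

section \<open>Heights\<close>

locale s_integers = function_field \<phi> B
  for \<phi> :: "'p::prime_card mod_ring poly \<Rightarrow> 'k::field" and B :: "'k set" +
  fixes S :: "('k \<Rightarrow> int extended) set"
  assumes finite_S: "finite S" and card_S: "card S \<ge> 2" and places_S: "\<forall>s\<in>S. is_prime_place s"
    and t_integral: "\<forall>u. is_prime_place u \<longrightarrow> u \<notin> S \<longrightarrow> ord_ge u 0 t"
begin

abbreviation (input) R :: "'k set" where "R \<equiv> S_integers S"

lemma R_iff: "x \<in> R \<longleftrightarrow> (\<forall>u. is_prime_place u \<longrightarrow> u \<notin> S \<longrightarrow> ord_ge u 0 x)"
proof -
  have "u x \<ge> 0 \<longleftrightarrow> ord_ge u 0 x" if "is_prime_place u" for u
    using place_ge_iff[OF that, of 0 x] by (simp add: zero_extended_def)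
  then show ?thesis unfolding S_integers_def by blast
qed

lemma R_D: "x \<in> R \<Longrightarrow> is_prime_place u \<Longrightarrow> u \<notin> S \<Longrightarrow> ord_ge u 0 x"
  using R_iff by blast

lemma subring_R: "is_subring R"
proof -
  have "R = {y. \<forall>v\<in>{u. is_prime_place u \<and> u \<notin> S}. ord_ge v 0 y}" using R_iff by auto
  then show ?thesis using is_subring_integral[of "{u. is_prime_place u \<and> u \<notin> S}"] by simp
qed

lemmas RD = is_subringD[OF subring_R]

lemma t_in_R: "t \<in> R"
  using t_integral R_iff by blast

lemma infinite_place_exists: "\<exists>s\<in>S. ord_at s t < 0"
  using t_pole t_integral t_nonzero unfolding ord_ge_def by force

lemma place_S: "s \<in> S \<Longrightarrow> is_prime_place s"
  using places_S by blast

text \<open>The largest pole order at a place of \<open>S\<close>, with 0 inserted for elements that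
  have no pole there. Leaving the places unweighted by their degrees only affects the constant
  \<open>c\<close>.\<close>

definition height :: "'k \<Rightarrow> int" where
  "height x = (if x = 0 then 0 else Max (insert 0 ((\<lambda>s. - ord_at s x) ` S)))"

lemma height_nonneg: "height x \<ge> 0"
  unfolding height_def using finite_S by simp

lemma height_ge: "s \<in> S \<Longrightarrow> ord_ge s (- height x) x"
proof (cases "x = 0")
  case False
  assume "s \<in> S"
  then have "- ord_at s x \<le> height x"
    unfolding height_def using finite_S False by (auto intro!: Max_ge)
  then show ?thesis by (simp add: ord_ge_def)
qed simp

lemma height_attained:
  assumes "height x > 0"
  shows "x \<noteq> 0 \<and> (\<exists>s\<in>S. ord_at s x = - height x)"
proof -
  have x: "x \<noteq> 0" using assms by (auto simp: height_def)
  then have "height x \<in> insert 0 ((\<lambda>s. - ord_at s x) ` S)"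
    unfolding height_def using finite_S Max_in[of "insert 0 ((\<lambda>s. - ord_at s x) ` S)"] by auto
  then show ?thesis using x assms by auto
qed

lemma height_le:
  assumes "h \<ge> 0" "\<And>s. s \<in> S \<Longrightarrow> ord_ge s (- h) x"
  shows "height x \<le> h"
proof (rule ccontr)
  assume *: "\<not> ?thesis"
  then obtain s where "s \<in> S" "x \<noteq> 0" "ord_at s x = - height x" using height_attained[of x] assms(1) by auto
  then show False using assms(2)[of s] * by (simp add: ord_ge_def)
qed

lemma height_add: "height (x + y) \<le> max (height x) (height y)"
proof (rule height_le)
  fix s assume s: "s \<in> S"
  show "ord_ge s (- max (height x) (height y)) (x + y)"
    by (intro ord_ge_add place_S s ord_ge_mono[OF height_ge[OF s]]) auto
qed (simp add: height_nonneg le_max_iff_disj)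

lemma height_uminus: "height (- x) = height x"
proof -
  have "(\<lambda>s. - ord_at s (- x)) ` S = (\<lambda>s. - ord_at s x) ` S" using place_S by (intro image_cong) auto
  then show ?thesis unfolding height_def by simp
qed

lemma height_diff: "height (x - y) \<le> max (height x) (height y)"
  using height_add[of x "- y"] by (simp add: height_uminus)

lemma height_mult: "height (x * y) \<le> height x + height y"
proof (rule height_le)
  fix s assume s: "s \<in> S"
  show "ord_ge s (- (height x + height y)) (x * y)"
    using ord_ge_mult[OF place_S[OF s] height_ge[OF s] height_ge[OF s], of x y] by simp
qed (simp add: height_nonneg add_nonneg_nonneg)

lemma height_0 [simp]: "height 0 = 0" by (simp add: height_def)

lemma height_1 [simp]: "height 1 = 0"
proof -
  have "height 1 \<le> 0" by (rule height_le) (use place_S in auto)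
  then show ?thesis using height_nonneg[of 1] by simp
qed

lemma height_power: "height (x ^ n) = int n * height x"
proof (rule antisym)
  show "height (x ^ n) \<le> int n * height x"
  proof (induction n)
    case (Suc n)
    have "height (x ^ Suc n) \<le> height x + height (x ^ n)" using height_mult[of x "x ^ n"] by simp
    then show ?case using Suc by (simp add: algebra_simps)
  qed simp
  show "int n * height x \<le> height (x ^ n)"
  proof (cases "height x > 0")
    case True
    then obtain s where s: "s \<in> S" "x \<noteq> 0" "ord_at s x = - height x" using height_attained by blast
    then have "- (int n * height x) = ord_at s (x ^ n)" using place_S by (simp add: ord_at_power)
    then show ?thesis using height_ge[OF s(1), of "x ^ n"] s(2) by (simp add: ord_ge_def)
  next
    case False
    then show ?thesis using height_nonneg[of x] height_nonneg[of "x ^ n"] by simp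
  qed
qed

lemma height_prod: "height (\<Prod>i\<in>I. f i) \<le> (\<Sum>i\<in>I. height (f i))"
proof (induction I rule: infinite_finite_induct)
  case (insert i I)
  then show ?case using height_mult[of "f i" "\<Prod>i\<in>I. f i"] by simp
qed auto

definition c :: int where
  "c = int (\<Prod>s\<in>S. q s)"

lemma c_ge_1: "c \<ge> 1"
proof -
  have "(\<Prod>s\<in>S. q s) \<ge> 1" by (intro prod_ge_1) (use q_ge_2 place_S in fastforce)
  then show ?thesis unfolding c_def by (metis of_nat_1 of_nat_le_iff)
qed

text \<open>The product formula for the single zero \<open>s\<close>. Using
  \<open>2 \<le> q s\<close> on one side and the crude bound \<open>n < 2 ^ n\<close> for the
  product of all norms on the other replaces logarithms by the integer factor
  \<open>c\<close>.\<close>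

lemma ord_le_height:
  assumes x: "x \<in> R" "x \<noteq> 0" and s: "s \<in> S"
  shows "ord_at s x \<le> c * height x"
proof (cases "ord_at s x > 0")
  case True
  have ps: "is_prime_place s" using place_S[OF s] .
  have "(\<Prod>v\<in>{s}. q v ^ nat (ord_at v x)) \<le> (\<Prod>v\<in>S. q v ^ nat (- ord_at v x))"
    by (rule product_formula_le[OF x(2)]) (use True ps finite_S places_S x R_iff in auto)
  also have "\<dots> \<le> (\<Prod>v\<in>S. q v ^ nat (height x))"
  proof (intro prod_mono conjI)
    fix v assume v: "v \<in> S"
    have "- ord_at v x \<le> height x" using height_ge[OF v, of x] x by (simp add: ord_ge_def)
    then show "q v ^ nat (- ord_at v x) \<le> q v ^ nat (height x)"
      using q_ge_2[OF place_S[OF v]] by (intro power_increasing) auto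
  qed simp
  also have "\<dots> = (\<Prod>v\<in>S. q v) ^ nat (height x)" by (simp add: prod_power_distrib)
  also have "\<dots> \<le> (2 ^ (\<Prod>v\<in>S. q v)) ^ nat (height x)"
    by (intro power_mono less_imp_le[OF less_exp]) auto
  finally have "q s ^ nat (ord_at s x) \<le> 2 ^ ((\<Prod>v\<in>S. q v) * nat (height x))" by (simp add: power_mult)
  moreover have "2 ^ nat (ord_at s x) \<le> q s ^ nat (ord_at s x)" using q_ge_2[OF ps] by (intro power_mono) auto
  ultimately have "(2::nat) ^ nat (ord_at s x) \<le> 2 ^ ((\<Prod>v\<in>S. q v) * nat (height x))" by linarith
  then have "nat (ord_at s x) \<le> (\<Prod>v\<in>S. q v) * nat (height x)" by simp
  then have "int (nat (ord_at s x)) \<le> int ((\<Prod>v\<in>S. q v) * nat (height x))" by (simp only: of_nat_le_iff)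
  then show ?thesis using True height_nonneg[of x] unfolding c_def by simp
next
  case False
  then show ?thesis using c_ge_1 height_nonneg[of x] mult_nonneg_nonneg[of c "height x"] by linarith
qed

section \<open>Divisibility in the ring of S-integers, tested at many points\<close>

definition rdvd :: "'k \<Rightarrow> 'k \<Rightarrow> bool" where
  "rdvd x y \<longleftrightarrow> (\<exists>z\<in>R. y = x * z)"

lemma rdvd_trans: "rdvd x y \<Longrightarrow> rdvd y z \<Longrightarrow> rdvd x z"
  unfolding rdvd_def using RD(6) by (metis mult.assoc)

lemma rdvd_diff: "rdvd x y \<Longrightarrow> rdvd x z \<Longrightarrow> rdvd x (y - z)"
  unfolding rdvd_def using RD(4) by (metis right_diff_distrib)

lemma rdvd_add: "rdvd x y \<Longrightarrow> rdvd x z \<Longrightarrow> rdvd x (y + z)"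
  unfolding rdvd_def using RD(5) by (metis distrib_left)

lemma rdvd_mult: "rdvd x y \<Longrightarrow> z \<in> R \<Longrightarrow> rdvd x (y * z)"
  unfolding rdvd_def using RD(6) by (metis mult.assoc)

lemma rdvd_triv: "z \<in> R \<Longrightarrow> rdvd x (x * z)"
  unfolding rdvd_def by blast

lemma rdvd_mult_left: "rdvd (u * x) y \<Longrightarrow> u \<in> R \<Longrightarrow> rdvd x y"
  unfolding rdvd_def using RD(6) by (metis mult.assoc mult.commute)

lemma rdvd_0: "rdvd 0 x \<longleftrightarrow> x = 0"
  unfolding rdvd_def using RD(1) by auto

text \<open>
  Divisibility in \<open>R\<close> does not see the places in \<open>S\<close>. The remedy is to impose it on \<open>z - a i\<close> for many
  points \<open>a i\<close> at once: at each place of \<open>S\<close>, at most one of them is close to \<open>z\<close>.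
\<close>

definition a :: "nat \<Rightarrow> 'k" where "a i = t ^ i - 1"

lemma a_in_R: "a i \<in> R"
  unfolding a_def by (intro RD t_in_R)

lemma a_neq: "i \<noteq> j \<Longrightarrow> a i \<noteq> a j"
  unfolding a_def using t_power_neq by (metis diff_add_cancel linorder_neqE_nat)

lemma a_0 [simp]: "a 0 = 0" by (simp add: a_def)

text \<open>
  \<open>N\<close> is chosen to exceed the factors by which heights grow in \<open>square_rel_sound\<close> and
  \<open>square_sound\<close>; discarding the bad points leaves \<open>N\<close> of the \<open>L\<close> points.
\<close>

definition N :: int where
  "N = 3 * (1 + c)\<^sup>2 * c + (1 + c) * (c + 4) + 1"

definition L :: nat where "L = card S + nat N"

lemma N_ge: "N \<ge> 3" "N \<ge> 3 * (1 + c)\<^sup>2 * c + 1" "N \<ge> (1 + c) * (c + 4) + 1"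
proof -
  have 1: "3 * (1 + c)\<^sup>2 * c \<ge> 0" using c_ge_1 by simp
  have "(1 + c) * (c + 4) \<ge> 2 * 5" using c_ge_1 by (intro mult_mono) auto
  then show "N \<ge> 3" "N \<ge> 3 * (1 + c)\<^sup>2 * c + 1" "N \<ge> (1 + c) * (c + 4) + 1"
    unfolding N_def using 1 by linarith+
qed

lemma L_eq: "int L = int (card S) + N" unfolding L_def using N_ge(1) by simp

text \<open>A sum serves as a common bound for the heights of all points. Likewise
  \<open>\<gamma>\<close> bounds how close two of them come at a place of \<open>S\<close>.\<close>

definition \<alpha> :: int where "\<alpha> = (\<Sum>i<L. height (a i))"

definition \<gamma> :: int where "\<gamma> = (\<Sum>i<L. \<Sum>j<L. \<Sum>s\<in>S. \<bar>ord_at s (a i - a j)\<bar>)"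

lemma height_a: "i < L \<Longrightarrow> height (a i) \<le> \<alpha>"
  unfolding \<alpha>_def by (intro member_le_sum[of i "{..<L}" "\<lambda>i. height (a i)"]) (auto simp: height_nonneg)

lemma \<alpha>_nonneg: "\<alpha> \<ge> 0"
  unfolding \<alpha>_def by (intro sum_nonneg) (simp add: height_nonneg)

lemma \<gamma>_nonneg: "\<gamma> \<ge> 0"
  unfolding \<gamma>_def by (intro sum_nonneg) simp

lemma ord_a_diff:
  assumes "i < L" "j < L" "s \<in> S"
  shows "ord_at s (a i - a j) \<le> \<gamma>"
proof -
  have "\<bar>ord_at s (a i - a j)\<bar> \<le> (\<Sum>s\<in>S. \<bar>ord_at s (a i - a j)\<bar>)"
    using finite_S assms by (intro member_le_sum[of s S "\<lambda>s. \<bar>ord_at s (a i - a j)\<bar>"]) auto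
  also have "\<dots> \<le> \<gamma>" unfolding \<gamma>_def
    using assms by (intro member_le_double_sum[of "{..<L}" "{..<L}" i j "\<lambda>i j. \<Sum>s\<in>S. \<bar>ord_at s (a i - a j)\<bar>"])
      (auto intro: sum_nonneg)
  finally show ?thesis by linarith
qed

definition good :: "'k \<Rightarrow> nat \<Rightarrow> bool" where
  "good z i \<longleftrightarrow> (\<forall>s\<in>S. \<not> ord_ge s (\<gamma> + 1) (z - a i))"

text \<open>Two indices that are bad because of the same place would have points closer to each
  other there than \<open>\<gamma>\<close> allows, so bad indices inject into
  \<open>S\<close>.\<close>

lemma card_bad: "card {i. i < L \<and> \<not> good z i} \<le> card S"
proof -
  have "\<forall>i\<in>{i. i < L \<and> \<not> good z i}. \<exists>s. s \<in> S \<and> ord_ge s (\<gamma> + 1) (z - a i)"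
    unfolding good_def by blast
  from bchoice[OF this] obtain f where f: "\<forall>i\<in>{i. i < L \<and> \<not> good z i}. f i \<in> S \<and> ord_ge (f i) (\<gamma> + 1) (z - a i)" ..
  have "inj_on f {i. i < L \<and> \<not> good z i}"
  proof (rule inj_onI, rule ccontr)
    fix i j assume i: "i \<in> {i. i < L \<and> \<not> good z i}" and j: "j \<in> {i. i < L \<and> \<not> good z i}"
      and eq: "f i = f j" and "i \<noteq> j"
    have s: "f i \<in> S" "ord_ge (f i) (\<gamma> + 1) (z - a i)" using f i by blast+
    have "ord_ge (f i) (\<gamma> + 1) (z - a j)" unfolding eq using f j by blast
    then have "ord_ge (f i) (\<gamma> + 1) ((z - a j) - (z - a i))" by (rule ord_ge_diff[OF place_S[OF s(1)] _ s(2)])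
    then have "ord_ge (f i) (\<gamma> + 1) (a i - a j)" by simp
    then show False using ord_a_diff[OF _ _ s(1), of i j] i j a_neq[OF \<open>i \<noteq> j\<close>] by (simp add: ord_ge_def)
  qed
  then show ?thesis using f finite_S by (intro card_inj_on_le[of f]) auto
qed

text \<open>Two estimates for the cofactor \<open>w\<close>. For good points the factors have small
  orders on \<open>S\<close>, so the height of \<open>w\<close> exceeds that of \<open>D\<close> by
  a constant at most. Where \<open>z\<close> has its highest pole, all factors share it, because
  \<open>height z > \<alpha>\<close>; so \<open>w\<close> has a zero of order at least
  \<open>card I * height z - height D\<close>. Then \<open>ord_le_height\<close> applies to
  \<open>w\<close>.\<close>

lemma key_division:
  assumes "I \<subseteq> {..<L}" "\<forall>i\<in>I. good z i" "height z > \<alpha>" "D \<noteq> 0" "w \<in> R"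
    and D: "D = w * (\<Prod>i\<in>I. z - a i)"
  shows "int (card I) * height z \<le> (1 + c) * height D + c * \<gamma> * int (card I)"
proof -
  let ?n = "int (card I)"
  have fin: "finite I" using assms(1) finite_subset by blast
  have nz: "z - a i \<noteq> 0" if "i \<in> I" for i
    using assms(2) that infinite_place_exists unfolding good_def by fastforce
  have P0: "(\<Prod>i\<in>I. z - a i) \<noteq> 0" using fin nz by simp
  have w0: "w \<noteq> 0" using D assms(4) by auto
  have ordw: "ord_at s w = ord_at s D - (\<Sum>i\<in>I. ord_at s (z - a i))" if s: "s \<in> S" for s
    unfolding D using ord_at_mult[OF place_S[OF s] w0 P0] ord_at_prod[OF place_S[OF s], of I "\<lambda>i. z - a i"] nz by simp
  have ordD: "ord_at s D \<ge> - height D" if "s \<in> S" for s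
    using height_ge[OF that, of D] assms(4) by (simp add: ord_ge_def)
  have "height w \<le> height D + ?n * \<gamma>"
  proof (rule height_le)
    show "height D + ?n * \<gamma> \<ge> 0" using height_nonneg \<gamma>_nonneg by simp
    fix s assume s: "s \<in> S"
    have "ord_at s (z - a i) \<le> \<gamma>" if "i \<in> I" for i
      using assms(2) that s unfolding good_def ord_ge_def by force
    then have "(\<Sum>i\<in>I. ord_at s (z - a i)) \<le> ?n * \<gamma>" using sum_bounded_above[of I "\<lambda>i. ord_at s (z - a i)" \<gamma>] by simp
    then show "ord_ge s (- (height D + ?n * \<gamma>)) w" using ordw[OF s] ordD[OF s] by (simp add: ord_ge_def)
  qed
  then have cw: "c * height w \<le> c * (height D + ?n * \<gamma>)" using c_ge_1 by (intro mult_left_mono) auto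
  have "height z > 0" using assms(3) \<alpha>_nonneg by simp
  then obtain s where s: "s \<in> S" "z \<noteq> 0" "ord_at s z = - height z" using height_attained by blast
  have "ord_at s (z - a i) = - height z" if "i \<in> I" for i
  proof -
    have "ord_ge s (- \<alpha>) (- a i)"
      using ord_ge_mono[OF height_ge[OF s(1)]] height_a[of i] assms(1) that ord_ge_uminus[OF place_S[OF s(1)]] by auto
    then have "ord_ge s (ord_at s z + 1) (- a i)" by (rule ord_ge_mono) (use s(3) assms(3) in linarith)
    then show ?thesis using ord_at_add_eq(2)[OF place_S[OF s(1)] s(2)] s(3) by force
  qed
  then have "(\<Sum>i\<in>I. ord_at s (z - a i)) = - (?n * height z)" by simp
  then have "?n * height z \<le> ord_at s w + height D" using ordw[OF s(1)] ordD[OF s(1)] by simp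
  also have "ord_at s w \<le> c * height w" using ord_le_height[OF assms(5) w0 s(1)] .
  finally show ?thesis using cw by (simp add: algebra_simps)
qed

lemma prod_congruent:
  assumes "z \<in> R"
  shows "rdvd (z - a k) ((\<Prod>i\<in>I. z - a i) - (\<Prod>i\<in>I. a k - a i))"
proof (induction I rule: infinite_finite_induct)
  case (insert j I)
  let ?P = "\<Prod>i\<in>I. z - a i" and ?Q = "\<Prod>i\<in>I. a k - a i"
  have "(\<Prod>i\<in>insert j I. z - a i) - (\<Prod>i\<in>insert j I. a k - a i) = (?P - ?Q) * (z - a j) + (z - a k) * ?Q"
    using insert(1,2) by (simp add: algebra_simps)
  moreover have "rdvd (z - a k) ((?P - ?Q) * (z - a j))"
    using insert by (intro rdvd_mult RD assms a_in_R)
  moreover have "rdvd (z - a k) ((z - a k) * ?Q)"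
    by (intro rdvd_triv is_subring_prod[OF subring_R] RD a_in_R)
  ultimately show ?case using rdvd_add by metis
qed (simp_all add: rdvd_def RD(2) bexI[of _ 0])

text \<open>The \<open>z - a i\<close> need not be coprime, but modulo \<open>z - a k\<close> the
  product of the others is the constant \<open>\<Prod>i\<in>I. a k - a i\<close>. Multiplying
  \<open>D\<close> by these constants replaces coprimality, and the height of their product
  \<open>\<beta>\<close> does not depend on \<open>z\<close>.\<close>

lemma prod_divides:
  assumes "finite I" "I \<subseteq> {..<L}" "z \<in> R" "D \<in> R" "\<forall>i\<in>I. rdvd (z - a i) D"
  shows "\<exists>\<beta>\<in>R. \<beta> \<noteq> 0 \<and> height \<beta> \<le> int (card I) * (int L * \<alpha>) \<and> rdvd (\<Prod>i\<in>I. z - a i) (\<beta> * D)"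
  using assms(1,2,5)
proof (induction I rule: finite_induct)
  case empty
  have "rdvd 1 D" unfolding rdvd_def using assms(4) by auto
  then show ?case using RD(1) by (intro bexI[of _ 1]) auto
next
  case (insert k I)
  then obtain \<beta> where \<beta>: "\<beta> \<in> R" "\<beta> \<noteq> 0" "height \<beta> \<le> int (card I) * (int L * \<alpha>)" "rdvd (\<Prod>i\<in>I. z - a i) (\<beta> * D)"
    by auto
  let ?P = "\<Prod>i\<in>I. z - a i" and ?Q = "\<Prod>i\<in>I. a k - a i"
  have Q: "?Q \<in> R" by (intro is_subring_prod[OF subring_R] RD a_in_R)
  have "a k - a i \<noteq> 0" if "i \<in> I" for i using a_neq[of k i] insert(2) that by auto
  then have Q0: "?Q \<noteq> 0" using insert(1) by simp
  obtain e where e: "e \<in> R" "\<beta> * D = ?P * e" using \<beta>(4) unfolding rdvd_def by blast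
  have "rdvd (z - a k) (D * \<beta>)" using insert.prems(2) \<beta>(1) by (intro rdvd_mult) auto
  then have "rdvd (z - a k) (?P * e)" using e(2) by (simp add: mult.commute)
  moreover have "rdvd (z - a k) ((?P - ?Q) * e)" using prod_congruent[OF assms(3)] e(1) by (rule rdvd_mult)
  ultimately have "rdvd (z - a k) (?P * e - (?P - ?Q) * e)" by (rule rdvd_diff)
  then have "rdvd (z - a k) (?Q * e)" by (simp add: algebra_simps)
  then obtain g where g: "g \<in> R" "?Q * e = (z - a k) * g" unfolding rdvd_def by blast
  have "(?Q * \<beta>) * D = ?P * (?Q * e)" using e(2) by (simp add: mult_ac)
  also have "\<dots> = (\<Prod>i\<in>insert k I. z - a i) * g" using g(2) insert(1,2) by (simp add: mult_ac)
  finally have "rdvd (\<Prod>i\<in>insert k I. z - a i) ((?Q * \<beta>) * D)" unfolding rdvd_def using g(1) by blast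
  moreover have "height (?Q * \<beta>) \<le> int (card (insert k I)) * (int L * \<alpha>)"
  proof -
    have "height (a k - a i) \<le> \<alpha>" if "i \<in> I" for i
      using height_diff[of "a k" "a i"] height_a[of k] height_a[of i] insert.prems(1) that by fastforce
    then have "(\<Sum>i\<in>I. height (a k - a i)) \<le> int (card I) * \<alpha>"
      using sum_bounded_above[of I "\<lambda>i. height (a k - a i)" \<alpha>] by simp
    also have "\<dots> \<le> int L * \<alpha>"
      using insert.prems(1) card_mono[of "{..<L}" I] \<alpha>_nonneg by (intro mult_right_mono) auto
    finally have "height ?Q \<le> int L * \<alpha>" using height_prod[of "\<lambda>i. a k - a i" I] by simp
    then show ?thesis using height_mult[of ?Q \<beta>] \<beta>(3) insert(1,2) by (simp add: algebra_simps)
  qed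
  ultimately show ?case using Q Q0 \<beta>(1,2) RD(6) by (intro bexI[of _ "?Q * \<beta>"]) auto
qed

end

section \<open>Divisibility conditions that force an element to be a square\<close>

context s_integers
begin

text \<open>Used as a vanishing criterion: an element divisible by all \<open>z - a i\<close> is 0
  if its height is small compared with \<open>N * height z\<close>.\<close>

lemma many_divisors:
  assumes z: "z \<in> R" "height z > \<alpha>" and D: "D \<in> R" "D \<noteq> 0" "\<forall>i<L. rdvd (z - a i) D"
  shows "N * height z \<le> (1 + c) * (height D + int L * (int L * \<alpha>)) + c * \<gamma> * int L"
proof -
  define I where "I = {i. i < L \<and> good z i}"
  have I: "I \<subseteq> {..<L}" "finite I" "\<forall>i\<in>I. good z i" unfolding I_def by auto
  have card_I: "card I \<le> L" using card_mono[OF _ I(1)] by simp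
  have "{..<L} = I \<union> {i. i < L \<and> \<not> good z i}" unfolding I_def by auto
  then have "L \<le> card I + card {i. i < L \<and> \<not> good z i}" by (metis card_Un_le card_lessThan)
  then have N_I: "N \<le> int (card I)" using card_bad[of z] L_eq by linarith
  obtain \<beta> where \<beta>: "\<beta> \<in> R" "\<beta> \<noteq> 0" "height \<beta> \<le> int (card I) * (int L * \<alpha>)" "rdvd (\<Prod>i\<in>I. z - a i) (\<beta> * D)"
    using prod_divides[OF I(2,1) z(1) D(1)] D(3) I(1) by auto
  obtain w where w: "w \<in> R" "\<beta> * D = w * (\<Prod>i\<in>I. z - a i)"
    using \<beta>(4) unfolding rdvd_def by (metis mult.commute)
  have "N * height z \<le> int (card I) * height z" using N_I height_nonneg by (intro mult_right_mono) auto
  also have "\<dots> \<le> (1 + c) * height (\<beta> * D) + c * \<gamma> * int (card I)"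
    using \<beta>(2) D(2) by (intro key_division[OF I(1,3) z(2) _ w]) simp
  also have "\<dots> \<le> (1 + c) * (height D + int L * (int L * \<alpha>)) + c * \<gamma> * int L"
  proof (intro add_mono mult_left_mono)
    have "int (card I) * (int L * \<alpha>) \<le> int L * (int L * \<alpha>)"
      using card_I \<alpha>_nonneg by (intro mult_right_mono) auto
    then show "height (\<beta> * D) \<le> height D + int L * (int L * \<alpha>)"
      using height_mult[of \<beta> D] \<beta>(3) by linarith
  qed (use c_ge_1 \<gamma>_nonneg card_I in auto)
  finally show ?thesis .
qed

text \<open>A single good index suffices for a linear bound, so \<open>D\<close> may depend on
  \<open>i\<close>; more than \<open>card S\<close> indices guarantee a good one.\<close>

lemma some_divisor:
  assumes z: "z \<in> R" and I: "I \<subseteq> {..<L}" "card I > card S"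
    and D: "\<forall>i\<in>I. \<exists>D. D \<noteq> 0 \<and> height D \<le> h \<and> rdvd (z - a i) D"
  shows "height z \<le> (1 + c) * h + c * \<gamma> + \<alpha>"
proof -
  have "I \<noteq> {}" using I(2) by auto
  then have h: "h \<ge> 0" using D height_nonneg by (meson all_not_in_conv order_trans)
  have ch: "(1 + c) * h \<ge> 0" "c * \<gamma> \<ge> 0" using h c_ge_1 \<gamma>_nonneg by simp_all
  show ?thesis
  proof (cases "height z > \<alpha>")
    case True
    have "\<not> I \<subseteq> {i. i < L \<and> \<not> good z i}"
      using card_mono[of "{i. i < L \<and> \<not> good z i}" I] card_bad[of z] I(2) by auto
    then obtain i where i: "i \<in> I" "good z i" using I(1) by auto
    obtain D where D': "D \<noteq> 0" "height D \<le> h" "rdvd (z - a i) D" using D i(1) by blast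
    obtain w where w: "w \<in> R" "D = w * (\<Prod>i\<in>{i}. z - a i)"
      using D'(3) unfolding rdvd_def by (auto simp: mult.commute)
    have "int (card {i}) * height z \<le> (1 + c) * height D + c * \<gamma> * int (card {i})"
      using I(1) i by (intro key_division[OF _ _ True D'(1) w]) auto
    moreover have "(1 + c) * height D \<le> (1 + c) * h" using D'(2) c_ge_1 by (intro mult_left_mono) auto
    ultimately show ?thesis using \<alpha>_nonneg by simp
  next
    case False
    then show ?thesis using ch by linarith
  qed
qed

lemma card_S_less_L: "card {i. i < L \<and> i \<noteq> k} > card S" "card {..<L} > card S"
proof -
  have "card ({..<L} - {k}) \<ge> card {..<L} - 1" by (simp add: card_Diff_singleton_if)
  moreover have "{..<L} - {k} = {i. i < L \<and> i \<noteq> k}" by auto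
  ultimately show "card {i. i < L \<and> i \<noteq> k} > card S" "card {..<L} > card S"
    using L_eq N_ge(1) by simp_all
qed

definition square_rel :: "'k \<Rightarrow> 'k \<Rightarrow> bool" where
  "square_rel u y \<longleftrightarrow> (\<forall>i<L. rdvd (y - a i * u) (u - a i) \<and> rdvd (u - a i) (y - a i * u))"

lemma square_rel_square:
  assumes "u \<in> R" "inverse u \<in> R" "u \<noteq> 0"
  shows "square_rel u (u\<^sup>2)"
proof -
  have "u\<^sup>2 - a i * u = (u - a i) * u" "u - a i = (u\<^sup>2 - a i * u) * inverse u" for i
    using assms(3) by (simp_all add: power2_eq_square algebra_simps)
  then show ?thesis unfolding square_rel_def rdvd_def using assms by metis
qed

text \<open>Write \<open>y = u * z\<close>. One divisibility makes \<open>z - a i\<close> a divisor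
  of \<open>u - a i\<close>, so the height of \<open>z\<close> is at most
  \<open>(1 + c) * height u\<close> up to a constant. The other makes \<open>y - u\<^sup>2\<close>
  divisible by all \<open>u - a i\<close>. As its height is at most
  \<open>(c + 3) * height u\<close> up to a constant, it vanishes by the choice of
  \<open>N\<close>.\<close>

lemma square_rel_sound:
  "\<exists>H. \<forall>u\<in>R. \<forall>y\<in>R. inverse u \<in> R \<longrightarrow> height u > H \<longrightarrow> square_rel u y \<longrightarrow> y = u\<^sup>2"
proof -
  define K where "K = (1 + c) * \<alpha> + c * \<gamma> + \<alpha>"
  define H where "H = (1 + c) * (K + int L * (int L * \<alpha>)) + c * \<gamma> * int L"
  have "y = u\<^sup>2" if u: "u \<in> R" "inverse u \<in> R" and y: "y \<in> R" and big: "height u > max H \<alpha>" and rel: "square_rel u y" for u y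
  proof (rule ccontr)
    assume ne: "y \<noteq> u\<^sup>2"
    have u0: "u \<noteq> 0" using big \<alpha>_nonneg by auto
    define z where "z = y * inverse u"
    have z: "z \<in> R" unfolding z_def using RD(6) u y by blast
    have yz: "y = u * z" unfolding z_def using u0 by simp
    have una: "u - a i \<noteq> 0 \<and> height (u - a i) \<le> height u + \<alpha>" if "i < L" for i
      using height_a[OF that] big height_diff[of u "a i"] height_nonneg[of u] \<alpha>_nonneg by auto
    have "\<exists>D. D \<noteq> 0 \<and> height D \<le> height u + \<alpha> \<and> rdvd (z - a i) D" if i: "i < L" for i
    proof (intro exI[of _ "u - a i"] conjI)
      have "rdvd (u * (z - a i)) (u - a i)" using rel i unfolding square_rel_def yz by (simp add: algebra_simps)
      then show "rdvd (z - a i) (u - a i)" using u(1) by (rule rdvd_mult_left)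
    qed (use una[OF i] in auto)
    then have hz: "height z \<le> (1 + c) * (height u + \<alpha>) + c * \<gamma> + \<alpha>"
      using card_S_less_L(2) by (intro some_divisor[OF z, of "{..<L}"]) auto
    define D where "D = y - u\<^sup>2"
    have D: "D \<in> R" "D \<noteq> 0" unfolding D_def using ne u y RD(4,7) by auto
    have "height D \<le> max (height y) (height (u\<^sup>2))" unfolding D_def by (rule height_diff)
    moreover have "height y \<le> height u + height z" unfolding yz by (rule height_mult)
    moreover have "height (u\<^sup>2) = 2 * height u" using height_power[of u 2] by simp
    ultimately have "height D \<le> height z + 2 * height u"
      using height_nonneg[of u] height_nonneg[of z] by linarith
    then have hD: "height D \<le> (c + 3) * height u + K" using hz unfolding K_def by (simp add: algebra_simps)
    have "rdvd (u - a i) D" if i: "i < L" for i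
    proof -
      have "rdvd (u - a i) ((y - a i * u) - (u - a i) * u)"
        by (rule rdvd_diff[OF _ rdvd_triv[OF u(1)]]) (use rel i in \<open>simp add: square_rel_def\<close>)
      then show ?thesis unfolding D_def by (simp add: power2_eq_square algebra_simps)
    qed
    then have "N * height u \<le> (1 + c) * (height D + int L * (int L * \<alpha>)) + c * \<gamma> * int L"
      using big by (intro many_divisors[OF u(1) _ D]) auto
    also have "\<dots> \<le> (1 + c) * ((c + 3) * height u + K + int L * (int L * \<alpha>)) + c * \<gamma> * int L"
      using hD c_ge_1 \<gamma>_nonneg by (intro add_mono mult_left_mono) auto
    also have "\<dots> = (1 + c) * (c + 3) * height u + H" unfolding H_def by (simp add: algebra_simps)
    finally have "N * height u \<le> (1 + c) * (c + 3) * height u + H" .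
    moreover have "N * height u \<ge> ((1 + c) * (c + 3) + 1) * height u"
    proof (intro mult_right_mono)
      have "(1 + c) * (c + 4) = (1 + c) * (c + 3) + (1 + c)" by (simp add: algebra_simps)
      then show "(1 + c) * (c + 3) + 1 \<le> N" using N_ge(3) c_ge_1 by linarith
    qed (rule height_nonneg)
    ultimately have "height u \<le> H" by (simp add: algebra_simps)
    then show False using big by simp
  qed
  then show ?thesis by (intro exI[of _ "max H \<alpha>"]) blast
qed

text \<open>At a suitable zero of \<open>v\<close>, the order of \<open>x\<close> can be up to about
  \<open>(1 + c) * c\<^sup>2\<close> times that of \<open>v\<close>. Dividing by
  \<open>v ^ (2 ^ e)\<close> must still leave a pole there.\<close>

definition e :: nat where "e = nat ((1 + c) * c\<^sup>2 + 1)"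

lemma e_large: "(2::int) ^ e \<ge> (1 + c) * c\<^sup>2 + 1"
proof -
  have "(1 + c) * c\<^sup>2 + 1 = int e" unfolding e_def using c_ge_1 by simp
  also have "\<dots> \<le> 2 ^ e" by (rule less_imp_le) (rule of_nat_less_two_power)
  finally show ?thesis .
qed

text \<open>The index \<open>k\<close> is exempt because \<open>y\<close> may equal one test point,
  and 0 does not divide \<open>v - 1\<close>; the points being distinct, one exemption is enough.
  With \<open>u = v ^ (2 ^ e)\<close> and \<open>z = x / u\<close>, all \<open>z - a i\<close>
  divide \<open>y - x\<^sup>2\<close>. The height of this difference is at most a fixed multiple of
  the height of \<open>inverse v\<close>, up to a constant, while that of \<open>z\<close> is at
  least the height of \<open>inverse v\<close> up to a constant.\<close>

lemma square_sound:
  "\<exists>H. \<forall>k. \<forall>v\<in>R. \<forall>x\<in>R. \<forall>y\<in>R. inverse v \<in> R \<longrightarrow> height v > H \<longrightarrow>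
    (\<forall>i<L. rdvd (x - a i) (v - 1)) \<longrightarrow> (\<forall>i<L. i \<noteq> k \<longrightarrow> rdvd (y - a i) (v - 1)) \<longrightarrow>
    (\<forall>i<L. rdvd (x - a i * v ^ (2 ^ e)) (y - (a i)\<^sup>2 * (v ^ (2 ^ e))\<^sup>2)) \<longrightarrow> y = x\<^sup>2"
proof -
  define K where "K = c * \<gamma> + \<alpha>"
  define H where "H = N * (c * K) + (1 + c) * (3 * K + int L * (int L * \<alpha>)) + c * \<gamma> * int L"
  have K: "K \<ge> 0" unfolding K_def using c_ge_1 \<alpha>_nonneg \<gamma>_nonneg by simp
  have "y = x\<^sup>2" if v: "v \<in> R" "inverse v \<in> R" and x: "x \<in> R" and y: "y \<in> R"
    and big: "height v > c * (max 0 (max H (c * K + \<alpha>)))"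
    and xd: "\<And>i. i < L \<Longrightarrow> rdvd (x - a i) (v - 1)" and yd: "\<And>i. i < L \<Longrightarrow> i \<noteq> k \<Longrightarrow> rdvd (y - a i) (v - 1)"
    and main: "\<And>i. i < L \<Longrightarrow> rdvd (x - a i * v ^ (2 ^ e)) (y - (a i)\<^sup>2 * (v ^ (2 ^ e))\<^sup>2)" for v x y k
  proof (rule ccontr)
    assume ne: "y \<noteq> x\<^sup>2"
    have "c * (max 0 (max H (c * K + \<alpha>))) \<ge> 0" using c_ge_1 by simp
    then have hv: "height v > 0" using big by linarith
    then have v0: "v \<noteq> 0" "v \<noteq> 1" by auto
    have hv1: "height (v - 1) \<le> height v" using height_diff[of v 1] hv by simp
    have wit: "\<exists>D. D \<noteq> 0 \<and> height D \<le> height v \<and> rdvd b D" if "rdvd b (v - 1)" for b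
      using that hv1 v0 by (intro exI[of _ "v - 1"]) simp
    have "height x \<le> (1 + c) * height v + c * \<gamma> + \<alpha>"
      by (rule some_divisor[OF x subset_refl card_S_less_L(2)]) (use wit xd in simp)
    then have hx: "height x \<le> (1 + c) * height v + K" unfolding K_def by simp
    have sub: "{i. i < L \<and> i \<noteq> k} \<subseteq> {..<L}" by auto
    have "height y \<le> (1 + c) * height v + c * \<gamma> + \<alpha>"
      by (rule some_divisor[OF y sub card_S_less_L(1)]) (use wit yd in simp)
    then have hy: "height y \<le> (1 + c) * height v + K" unfolding K_def by simp
    define u where "u = v ^ (2 ^ e)"
    define z where "z = x * inverse u"
    have u: "u \<in> R" "inverse u \<in> R" "u \<noteq> 0"
      unfolding u_def using v v0 RD(7) by (auto simp flip: power_inverse)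
    have z: "z \<in> R" unfolding z_def using RD(6) u x by blast
    have xz: "x = u * z" unfolding z_def using u by simp
    have "L > 0" using L_eq N_ge(1) by simp
    \<comment> \<open>Because \<open>a 0 = 0\<close>, the condition at index 0 says that
      \<open>x\<close> itself divides \<open>v - 1\<close>.\<close>
    have x0: "x \<noteq> 0"
    proof
      assume "x = 0"
      then have "rdvd 0 (v - 1)" using xd[OF \<open>L > 0\<close>] by simp
      then show False using v0 by (simp add: rdvd_0)
    qed
    define D where "D = y - x\<^sup>2"
    have D: "D \<in> R" "D \<noteq> 0" unfolding D_def using ne x y RD(4,7) by auto
    have "height (x\<^sup>2) = 2 * height x" using height_power[of x 2] by simp
    then have "height D \<le> height y + 2 * height x"
      using height_diff[of y "x\<^sup>2"] height_nonneg[of x] height_nonneg[of y] unfolding D_def by linarith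
    then have hD: "height D \<le> 3 * (1 + c) * height v + 3 * K" using hx hy by (simp add: algebra_simps)
    have zD: "rdvd (z - a i) D" if i: "i < L" for i
    proof -
      have "rdvd (x - a i * u) ((y - (a i)\<^sup>2 * u\<^sup>2) - (x - a i * u) * (x + a i * u))"
        by (rule rdvd_diff[OF main[OF i, folded u_def] rdvd_triv]) (intro RD x u(1) a_in_R)
      moreover have "(y - (a i)\<^sup>2 * u\<^sup>2) - (x - a i * u) * (x + a i * u) = D"
        unfolding D_def by (simp add: power2_eq_square algebra_simps)
      moreover have "x - a i * u = u * (z - a i)" unfolding xz by (simp add: algebra_simps)
      ultimately have "rdvd (u * (z - a i)) D" by simp
      then show ?thesis using u(1) by (rule rdvd_mult_left)
    qed
    obtain s1 where s1: "s1 \<in> S" "ord_at s1 v = - height v" using height_attained[OF hv] by blast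
    \<comment> \<open>The highest pole of \<open>inverse v\<close> marks the place where division by
      \<open>u\<close> creates a pole of \<open>z\<close>. All estimates are therefore expressed by
      \<open>o'\<close>, and \<open>height v \<le> c * o'\<close> converts them.\<close>
    define o' where "o' = height (inverse v)"
    have "ord_at s1 (inverse v) \<le> c * o'" unfolding o'_def using v v0 s1 by (intro ord_le_height) auto
    then have co: "height v \<le> c * o'" using s1 v0 place_S by (simp add: ord_at_inverse)
    then have "o' > max 0 (max H (c * K + \<alpha>))" using big c_ge_1 by (metis less_le_trans mult_less_cancel_left_pos zero_less_one)
    then have o': "o' > 0" "o' > H" "o' > c * K + \<alpha>" by auto
    obtain s0 where s0: "s0 \<in> S" "ord_at s0 (inverse v) = - o'" using height_attained[of "inverse v"] o'(1) unfolding o'_def by blast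
    then have ov: "ord_at s0 v = o'" using v0 place_S by (simp add: ord_at_inverse)
    have ps0: "is_prime_place s0" using place_S s0 by blast
    have z0: "z \<noteq> 0" unfolding z_def using x0 u by simp
    have "ord_at s0 z = ord_at s0 x - 2 ^ e * o'"
      unfolding z_def using x0 u v0 ps0 ov by (simp add: ord_at_mult ord_at_inverse u_def ord_at_power)
    moreover have "- ord_at s0 z \<le> height z" using height_ge[OF s0(1), of z] z0 by (simp add: ord_ge_def)
    moreover have "ord_at s0 x \<le> c * height x" using ord_le_height[OF x x0 s0(1)] .
    moreover have "c * height x \<le> c * ((1 + c) * (c * o') + K)"
    proof (rule mult_left_mono)
      have "(1 + c) * height v \<le> (1 + c) * (c * o')" by (rule mult_left_mono[OF co]) (use c_ge_1 in simp)
      then show "height x \<le> (1 + c) * (c * o') + K" using hx by linarith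
    qed (use c_ge_1 in simp)
    moreover have "2 ^ e * o' \<ge> ((1 + c) * c\<^sup>2 + 1) * o'" using e_large o'(1) by (intro mult_right_mono) auto
    ultimately have hz: "height z \<ge> o' - c * K" by (simp add: algebra_simps power2_eq_square)
    then have "height z > \<alpha>" using o'(3) by linarith
    then have "N * height z \<le> (1 + c) * (height D + int L * (int L * \<alpha>)) + c * \<gamma> * int L"
      using many_divisors[OF z _ D] zD by blast
    also have "\<dots> \<le> (1 + c) * (3 * (1 + c) * (c * o') + 3 * K + int L * (int L * \<alpha>)) + c * \<gamma> * int L"
    proof -
      have "3 * (1 + c) * height v \<le> 3 * (1 + c) * (c * o')" using co c_ge_1 by (intro mult_left_mono) auto
      then have "height D \<le> 3 * (1 + c) * (c * o') + 3 * K" using hD by linarith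
      then show ?thesis using c_ge_1 \<gamma>_nonneg by (intro add_mono mult_left_mono) auto
    qed
    also have "\<dots> = 3 * (1 + c)\<^sup>2 * c * o' + (H - N * (c * K))"
      unfolding H_def by (simp add: algebra_simps power2_eq_square)
    finally have 1: "N * height z \<le> 3 * (1 + c)\<^sup>2 * c * o' + (H - N * (c * K))" .
    have "N * (o' - c * K) \<le> N * height z" using hz N_ge(1) by (intro mult_left_mono) auto
    then have "N * o' \<le> 3 * (1 + c)\<^sup>2 * c * o' + H" using 1 by (simp add: algebra_simps)
    moreover have "(3 * (1 + c)\<^sup>2 * c + 1) * o' \<le> N * o'" using N_ge(2) o'(1) by (intro mult_right_mono) auto
    ultimately have "o' \<le> H" by (simp add: algebra_simps)
    then show False using o'(2) by simp
  qed
  then show ?thesis by (intro exI[of _ "c * (max 0 (max H (c * K + \<alpha>)))"]) blast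
qed

end

section \<open>Squaring\<close>

context function_field
begin

lemma char_eq: "CHAR('k) = CARD('p)"
proof (rule CHAR_eqI)
  have *: "(of_nat n :: 'k) = \<phi> [:of_nat n:]" for n by (metis hom_of_nat of_nat_poly)
  show "of_nat CARD('p) = (0 :: 'k)" unfolding * by simp
  fix n assume "of_nat n = (0 :: 'k)"
  then have "(of_nat n :: 'p mod_ring) = 0" unfolding * by simp
  then show "CARD('p) dvd n" by (rule of_nat_0_mod_ring_dvd)
qed

lemma frobenius_minus_one: "(x - 1 :: 'k) ^ (CARD('p) ^ k) = x ^ (CARD('p) ^ k) - 1"
proof -
  have "((x - 1) + 1 :: 'k) ^ (CARD('p) ^ k) = (x - 1) ^ (CARD('p) ^ k) + 1 ^ (CARD('p) ^ k)"
    by (rule freshmans_dream') (simp_all add: char_eq prime_card)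
  then show ?thesis by simp
qed

lemma emb_eq_poly: "\<phi> f = poly (map_poly (\<lambda>c. \<phi> [:c:]) f) t"
proof (induction f)
  case (pCons c f)
  show ?case unfolding emb_pCons[of c f] using pCons by (simp add: map_poly_pCons)
qed simp

lemma emb_integral:
  assumes v: "is_prime_place v" "ord_ge v 0 t"
  shows "ord_ge v 0 (\<phi> f)"
proof (induction f)
  case (pCons c f)
  have "ord_ge v 0 (\<phi> [:c:])"
    using const_ord[OF v(1), of "\<phi> [:c:]"] by (cases "c = 0") (auto simp: const_field_def ord_ge_def)
  then show ?case unfolding emb_pCons[of c f] using ord_ge_add[OF v(1)] ord_ge_mult0(1)[OF v pCons.IH] by simp
qed simp

lemma ord_emb_neg:
  assumes s: "is_prime_place s" "ord_at s t < 0" and f: "f \<noteq> 0"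
  shows "ord_at s (\<phi> f) = int (degree f) * ord_at s t"
proof -
  let ?G = "map_poly (\<lambda>c. \<phi> [:c:]) f"
  have coeff: "coeff ?G i = \<phi> [:coeff f i:]" for i by (rule coeff_map_poly) simp
  have "?G \<noteq> 0" using f coeff by (metis coeff_0 emb_eq_0_iff leading_coeff_0_iff pCons_eq_0_iff)
  moreover have "degree ?G = degree f" by (rule map_poly_degree_eq) (use f in simp)
  moreover have "\<forall>i. coeff ?G i \<in> const_field" unfolding coeff const_field_def by blast
  ultimately show ?thesis using ord_poly_neg[OF s(1) t_nonzero s(2), of ?G] by (simp add: emb_eq_poly[of f])
qed

end

section \<open>Congruences for powers of a unit\<close>

context s_integers
begin

lemma rdvd_iff:
  assumes "x \<noteq> 0" "y \<noteq> 0"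
  shows "rdvd x y \<longleftrightarrow> (\<forall>u. is_prime_place u \<longrightarrow> u \<notin> S \<longrightarrow> ord_at u x \<le> ord_at u y)"
proof -
  have "rdvd x y \<longleftrightarrow> y / x \<in> R" unfolding rdvd_def using assms by (auto intro!: bexI[of _ "y / x"])
  then show ?thesis unfolding R_iff using assms by (auto simp: ord_ge_def ord_at_divide)
qed

lemma rdvd_power: "rdvd x y \<Longrightarrow> rdvd (x ^ n) (y ^ n)"
  unfolding rdvd_def using RD(7) by (metis power_mult_distrib)

lemma rdvd_power_minus_one: "z \<in> R \<Longrightarrow> rdvd (z - 1) (z ^ n - 1)"
proof (induction n)
  case (Suc n)
  have "z ^ Suc n - 1 = (z ^ n - 1) * z + (z - 1) * 1" by (simp add: algebra_simps)
  moreover have "rdvd (z - 1) ((z ^ n - 1) * z + (z - 1) * 1)"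
    by (intro rdvd_add rdvd_mult rdvd_triv Suc RD)
  ultimately show ?case by (simp only:)
qed (auto simp: rdvd_def RD(2) intro: bexI[of _ 0])

text \<open>The binomial expansion of \<open>(1 + (z - 1)) ^ m\<close> up to first order. For
  \<open>m\<close> congruent to 1 modulo the characteristic, it gives \<open>z ^ m\<close> congruent
  to \<open>z\<close> modulo \<open>(z - 1)\<^sup>2\<close>.\<close>

lemma rdvd_square_power:
  assumes "z \<in> R"
  shows "rdvd ((z - 1)\<^sup>2) (z ^ m - 1 - of_nat m * (z - 1))"
proof (induction m)
  case (Suc m)
  have n: "of_nat m \<in> R" for m by (induction m) (auto intro: RD)
  have "z ^ Suc m - 1 - of_nat (Suc m) * (z - 1) = (z ^ m - 1 - of_nat m * (z - 1)) * z + (z - 1)\<^sup>2 * of_nat m"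
    by (simp add: power2_eq_square algebra_simps)
  moreover have "rdvd ((z - 1)\<^sup>2) ((z ^ m - 1 - of_nat m * (z - 1)) * z + (z - 1)\<^sup>2 * of_nat m)"
    by (intro rdvd_add rdvd_mult rdvd_triv Suc assms n)
  ultimately show ?case by (simp only:)
qed (auto simp: rdvd_def RD(2) intro: bexI[of _ 0])

lemma range_emb_subring: "is_subring (range \<phi>)"
  unfolding is_subring_def
proof (intro conjI ballI)
  show "1 \<in> range \<phi>" using hom_one by (metis rangeI)
  fix x y assume "x \<in> range \<phi>" "y \<in> range \<phi>"
  then show "x - y \<in> range \<phi>" "x * y \<in> range \<phi>" by (auto simp flip: hom_minus hom_mult)
qed

lemma emb_in_R: "\<phi> f \<in> R"
  unfolding R_iff using emb_integral t_integral by blast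

lemma kill_places_poly:
  assumes "\<And>v. is_prime_place v \<Longrightarrow> v \<notin> P \<Longrightarrow> ord_ge v 0 t"
    and "finite U" "\<forall>u\<in>U. is_prime_place u"
  shows "\<exists>f. f \<noteq> 0 \<and> (\<forall>u\<in>U - P. ord_ge u (int n) (\<phi> f))"
proof -
  have P: "\<forall>v. is_prime_place v \<longrightarrow> v \<notin> P \<longrightarrow> ord_ge v 0 t" using assms(1) by blast
  obtain h where h: "h \<noteq> 0" "\<forall>A. is_subring A \<longrightarrow> t \<in> A \<longrightarrow> h \<in> A" "\<forall>u\<in>U - P. ord_ge u (int n) h"
    using kill_places[OF t_power_neq P assms(2,3), where n = n] by (elim exE conjE) (rule that)
  then have "h \<in> range \<phi>" using range_emb_subring by blast
  then obtain f where "h = \<phi> f" by blast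
  then show ?thesis using h by (intro exI[of _ f]) auto
qed

text \<open>Only zeros outside \<open>S\<close> matter for divisibility, and a polynomial in
  \<open>t\<close> can be made to vanish at them to any order. This turns \<open>r - 1\<close> into
  a divisor of something that the language can name.\<close>

lemma divides_polynomial:
  assumes x: "x \<in> R" "x \<noteq> 0"
  shows "\<exists>W. W \<noteq> 0 \<and> rdvd x (\<phi> W)"
proof -
  define U where "U = {u :: 'k \<Rightarrow> int extended. is_prime_place u \<and> ord_at u x > 0}"
  have U: "finite U" "\<forall>u\<in>U. is_prime_place u" unfolding U_def using finite_zeros[OF x(2)] by auto
  define n where "n = (\<Sum>u\<in>U. nat (ord_at u x))"
  obtain W where W: "W \<noteq> 0" "\<forall>u\<in>U - S. ord_ge u (int n) (\<phi> W)"
    using kill_places_poly[of S U n] t_integral U by blast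
  have "ord_at u x \<le> ord_at u (\<phi> W)" if u: "is_prime_place u" "u \<notin> S" for u
  proof (cases "u \<in> U")
    case True
    have "nat (ord_at u x) \<le> n" unfolding n_def using U True by (intro member_le_sum[of u U "\<lambda>u. nat (ord_at u x)"]) auto
    then show ?thesis using W u True unfolding ord_ge_def by force
  next
    case False
    then have "ord_at u x \<le> 0" using u unfolding U_def by simp
    moreover have "ord_at u (\<phi> W) \<ge> 0" using R_D[OF emb_in_R u, of W] W(1) by (simp add: ord_ge_def)
    ultimately show ?thesis by linarith
  qed
  then show ?thesis using W(1) x(2) by (intro exI[of _ W]) (simp add: rdvd_iff)
qed

text \<open>The finite places of \<open>S\<close> divide \<open>G\<close> and therefore not \<open>1 - G\<close>, whose zeros thus lie outside \<open>S\<close>.\<close>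

lemma nonunit_polynomial:
  assumes "W \<noteq> 0"
  shows "\<exists>G. G \<noteq> 0 \<and> W dvd G \<and> 1 - \<phi> G \<noteq> 0 \<and> (\<forall>s\<in>S. ord_at s (1 - \<phi> G) \<le> 0) \<and>
    (\<exists>s\<in>S. ord_at s (1 - \<phi> G) < 0) \<and> \<not> rdvd (1 - \<phi> G) 1"
proof -
  define I where "I = {u :: 'k \<Rightarrow> int extended. is_prime_place u \<and> ord_at u t < 0}"
  have notI: "ord_ge u 0 t" if "is_prime_place u" "u \<notin> I" for u
    using that unfolding I_def ord_ge_def by auto
  obtain F where F: "F \<noteq> 0" "\<forall>s\<in>S - I. ord_ge s (int 1) (\<phi> F)"
    using kill_places_poly[OF notI finite_S places_S, of I 1] by blast
  \<comment> \<open>The factor \<open>t\<close> makes the degree positive, so that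
    \<open>1 - \<phi> G\<close> has a pole at each pole of \<open>t\<close>; \<open>F\<close> makes
    it a unit at the other places of \<open>S\<close>.\<close>
  define G where "G = [:0, 1:] * W * F"
  have G0: "G \<noteq> 0" unfolding G_def using assms F by simp
  have deg: "degree G \<ge> 1" unfolding G_def using assms F by (simp add: degree_mult_eq)
  have fin: "1 - \<phi> G \<noteq> 0 \<and> ord_at s (1 - \<phi> G) = 0" if s: "s \<in> S" "s \<notin> I" for s
  proof -
    have ps: "is_prime_place s" using place_S s by blast
    have int: "ord_ge s 0 (\<phi> f)" for f by (rule emb_integral[OF ps notI[OF ps s(2)]])
    have "ord_ge s 1 (\<phi> ([:0, 1:] * W) * \<phi> F)" using F(2) s ord_ge_mult0(2)[OF ps _ int] by simp
    then have "ord_ge s 1 (- \<phi> G)" using ord_ge_uminus[OF ps] unfolding G_def by (simp only: hom_mult)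
    then show ?thesis using ord_at_add_eq[OF ps, of 1 "- \<phi> G"] ps by simp
  qed
  have inf: "1 - \<phi> G \<noteq> 0 \<and> ord_at s (1 - \<phi> G) < 0" if s: "s \<in> S" "s \<in> I" for s
  proof -
    have ps: "is_prime_place s" "ord_at s t < 0" using s unfolding I_def by auto
    have neg: "ord_at s (\<phi> G) < 0" unfolding ord_emb_neg[OF ps G0] using deg ps(2) by (simp add: mult_pos_neg)
    then have "ord_ge s (ord_at s (- \<phi> G) + 1) 1" using ps by (simp add: ord_ge_def)
    then have "- \<phi> G + 1 \<noteq> 0 \<and> ord_at s (- \<phi> G + 1) = ord_at s (- \<phi> G)"
      using ord_at_add_eq[OF ps(1), of "- \<phi> G" 1] G0 by simp
    then show ?thesis using neg ps(1) by simp
  qed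
  obtain s0 where s0: "s0 \<in> S" "s0 \<in> I" using infinite_place_exists places_S unfolding I_def by blast
  have nz: "1 - \<phi> G \<noteq> 0" and neg0: "ord_at s0 (1 - \<phi> G) < 0" using inf[OF s0] by auto
  have le: "ord_at s (1 - \<phi> G) \<le> 0" if "s \<in> S" for s using fin[OF that] inf[OF that] by (cases "s \<in> I") auto
  have ps0: "is_prime_place s0" using place_S s0 by blast
  obtain v where v: "is_prime_place v" "ord_at v (inverse (1 - \<phi> G)) < 0"
    using pole_exists[OF ps0, of "inverse (1 - \<phi> G)"] nz neg0 ps0 by (auto simp: ord_at_inverse)
  then have "ord_at v (1 - \<phi> G) > 0" using nz by (simp add: ord_at_inverse)
  moreover from this have "v \<notin> S" using le by force
  ultimately have "\<not> rdvd (1 - \<phi> G) 1" using rdvd_iff[OF nz, of 1] v(1) by force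
  moreover have "W dvd G" unfolding G_def by (intro dvd_mult2 dvd_triv_right)
  ultimately show ?thesis using G0 nz le s0(1) neg0 by blast
qed

text \<open>At each zero of \<open>x\<close> outside \<open>S\<close>, some power of
  \<open>r\<close> has residue 1. By Frobenius, the \<open>p\<close>-part of the common exponent
  \<open>l0\<close> does not affect where the difference from 1 vanishes, so it is removed; a new
  power \<open>p ^ k\<close> then raises the multiplicities to those of \<open>x\<close>. Having
  \<open>l\<close> prime to \<open>p\<close> makes \<open>l ^ (p - 1)\<close> congruent to 1 modulo
  \<open>p\<close>.\<close>

lemma unit_power_congruence:
  assumes r: "r \<in> R" "inverse r \<in> R" "r \<noteq> 0" and x: "x \<in> R" "x \<noteq> 0"
  shows "\<exists>l k. \<not> CARD('p) dvd l \<and> rdvd x (r ^ (CARD('p) ^ k * l) - 1)"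
proof -
  let ?p = "CARD('p)"
  have p: "prime ?p" by (rule prime_card)
  define U where "U = {u :: 'k \<Rightarrow> int extended. is_prime_place u \<and> ord_at u x > 0} - S"
  have U: "finite U" "\<And>u. u \<in> U \<Longrightarrow> is_prime_place u" "\<And>u. u \<in> U \<Longrightarrow> u \<notin> S"
    unfolding U_def using finite_zeros[OF x(2)] by auto
  have "\<forall>u\<in>U. \<exists>l. l > 0 \<and> ord_ge u 1 (r ^ l - 1)"
  proof
    fix u assume u: "u \<in> U"
    note pu = U(2)[OF u]
    have "ord_ge u 0 r" "ord_ge u 0 (inverse r)" using r R_D pu U(3)[OF u] by blast+
    then have ord0: "ord_at u r = 0" using r(3) pu by (simp add: ord_ge_def ord_at_inverse)
    obtain i j where ij: "i < j" "ord_ge u 1 (r ^ i - r ^ j)"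
      using residue_pigeonhole[OF pu \<open>ord_ge u 0 r\<close>] by blast
    have "r ^ j = r ^ i * r ^ (j - i)" using ij(1) by (simp flip: power_add)
    then have "r ^ i - r ^ j = r ^ i * (- (r ^ (j - i) - 1))" by (simp add: algebra_simps)
    then have "ord_ge u 1 (- (r ^ (j - i) - 1))"
      using ij(2) ord_ge_mult_iff[OF pu, of "r ^ i" 1 "- (r ^ (j - i) - 1)"] r(3) pu ord0 by (simp add: ord_at_power)
    then have "ord_ge u 1 (r ^ (j - i) - 1)" using ord_ge_uminus[OF pu, of 1 "- (r ^ (j - i) - 1)"] by simp
    then show "\<exists>l. l > 0 \<and> ord_ge u 1 (r ^ l - 1)" using ij(1) by (intro exI[of _ "j - i"]) simp
  qed
  from bchoice[OF this] obtain f where f: "\<And>u. u \<in> U \<Longrightarrow> f u > 0 \<and> ord_ge u 1 (r ^ f u - 1)" by blast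
  define l0 where "l0 = (\<Prod>u\<in>U. f u)"
  have l0: "l0 > 0" unfolding l0_def using f by (intro prod_pos) blast
  obtain m l where l: "l0 = ?p ^ m * l" "\<not> ?p dvd l"
    using prime_power_canonical[OF p l0] by (metis mult.commute)
  have pos: "ord_ge u 1 (r ^ l - 1)" if u: "u \<in> U" for u
  proof -
    note pu = U(2)[OF u]
    have "f u dvd l0" unfolding l0_def using U(1) u by (rule dvd_prodI)
    then obtain g where g: "l0 = f u * g" by blast
    have "rdvd (r ^ f u - 1) ((r ^ f u) ^ g - 1)" using r(1) by (intro rdvd_power_minus_one RD)
    then have "rdvd (r ^ f u - 1) (r ^ l0 - 1)" unfolding g by (simp add: power_mult)
    then obtain h where h: "h \<in> R" "r ^ l0 - 1 = (r ^ f u - 1) * h" unfolding rdvd_def by blast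
    have "ord_ge u 1 (r ^ l0 - 1)" unfolding h(2)
      using f[OF u] R_D[OF h(1) pu U(3)[OF u]] by (intro ord_ge_mult0(1)[OF pu]) auto
    moreover have "r ^ l0 - 1 = (r ^ l - 1) ^ (?p ^ m)"
      unfolding frobenius_minus_one l(1) by (simp add: power_mult[symmetric] mult.commute)
    ultimately have *: "ord_ge u 1 ((r ^ l - 1) ^ (?p ^ m))" by simp
    show ?thesis
    proof (cases "r ^ l - 1 = 0")
      case False
      then have "int (?p ^ m) * ord_at u (r ^ l - 1) \<ge> 1" using * pu by (simp add: ord_ge_def ord_at_power)
      moreover have "int (?p ^ m) * ord_at u (r ^ l - 1) \<le> 0" if "ord_at u (r ^ l - 1) \<le> 0"
        using that by (intro mult_nonneg_nonpos) auto
      ultimately have "ord_at u (r ^ l - 1) > 0" by linarith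
      then show ?thesis by (simp add: ord_ge_def)
    qed simp
  qed
  define k where "k = (\<Sum>u\<in>U. nat (ord_at u x))"
  let ?y = "r ^ l - 1"
  have eq: "r ^ (?p ^ k * l) - 1 = ?y ^ (?p ^ k)"
    unfolding frobenius_minus_one by (simp add: power_mult[symmetric] mult.commute)
  have "rdvd x (?y ^ (?p ^ k))"
  proof (cases "?y = 0")
    case True
    then show ?thesis unfolding rdvd_def using RD(2) p by (intro bexI[of _ 0]) (auto simp: prime_gt_0_nat zero_power)
  next
    case False
    have "ord_at u x \<le> ord_at u (?y ^ (?p ^ k))" if u: "is_prime_place u" "u \<notin> S" for u
    proof (cases "u \<in> U")
      case True
      have "nat (ord_at u x) \<le> k" unfolding k_def using U True by (intro member_le_sum[of u U "\<lambda>u. nat (ord_at u x)"]) auto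
      then have "ord_at u x \<le> int k" by simp
      also have "\<dots> \<le> int (2 ^ k)" by (simp add: less_imp_le)
      also have "\<dots> \<le> int (?p ^ k)" using prime_ge_2_nat[OF p] by (intro of_nat_mono power_mono) auto
      also have "\<dots> \<le> int (?p ^ k) * ord_at u ?y"
        using pos[OF True] False mult_left_mono[of 1 "ord_at u ?y" "int (?p ^ k)"] by (simp add: ord_ge_def)
      finally show ?thesis using False u by (simp add: ord_at_power)
    next
      case False
      then have "ord_at u x \<le> 0" using u unfolding U_def by simp
      moreover have "?y ^ (?p ^ k) \<in> R" using r(1) by (intro RD)
      then have "ord_ge u 0 (?y ^ (?p ^ k))" using u by (rule R_D)
      then have "ord_at u (?y ^ (?p ^ k)) \<ge> 0" using \<open>?y \<noteq> 0\<close> unfolding ord_ge_def by simp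
      ultimately show ?thesis by linarith
    qed
    then show ?thesis using False x(2) by (subst rdvd_iff) auto
  qed
  then show ?thesis using l(2) unfolding eq[symmetric] by blast
qed

text \<open>A positive way to demand large height. As \<open>b\<close> has no zeros on
  \<open>S\<close>, the cofactor \<open>w\<close> has height at most \<open>height v\<close>; the
  pole of \<open>b ^ M\<close> at \<open>s0\<close> gives it a zero of order at least
  \<open>M - height v\<close>. By \<open>ord_le_height\<close> the latter is at most
  \<open>c * height v\<close>.\<close>

lemma big_height:
  assumes b: "b \<noteq> 0" "\<And>s. s \<in> S \<Longrightarrow> ord_at s b \<le> 0" and s0: "s0 \<in> S" "ord_at s0 b < 0"
    and M: "int M > (1 + c) * H" and v: "v \<in> R" "v \<noteq> 1" "rdvd (b ^ M) (v - 1)"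
  shows "height v > H"
proof -
  obtain w where w: "w \<in> R" "v - 1 = b ^ M * w" using v(3) unfolding rdvd_def by blast
  have w0: "w \<noteq> 0" using w(2) v(2) by auto
  have hv: "height (v - 1) \<le> height v" using height_diff[of v 1] height_nonneg[of v] by simp
  have ordw: "ord_at s w \<ge> - height v - int M * ord_at s b" if s: "s \<in> S" for s
  proof -
    have "ord_at s (v - 1) = int M * ord_at s b + ord_at s w"
      unfolding w(2) using place_S[OF s] b w0 by (simp add: ord_at_mult ord_at_power)
    moreover have "ord_at s (v - 1) \<ge> - height (v - 1)" using height_ge[OF s, of "v - 1"] v(2) by (simp add: ord_ge_def)
    ultimately show ?thesis using hv by linarith
  qed
  have "height w \<le> height v"
  proof (rule height_le)
    fix s assume s: "s \<in> S"
    have "int M * ord_at s b \<le> 0" using b(2)[OF s] by (simp add: mult_nonneg_nonpos)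
    then show "ord_ge s (- height v) w" using ordw[OF s] by (simp add: ord_ge_def)
  qed (rule height_nonneg)
  then have "c * height w \<le> c * height v" using c_ge_1 by (intro mult_left_mono) auto
  moreover have "ord_at s0 w \<le> c * height w" using ord_le_height[OF w(1) w0 s0(1)] .
  moreover have "int M * ord_at s0 b \<le> int M * (-1)" using s0(2) by (intro mult_left_mono) auto
  ultimately have "int M \<le> (1 + c) * height v" using ordw[OF s0(1)] by (simp add: algebra_simps)
  then have "(1 + c) * H < (1 + c) * height v" using M by linarith
  then show ?thesis using c_ge_1 by (simp add: mult_less_cancel_left)
qed

lemma of_nat_power_p_minus_1:
  assumes "\<not> CARD('p) dvd l"
  shows "(of_nat (l ^ (CARD('p) - 1)) :: 'k) = 1"
proof -
  have "[l ^ (CARD('p) - 1) = 1] (mod CARD('p))" using prime_card assms by (rule fermat_theorem)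
  then have "(of_nat (l ^ (CARD('p) - 1)) :: 'k) = of_nat 1"
    by (subst of_nat_eq_iff_cong_CHAR) (simp add: char_eq)
  then show ?thesis by simp
qed

text \<open>
  For a unit \<open>r\<close>, the intended values are \<open>u = r ^ p ^ k\<close> and \<open>v 0 = u ^ m\<close> with \<open>m \<equiv> 1\<close> modulo \<open>p\<close>. The element
  \<open>w\<close> is divisible by \<open>u - 1\<close> but coprime to the non-unit \<open>Q\<close>, which certifies \<open>u \<noteq> 1\<close>; then \<open>v 0 \<noteq> 1\<close> follows from
  \<open>v 0 \<equiv> u\<close> modulo \<open>(u - 1)\<^sup>2\<close>. Divisibility of \<open>u - 1\<close> by \<open>b ^ M\<close> makes the heights large enough for
  \<open>square_rel\<close> to mean squaring, so that \<open>v i = v 0 ^ 2 ^ i\<close>.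
\<close>

definition witness :: "'k \<Rightarrow> 'k \<Rightarrow> nat \<Rightarrow> 'k \<Rightarrow> 'k \<Rightarrow> 'k \<Rightarrow> 'k \<Rightarrow> 'k \<Rightarrow> (nat \<Rightarrow> 'k) \<Rightarrow> bool" where
  "witness b Q M x y u u2 w v \<longleftrightarrow>
     rdvd u 1 \<and> rdvd (b ^ M) (u - 1) \<and> rdvd (u - 1) w \<and> rdvd Q (w - 1) \<and> square_rel u u2 \<and>
     rdvd (v 0) 1 \<and> rdvd (u2 - 2 * u + 1) (v 0 - u) \<and> (\<forall>i\<le>e. square_rel (v i) (v (Suc i))) \<and>
     (\<forall>i<L. rdvd (x - a i) (v 0 - 1)) \<and> (\<exists>k<L. \<forall>i<L. i \<noteq> k \<longrightarrow> rdvd (y - a i) (v 0 - 1)) \<and>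
     (\<forall>i<L. rdvd (x - a i * v e) (y - (a i)\<^sup>2 * v (Suc e)))"

lemma rdvd_1_iff: "rdvd u 1 \<longleftrightarrow> u \<noteq> 0 \<and> inverse u \<in> R"
  unfolding rdvd_def by (metis inverse_unique mult_zero_left right_inverse zero_neq_one)

text \<open>\<open>M\<close> is obtained before \<open>Q\<close> on purpose. The unit
  \<open>r\<close> is later chosen with \<open>b ^ M\<close> dividing \<open>r - 1\<close>, and
  \<open>Q\<close> depends on \<open>r\<close>.\<close>

lemma witness_sound:
  assumes b: "b \<in> R" "b \<noteq> 0" "\<And>s. s \<in> S \<Longrightarrow> ord_at s b \<le> 0" "\<not> rdvd b 1"
    and s0: "s0 \<in> S" "ord_at s0 b < 0"
  shows "\<exists>M. \<forall>Q. \<not> rdvd Q 1 \<longrightarrow> (\<forall>x\<in>R. \<forall>y\<in>R. \<forall>u\<in>R. \<forall>u2\<in>R. \<forall>w\<in>R. \<forall>v. (\<forall>i. v i \<in> R) \<longrightarrow> witness b Q M x y u u2 w v \<longrightarrow> y = x\<^sup>2)"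
proof -
  from square_rel_sound obtain H1 where
    H1: "\<forall>u\<in>R. \<forall>y\<in>R. inverse u \<in> R \<longrightarrow> height u > H1 \<longrightarrow> square_rel u y \<longrightarrow> y = u\<^sup>2" by (rule exE)
  from square_sound obtain H2 where
    H2: "\<forall>k. \<forall>v\<in>R. \<forall>x\<in>R. \<forall>y\<in>R. inverse v \<in> R \<longrightarrow> height v > H2 \<longrightarrow>
    (\<forall>i<L. rdvd (x - a i) (v - 1)) \<longrightarrow> (\<forall>i<L. i \<noteq> k \<longrightarrow> rdvd (y - a i) (v - 1)) \<longrightarrow>
    (\<forall>i<L. rdvd (x - a i * v ^ (2 ^ e)) (y - (a i)\<^sup>2 * (v ^ (2 ^ e))\<^sup>2)) \<longrightarrow> y = x\<^sup>2" by (rule exE)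
  define H where "H = max 0 (max H1 H2)"
  define M where "M = Suc (nat ((1 + c) * H))"
  have M: "int M > (1 + c) * H" unfolding M_def using c_ge_1 by (simp add: H_def)
  have big: "height v > H" if "v \<in> R" "v \<noteq> 1" "rdvd (b ^ M) (v - 1)" for v
    using big_height[OF b(2,3) s0 M that] by simp
  have "y = x\<^sup>2" if xy: "x \<in> R" "y \<in> R" and R: "u \<in> R" "u2 \<in> R" "w \<in> R" "\<forall>i. v i \<in> R"
    and Q: "\<not> rdvd Q 1" and wit: "witness b Q M x y u u2 w v" for x y u u2 w v Q
  proof -
    have W: "rdvd u 1" "rdvd (b ^ M) (u - 1)" "rdvd (u - 1) w" "rdvd Q (w - 1)" "square_rel u u2"
      "rdvd (v 0) 1" "rdvd (u2 - 2 * u + 1) (v 0 - u)" "\<forall>i\<le>e. square_rel (v i) (v (Suc i))"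
      "\<forall>i<L. rdvd (x - a i) (v 0 - 1)" "\<exists>k<L. \<forall>i<L. i \<noteq> k \<longrightarrow> rdvd (y - a i) (v 0 - 1)"
      "\<forall>i<L. rdvd (x - a i * v e) (y - (a i)\<^sup>2 * v (Suc e))"
      using wit unfolding witness_def by simp_all
    have u: "inverse u \<in> R" using W(1) rdvd_1_iff by blast
    have "u \<noteq> 1"
    proof
      assume "u = 1"
      then have "w = 0" using W(3) rdvd_0 by simp
      then obtain z where z: "z \<in> R" "- 1 = Q * z" using W(4) unfolding rdvd_def by auto
      then have "1 = Q * (- z)" by (metis minus_minus mult_minus_right)
      then have "rdvd Q 1" unfolding rdvd_def using RD(3)[OF z(1)] by blast
      then show False using Q by simp
    qed
    then have "height u > H" using big R(1) W(2) by blast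
    then have u2: "u2 = u\<^sup>2" using H1 R(1,2) u W(5) unfolding H_def by auto
    then have sq: "u2 - 2 * u + 1 = (u - 1) * (u - 1)" by (simp add: power2_eq_square algebra_simps)
    then obtain z where z: "z \<in> R" "v 0 - u = (u - 1) * (u - 1) * z" using W(7) unfolding rdvd_def by auto
    have bu: "rdvd b (u - 1)"
    proof (rule rdvd_trans)
      show "rdvd b (b ^ M)" unfolding M_def power_Suc by (intro rdvd_triv RD b(1))
    qed (rule W(2))
    \<comment> \<open>The second factor could vanish only if \<open>u - 1\<close> were a unit, but
      the nonunit \<open>b\<close> divides \<open>u - 1\<close>.\<close>
    have v1: "v 0 - 1 = (u - 1) * (1 + (u - 1) * z)" using z(2) by (simp add: algebra_simps)
    have "v 0 \<noteq> 1"
    proof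
      assume "v 0 = 1"
      then have "1 + (u - 1) * z = 0" using v1 \<open>u \<noteq> 1\<close> by simp
      then have "1 = (u - 1) * (- z)" by (simp add: eq_neg_iff_add_eq_0)
      then have "rdvd (u - 1) 1" unfolding rdvd_def using RD(3)[OF z(1)] by blast
      then show False using bu rdvd_trans b(4) by blast
    qed
    moreover have "rdvd (b ^ M) (v 0 - 1)"
      unfolding v1 by (intro rdvd_mult RD R(1) z(1) W(2))
    ultimately have hv: "height (v 0) > H" using big R(4) by blast
    have v0: "v 0 \<noteq> 0" "inverse (v 0) \<in> R" using W(6) rdvd_1_iff by blast+
    have pow: "v i = v 0 ^ (2 ^ i)" if "i \<le> Suc e" for i
      using that
    proof (induction i)
      case (Suc i)
      then have IH: "v i = v 0 ^ (2 ^ i)" by simp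
      have "inverse (v i) \<in> R" unfolding IH power_inverse[symmetric] using v0(2) by (rule RD(7))
      moreover have "height (v i) > H1"
      proof -
        have "height (v 0) \<le> int (2 ^ i) * height (v 0)"
          using height_nonneg[of "v 0"] mult_right_mono[of 1 "int (2 ^ i)" "height (v 0)"] by simp
        then show ?thesis unfolding IH height_power using hv unfolding H_def by linarith
      qed
      moreover have "square_rel (v i) (v (Suc i))" using W(8) Suc.prems by simp
      ultimately have "v (Suc i) = (v i)\<^sup>2" using H1 R(4) by blast
      then show ?case unfolding IH by (simp add: power_mult[symmetric] mult.commute)
    qed simp
    have ve: "v e = v 0 ^ (2 ^ e)" "v (Suc e) = (v 0 ^ (2 ^ e))\<^sup>2"
      using pow[of e] pow[of "Suc e"] by (simp_all add: power_mult[symmetric] mult.commute)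
    obtain k where k: "\<forall>i<L. i \<noteq> k \<longrightarrow> rdvd (y - a i) (v 0 - 1)" using W(10) by blast
    have "height (v 0) > H2" using hv unfolding H_def by simp
    moreover have "\<forall>i<L. rdvd (x - a i) (v 0 - 1)"
      "\<forall>i<L. rdvd (x - a i * v 0 ^ (2 ^ e)) (y - (a i)\<^sup>2 * (v 0 ^ (2 ^ e))\<^sup>2)"
      using W(9,11) unfolding ve by blast+
    ultimately show ?thesis using H2[rule_format, OF R(4)[rule_format] xy v0(2), of k] k by blast
  qed
  then show ?thesis by (intro exI[of _ M]) blast
qed

text \<open>The parameters \<open>r\<close> and \<open>G\<close> serve all \<open>x\<close>:
  \<open>u - 1\<close> is \<open>(r - 1) ^ p ^ m\<close> and divides \<open>G ^ p ^ m\<close>, which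
  remains congruent to 1 modulo \<open>1 - G\<close>. The exponent \<open>j = l ^ (p - 1)\<close> is
  a multiple of \<open>l\<close>, so \<open>n\<close> divides \<open>v 0 - 1\<close>, and is 1
  modulo \<open>p\<close>, so \<open>v 0\<close> is congruent to \<open>u\<close> modulo
  \<open>(u - 1)\<^sup>2\<close>.\<close>

lemma witness_complete:
  assumes b: "b \<in> R" "b \<noteq> 0" and r: "r \<in> R" "inverse r \<in> R" "r \<noteq> 0"
    and br: "rdvd (b ^ M) (r - 1)" and rG: "rdvd (r - 1) G" "G \<in> R"
    and x: "x \<in> R" "\<And>i. i < L \<Longrightarrow> x \<noteq> a i"
  shows "\<exists>u\<in>R. \<exists>u2\<in>R. \<exists>w\<in>R. \<exists>v. (\<forall>i. v i \<in> R) \<and> witness b (1 - G) M x (x\<^sup>2) u u2 w v"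
proof -
  let ?p = "CARD('p)"
  have L0: "L > 0" using L_eq N_ge(1) by simp
  \<comment> \<open>The points are distinct, so \<open>x\<^sup>2\<close> equals at most one of them.
    If it equals none, index 0 is exempted.\<close>
  obtain k where k: "k < L" "\<And>i. i < L \<Longrightarrow> i \<noteq> k \<Longrightarrow> x\<^sup>2 \<noteq> a i"
  proof (cases "\<exists>k<L. x\<^sup>2 = a k")
    case True
    then show ?thesis using that a_neq by metis
  next
    case False
    then show ?thesis using that[OF L0] by blast
  qed
  have y: "x\<^sup>2 \<in> R" using x(1) by (rule RD(7))
  \<comment> \<open>The product of everything that has to divide \<open>v 0 - 1\<close>, nonzero by
    the choice of \<open>k\<close> and the assumption on \<open>x\<close>.\<close>
  define n where "n = (\<Prod>i<L. x - a i) * (\<Prod>i\<in>{..<L} - {k}. x\<^sup>2 - a i)"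
  have n: "n \<in> R" "n \<noteq> 0"
    unfolding n_def using x(2) k by (auto intro!: RD(6,4) is_subring_prod[OF subring_R] x(1) y a_in_R)
  obtain l m where lm: "\<not> ?p dvd l" "rdvd n (r ^ (?p ^ m * l) - 1)"
    using unit_power_congruence[OF r n] by blast
  define u where "u = r ^ (?p ^ m)"
  define j where "j = l ^ (?p - 1)"
  define v where "v i = (u ^ j) ^ (2 ^ i)" for i :: nat
  have u: "u \<in> R" "inverse u \<in> R" "u \<noteq> 0"
    unfolding u_def using r RD(7) by (auto simp flip: power_inverse)
  have v: "v i \<in> R" "inverse (v i) \<in> R" "v i \<noteq> 0" for i
    unfolding v_def using u RD(7) by (auto simp flip: power_inverse)
  have v_Suc: "v (Suc i) = (v i)\<^sup>2" for i
    unfolding v_def by (simp add: power_mult[symmetric] mult_ac)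
  have ur: "rdvd (r - 1) (u - 1)" unfolding u_def by (rule rdvd_power_minus_one[OF r(1)])
  have nv: "rdvd n (v 0 - 1)"
  proof (rule rdvd_trans)
    show "rdvd n (u ^ l - 1)" using lm(2) unfolding u_def by (simp add: power_mult)
    have "?p - 1 = Suc (?p - 2)" using prime_ge_2_nat[OF prime_card[where 'a = 'p]] by linarith
    then have "j = l * l ^ (?p - 2)" unfolding j_def by (simp only: power_Suc)
    then have "v 0 = (u ^ l) ^ (l ^ (?p - 2))" unfolding v_def by (simp add: power_mult)
    then show "rdvd (u ^ l - 1) (v 0 - 1)" using rdvd_power_minus_one[OF RD(7)[OF u(1)]] by simp
  qed
  have "witness b (1 - G) M x (x\<^sup>2) u (u\<^sup>2) (G ^ (?p ^ m)) v"
    unfolding witness_def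
  proof (intro conjI allI impI)
    show "rdvd u 1" "rdvd (v 0) 1" using u v rdvd_1_iff by blast+
    show "rdvd (b ^ M) (u - 1)" using br ur rdvd_trans by blast
    have "u - 1 = (r - 1) ^ (?p ^ m)" unfolding u_def frobenius_minus_one ..
    then show "rdvd (u - 1) (G ^ (?p ^ m))" using rdvd_power[OF rG(1)] by simp
    obtain z where z: "z \<in> R" "G ^ (?p ^ m) - 1 = (G - 1) * z"
      using rdvd_power_minus_one[OF rG(2), of "?p ^ m"] unfolding rdvd_def by blast
    have "G ^ (?p ^ m) - 1 = (1 - G) * (- z)" unfolding z(2) by (simp add: algebra_simps)
    then show "rdvd (1 - G) (G ^ (?p ^ m) - 1)" unfolding rdvd_def using RD(3)[OF z(1)] by blast
    show "square_rel u (u\<^sup>2)" using square_rel_square u by blast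
    have "rdvd ((u - 1)\<^sup>2) (u ^ j - 1 - of_nat j * (u - 1))" by (rule rdvd_square_power[OF u(1)])
    then have "rdvd ((u - 1)\<^sup>2) (v 0 - u)" using of_nat_power_p_minus_1[OF lm(1)] by (simp add: j_def v_def)
    moreover have "(u - 1)\<^sup>2 = u\<^sup>2 - 2 * u + 1" by (simp add: power2_eq_square algebra_simps)
    ultimately show "rdvd (u\<^sup>2 - 2 * u + 1) (v 0 - u)" by (simp only:)
  next
    fix i
    show "square_rel (v i) (v (Suc i))" unfolding v_Suc by (rule square_rel_square[OF v])
  next
    fix i assume i: "i < L"
    have "n = (x - a i) * ((\<Prod>i\<in>{..<L} - {i}. x - a i) * (\<Prod>i\<in>{..<L} - {k}. x\<^sup>2 - a i))"
      unfolding n_def using i by (subst prod.remove[of "{..<L}" i]) (auto simp: mult_ac)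
    then have "rdvd (x - a i) n" unfolding rdvd_def
      by (rule bexI) (intro RD(6,4) is_subring_prod[OF subring_R] x(1) y a_in_R)
    then show "rdvd (x - a i) (v 0 - 1)" using nv rdvd_trans by blast
  next
    show "\<exists>k<L. \<forall>i<L. i \<noteq> k \<longrightarrow> rdvd (x\<^sup>2 - a i) (v 0 - 1)"
    proof (intro exI[of _ k] conjI allI impI)
      fix i assume i: "i < L" "i \<noteq> k"
      have "n = (x\<^sup>2 - a i) * ((\<Prod>i<L. x - a i) * (\<Prod>i\<in>{..<L} - {k} - {i}. x\<^sup>2 - a i))"
        unfolding n_def using i by (subst prod.remove[of "{..<L} - {k}" i]) (auto simp: mult_ac)
      then have "rdvd (x\<^sup>2 - a i) n" unfolding rdvd_def
        by (rule bexI) (intro RD(6,4) is_subring_prod[OF subring_R] x(1) y a_in_R)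
      then show "rdvd (x\<^sup>2 - a i) (v 0 - 1)" using nv rdvd_trans by blast
    qed (rule k(1))
  next
    fix i
    have "x\<^sup>2 - (a i)\<^sup>2 * v (Suc e) = (x - a i * v e) * (x + a i * v e)"
      unfolding v_Suc by (simp add: power2_eq_square algebra_simps)
    moreover have "x + a i * v e \<in> R" by (intro RD(5,6) x(1) a_in_R v)
    ultimately show "rdvd (x - a i * v e) (x\<^sup>2 - (a i)\<^sup>2 * v (Suc e))" unfolding rdvd_def by blast
  qed
  moreover have "u\<^sup>2 \<in> R" "G ^ (?p ^ m) \<in> R" using u rG RD(7) by blast+
  ultimately show ?thesis using u(1) v(1) by blast
qed

text \<open>The first disjunct lists the finitely many \<open>x\<close> for which some
  \<open>x - a i\<close> is 0 and so divides no \<open>v 0 - 1\<close> other than 0. The parameters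
  must be images of polynomials, since they occur in the formula as closed terms.\<close>

theorem squaring_characterization:
  "\<exists>f g M. \<forall>x\<in>R. \<forall>y\<in>R. y = x\<^sup>2 \<longleftrightarrow> (\<exists>i<L. x = a i \<and> y = (a i)\<^sup>2) \<or>
    (\<exists>u\<in>R. \<exists>u2\<in>R. \<exists>w\<in>R. \<exists>v. (\<forall>i. v i \<in> R) \<and> witness (\<phi> f) (\<phi> g) M x y u u2 w v)"
proof -
  obtain G1 where G1: "1 - \<phi> G1 \<noteq> 0" "\<forall>s\<in>S. ord_at s (1 - \<phi> G1) \<le> 0" "\<exists>s\<in>S. ord_at s (1 - \<phi> G1) < 0" "\<not> rdvd (1 - \<phi> G1) 1"
    using nonunit_polynomial[of 1] by auto
  obtain s0 where s0: "s0 \<in> S" "ord_at s0 (1 - \<phi> G1) < 0" using G1(3) by blast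
  define b where "b = 1 - \<phi> G1"
  have b: "b \<in> R" "b \<noteq> 0" "\<And>s. s \<in> S \<Longrightarrow> ord_at s b \<le> 0" "\<not> rdvd b 1"
    unfolding b_def using G1 by (auto intro!: RD(1,4) emb_in_R)
  have b_emb: "b = \<phi> (1 - G1)" unfolding b_def by (simp only: hom_minus hom_one)
  obtain w where w: "w \<in> S" "ord_at w t < 0" using infinite_place_exists by blast
  have "\<not> S \<subseteq> {w}" using card_S card_mono[of "{w}" S] by auto
  then obtain v where v: "v \<in> S" "v \<noteq> w" by blast
  obtain r0 where r0: "r0 \<noteq> 0" "\<forall>u. is_prime_place u \<longrightarrow> u \<notin> S \<longrightarrow> ord_at u r0 = 0" "ord_at v r0 \<noteq> 0"
    using nontrivial_unit[OF place_S[OF v(1)] place_S[OF w(1)] w(2) v(2) v(1) w(1) t_integral] by (elim exE conjE) (rule that)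
  have r0R: "r0 \<in> R" "inverse r0 \<in> R" using r0(1,2) by (simp_all add: R_iff ord_ge_def ord_at_inverse)
  obtain M where sound: "\<forall>Q. \<not> rdvd Q 1 \<longrightarrow> (\<forall>x\<in>R. \<forall>y\<in>R. \<forall>u\<in>R. \<forall>u2\<in>R. \<forall>w\<in>R. \<forall>v. (\<forall>i. v i \<in> R) \<longrightarrow>
      witness b Q M x y u u2 w v \<longrightarrow> y = x\<^sup>2)"
    using witness_sound[OF b s0(1) s0(2)[folded b_def]] by (rule exE)
  obtain l k where lk: "\<not> CARD('p) dvd l" "rdvd (b ^ M) (r0 ^ (CARD('p) ^ k * l) - 1)"
    using unit_power_congruence[OF r0R r0(1), of "b ^ M"] b(1,2) RD(7) by auto
  \<comment> \<open>A power of \<open>r0\<close> that is 1 modulo \<open>b ^ M\<close>; its nonzero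
    order at \<open>v\<close> keeps it different from 1.\<close>
  define r where "r = r0 ^ (CARD('p) ^ k * l)"
  have r: "r \<in> R" "inverse r \<in> R" "r \<noteq> 0"
    unfolding r_def using r0R r0(1) RD(7) by (auto simp flip: power_inverse)
  have "CARD('p) ^ k * l > 0" using lk(1) prime_gt_0_nat[OF prime_card[where 'a = 'p]] by (cases l) auto
  then have "ord_at v r \<noteq> 0" unfolding r_def using r0 place_S[OF v(1)] by (simp add: ord_at_power)
  then have "r - 1 \<noteq> 0" using place_S[OF v(1)] by auto
  then obtain W where W: "W \<noteq> 0" "rdvd (r - 1) (\<phi> W)" using divides_polynomial[of "r - 1"] r(1) RD(1,4) by blast
  obtain G where G: "W dvd G" "\<not> rdvd (1 - \<phi> G) 1" using nonunit_polynomial[OF W(1)] by blast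
  obtain F where "G = W * F" using G(1) by blast
  then have rG: "rdvd (r - 1) (\<phi> G)" using W(2) by (simp add: hom_mult rdvd_mult emb_in_R)
  have Q_emb: "1 - \<phi> G = \<phi> (1 - G)" by (simp only: hom_minus hom_one)
  have "y = x\<^sup>2 \<longleftrightarrow> (\<exists>i<L. x = a i \<and> y = (a i)\<^sup>2) \<or>
    (\<exists>u\<in>R. \<exists>u2\<in>R. \<exists>w\<in>R. \<exists>v. (\<forall>i. v i \<in> R) \<and> witness b (1 - \<phi> G) M x y u u2 w v)"
    (is "_ \<longleftrightarrow> ?A \<or> ?B") if x: "x \<in> R" and y: "y \<in> R" for x y
  proof
    assume eq: "y = x\<^sup>2"
    show "?A \<or> ?B"
    proof (cases "\<exists>i<L. x = a i")
      case False
      have ?B unfolding eq using False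
        by (intro witness_complete[OF b(1,2) r _ rG emb_in_R x] lk(2)[folded r_def]) blast
      then show ?thesis ..
    qed (use eq in blast)
  next
    assume "?A \<or> ?B"
    then show "y = x\<^sup>2"
    proof
      assume ?B
      then obtain u u2 w v where "u \<in> R" "u2 \<in> R" "w \<in> R" "\<forall>i. v i \<in> R" "witness b (1 - \<phi> G) M x y u u2 w v"
        by (elim bexE exE conjE) (rule that)
      then show ?thesis using sound[rule_format, OF G(2) x y] by metis
    qed auto
  qed
  then show ?thesis unfolding b_emb Q_emb
    by (intro exI[of _ "1 - G1"] exI[of _ "1 - G"] exI[of _ M]) blast
qed

end

section \<open>Definability\<close>

lemma finite_term_vars: "finite (term_vars T)"
  by (induction T) auto

lemma finite_formula_vars: "finite (formula_vars \<theta>)"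
  by (induction \<theta>) (auto simp: finite_term_vars)

lemma term_value_cong: "(\<And>i. i \<in> term_vars T \<Longrightarrow> \<rho> i = \<rho>' i) \<Longrightarrow> term_value M \<rho> T = term_value M \<rho>' T"
  by (induction T) auto

lemma satisfies_cong: "(\<And>i. i \<in> formula_vars \<theta> \<Longrightarrow> \<rho> i = \<rho>' i) \<Longrightarrow> satisfies M \<rho> \<theta> = satisfies M \<rho>' \<theta>"
proof (induction \<theta>)
  case (Eq a b)
  then show ?case using term_value_cong[of a \<rho> \<rho>' M] term_value_cong[of b \<rho> \<rho>' M] by simp
next
  case (Divides a b)
  then show ?case using term_value_cong[of a \<rho> \<rho>' M] term_value_cong[of b \<rho> \<rho>' M] by simp
qed auto

text \<open>Terms, and below formulas, are treated as functions of the valuation. Closure properties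
  then act as introduction rules, and the defining formula never has to be written out.\<close>

definition term_definable :: "'k div_structure \<Rightarrow> ((nat \<Rightarrow> 'k) \<Rightarrow> 'k) \<Rightarrow> bool" where
  "term_definable M F \<longleftrightarrow> (\<exists>T. \<forall>\<rho>. term_value M \<rho> T = F \<rho>)"

definition qf_definable :: "'k div_structure \<Rightarrow> ((nat \<Rightarrow> 'k) \<Rightarrow> bool) \<Rightarrow> bool" where
  "qf_definable M P \<longleftrightarrow> (\<exists>\<theta>. \<forall>\<rho>. satisfies M \<rho> \<theta> = P \<rho>)"

text \<open>Lists of witnesses are exchanged for total valuations: a formula has finitely many
  variables, and \<open>z\<close> fills the positions beyond the list.\<close>

lemma pos_ex_definable2I:
  assumes "qf_definable M P" "z \<in> universe M"
    and "A = {(x, y). x \<in> universe M \<and> y \<in> universe M \<and> (\<exists>\<rho>. (\<forall>i. \<rho> i \<in> universe M) \<and> \<rho> 0 = x \<and> \<rho> 1 = y \<and> P \<rho>)}"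
  shows "pos_ex_definable2 M A"
proof -
  obtain \<theta> where \<theta>: "\<And>\<rho>. satisfies M \<rho> \<theta> = P \<rho>" using assms(1) unfolding qf_definable_def by blast
  obtain m where "\<forall>i\<in>formula_vars \<theta>. i < m" using finite_formula_vars[of \<theta>] by (metis finite_nat_set_iff_bounded)
  then have vars: "formula_vars \<theta> \<subseteq> {..<m + 2}" by fastforce
  have "(\<exists>\<rho>. (\<forall>i. \<rho> i \<in> universe M) \<and> \<rho> 0 = x \<and> \<rho> 1 = y \<and> P \<rho>) \<longleftrightarrow>
      (\<exists>ys. length ys = m \<and> set ys \<subseteq> universe M \<and> satisfies M (\<lambda>i. (x # y # ys) ! i) \<theta>)"
    (is "?L \<longleftrightarrow> ?R") if xy: "x \<in> universe M" "y \<in> universe M" for x y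
  proof
    assume ?L
    then obtain \<rho> where \<rho>: "\<forall>i. \<rho> i \<in> universe M" "\<rho> 0 = x" "\<rho> 1 = y" "P \<rho>" by blast
    define ys where "ys = map (\<lambda>i. \<rho> (i + 2)) [0..<m]"
    have "(x # y # ys) ! i = \<rho> i" if "i < m + 2" for i
      using that \<rho>(2,3) unfolding ys_def by (cases i; cases "i - 1") (auto simp: nth_Cons split: nat.splits)
    then have "satisfies M (\<lambda>i. (x # y # ys) ! i) \<theta> = satisfies M \<rho> \<theta>"
      using vars by (intro satisfies_cong) auto
    then show ?R using \<rho>(1,4) \<theta> by (intro exI[of _ ys]) (auto simp: ys_def)
  next
    assume ?R
    then obtain ys where ys: "length ys = m" "set ys \<subseteq> universe M" "satisfies M (\<lambda>i. (x # y # ys) ! i) \<theta>" by blast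
    define \<rho> where "\<rho> i = (if i < m + 2 then (x # y # ys) ! i else z)" for i
    have "satisfies M \<rho> \<theta> = satisfies M (\<lambda>i. (x # y # ys) ! i) \<theta>"
      using vars by (intro satisfies_cong) (auto simp: \<rho>_def)
    then have "P \<rho>" using ys(3) \<theta> by simp
    moreover have "\<rho> i \<in> universe M" for i
    proof (cases "i < m + 2")
      case True
      then have "(x # y # ys) ! i \<in> set (x # y # ys)" using ys(1) by (intro nth_mem) simp
      then show ?thesis using True xy ys(2) unfolding \<rho>_def by auto
    qed (simp add: \<rho>_def assms(2))
    moreover have "\<rho> 0 = x" "\<rho> 1 = y" unfolding \<rho>_def by simp_all
    ultimately show ?L by blast
  qed
  then show ?thesis unfolding pos_ex_definable2_def assms(3)
    by (intro exI[of _ m] exI[of _ \<theta>] conjI vars) auto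
qed

section \<open>Closure properties of definable terms and relations\<close>

context s_integers
begin

abbreviation (input) \<M> :: "'k div_structure" where "\<M> \<equiv> S_integer_structure S t"

lemma term_var: "term_definable \<M> (\<lambda>\<rho>. \<rho> i)"
  unfolding term_definable_def by (intro exI[of _ "Var i"]) simp

lemma term_0: "term_definable \<M> (\<lambda>\<rho>. 0)"
  unfolding term_definable_def by (intro exI[of _ Zero]) (simp add: S_integer_structure_def)

lemma term_1: "term_definable \<M> (\<lambda>\<rho>. 1)"
  unfolding term_definable_def by (intro exI[of _ One]) (simp add: S_integer_structure_def)

lemma term_add:
  assumes "term_definable \<M> F" "term_definable \<M> G"
  shows "term_definable \<M> (\<lambda>\<rho>. F \<rho> + G \<rho>)"
proof -
  obtain T U where "\<forall>\<rho>. term_value \<M> \<rho> T = F \<rho>" "\<forall>\<rho>. term_value \<M> \<rho> U = G \<rho>"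
    using assms unfolding term_definable_def by blast
  then show ?thesis unfolding term_definable_def
    by (intro exI[of _ "Add T U"]) (simp add: S_integer_structure_def)
qed

lemma term_mult_t:
  assumes "term_definable \<M> F"
  shows "term_definable \<M> (\<lambda>\<rho>. t * F \<rho>)"
proof -
  obtain T where "\<forall>\<rho>. term_value \<M> \<rho> T = F \<rho>"
    using assms unfolding term_definable_def by blast
  then show ?thesis unfolding term_definable_def
    by (intro exI[of _ "MulT T"]) (simp add: S_integer_structure_def)
qed

lemma term_mult_nat:
  assumes "term_definable \<M> F"
  shows "term_definable \<M> (\<lambda>\<rho>. of_nat n * F \<rho>)"
proof (induction n)
  case (Suc n)
  then show ?case using term_add[OF assms Suc] by (simp add: distrib_right)
qed (simp add: term_0)

text \<open>Horner's scheme: a coefficient in the prime field acts by repeated addition, the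
  variable by the function symbol for \<open>t\<close>.\<close>

lemma term_mult_poly:
  assumes "term_definable \<M> F"
  shows "term_definable \<M> (\<lambda>\<rho>. \<phi> f * F \<rho>)"
proof (induction f)
  case (pCons c f)
  obtain i where "c = of_nat i" using surj_of_nat_mod_ring by blast
  then have "\<phi> [:c:] = of_nat i" by (metis hom_of_nat of_nat_poly)
  then show ?case unfolding emb_pCons[of c f]
    using term_add[OF term_mult_nat[OF assms, of i] term_mult_t[OF pCons.IH]] by (simp add: distrib_right mult.assoc)
qed (simp add: term_0)

lemma term_poly: "term_definable \<M> (\<lambda>\<rho>. \<phi> f)"
  using term_mult_poly[OF term_1, of f] by simp

text \<open>The language has no subtraction, but in positive characteristic multiplication by -1 is
  a repeated addition.\<close>

lemma term_diff:
  assumes "term_definable \<M> F" "term_definable \<M> G"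
  shows "term_definable \<M> (\<lambda>\<rho>. F \<rho> - G \<rho>)"
  using term_add[OF assms(1) term_mult_poly[OF assms(2), of "- 1"]] by (simp add: hom_uminus)

lemma term_mult_a:
  assumes "term_definable \<M> F"
  shows "term_definable \<M> (\<lambda>\<rho>. a i * F \<rho>)" "term_definable \<M> (\<lambda>\<rho>. (a i)\<^sup>2 * F \<rho>)"
proof -
  have "a i = \<phi> ([:0, 1:] ^ i - 1)" unfolding a_def by (simp only: hom_minus hom_power hom_one)
  moreover from this have "(a i)\<^sup>2 = \<phi> (([:0, 1:] ^ i - 1)\<^sup>2)" by (simp only: hom_power)
  ultimately show "term_definable \<M> (\<lambda>\<rho>. a i * F \<rho>)" "term_definable \<M> (\<lambda>\<rho>. (a i)\<^sup>2 * F \<rho>)"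
    using term_mult_poly[OF assms] by (simp_all only:)
qed

lemma term_a: "term_definable \<M> (\<lambda>\<rho>. a i)" "term_definable \<M> (\<lambda>\<rho>. (a i)\<^sup>2)"
  using term_mult_a[OF term_1, of i] by simp_all

lemma qf_eq:
  assumes "term_definable \<M> F" "term_definable \<M> G"
  shows "qf_definable \<M> (\<lambda>\<rho>. F \<rho> = G \<rho>)"
proof -
  obtain T U where "\<forall>\<rho>. term_value \<M> \<rho> T = F \<rho>" "\<forall>\<rho>. term_value \<M> \<rho> U = G \<rho>"
    using assms unfolding term_definable_def by blast
  then show ?thesis unfolding qf_definable_def by (intro exI[of _ "Eq T U"]) simp
qed

lemma qf_rdvd:
  assumes "term_definable \<M> F" "term_definable \<M> G"
  shows "qf_definable \<M> (\<lambda>\<rho>. rdvd (F \<rho>) (G \<rho>))"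
proof -
  obtain T U where "\<forall>\<rho>. term_value \<M> \<rho> T = F \<rho>" "\<forall>\<rho>. term_value \<M> \<rho> U = G \<rho>"
    using assms unfolding term_definable_def by blast
  then show ?thesis unfolding qf_definable_def
    by (intro exI[of _ "Divides T U"]) (simp add: S_integer_structure_def rdvd_def)
qed

lemma qf_conj:
  assumes "qf_definable \<M> P" "qf_definable \<M> Q"
  shows "qf_definable \<M> (\<lambda>\<rho>. P \<rho> \<and> Q \<rho>)"
proof -
  obtain \<theta> \<eta> where "\<forall>\<rho>. satisfies \<M> \<rho> \<theta> = P \<rho>" "\<forall>\<rho>. satisfies \<M> \<rho> \<eta> = Q \<rho>"
    using assms unfolding qf_definable_def by blast
  then show ?thesis unfolding qf_definable_def by (intro exI[of _ "And \<theta> \<eta>"]) simp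
qed

lemma qf_disj:
  assumes "qf_definable \<M> P" "qf_definable \<M> Q"
  shows "qf_definable \<M> (\<lambda>\<rho>. P \<rho> \<or> Q \<rho>)"
proof -
  obtain \<theta> \<eta> where "\<forall>\<rho>. satisfies \<M> \<rho> \<theta> = P \<rho>" "\<forall>\<rho>. satisfies \<M> \<rho> \<eta> = Q \<rho>"
    using assms unfolding qf_definable_def by blast
  then show ?thesis unfolding qf_definable_def by (intro exI[of _ "Or \<theta> \<eta>"]) simp
qed

text \<open>Formulas have no truth constants; \<open>0 = 0\<close> and \<open>0 = 1\<close> replace
  them. They start the inductions for bounded quantifiers and express the side condition
  \<open>i \<noteq> k\<close>.\<close>

lemma qf_const: "qf_definable \<M> (\<lambda>\<rho>. b)"
  using qf_eq[OF term_0 term_0] qf_eq[OF term_0 term_1] by (cases b) simp_all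

lemma qf_all: "(\<And>i. qf_definable \<M> (P i)) \<Longrightarrow> qf_definable \<M> (\<lambda>\<rho>. \<forall>i<(n::nat). P i \<rho>)"
proof (induction n)
  case (Suc n)
  then show ?case using qf_conj[OF Suc.IH[OF Suc.prems] Suc.prems[of n]] by (simp add: All_less_Suc conj_commute)
qed (simp add: qf_const)

lemma qf_ex: "(\<And>i. qf_definable \<M> (P i)) \<Longrightarrow> qf_definable \<M> (\<lambda>\<rho>. \<exists>i<(n::nat). P i \<rho>)"
proof (induction n)
  case (Suc n)
  then show ?case using qf_disj[OF Suc.IH[OF Suc.prems] Suc.prems[of n]] by (simp add: Ex_less_Suc disj_commute)
qed (simp add: qf_const)

lemma qf_imp: "qf_definable \<M> P \<Longrightarrow> qf_definable \<M> (\<lambda>\<rho>. b \<longrightarrow> P \<rho>)"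
  using qf_const[of True] by (cases b) simp_all

lemma qf_square_rel:
  assumes "term_definable \<M> F" "term_definable \<M> G"
  shows "qf_definable \<M> (\<lambda>\<rho>. square_rel (F \<rho>) (G \<rho>))"
  unfolding square_rel_def
  by (intro qf_all qf_conj qf_rdvd term_diff term_mult_a term_a assms)

text \<open>Variables 2, 3, 4 hold \<open>u\<close>, \<open>u2\<close>, \<open>w\<close>, and the
  sequence \<open>v\<close> begins at 5. Rewriting turns \<open>b ^ M\<close> into the image of one
  polynomial and \<open>2 * u\<close> into \<open>u + u\<close>.\<close>

lemma qf_witness:
  "qf_definable \<M> (\<lambda>\<rho>. witness (\<phi> f) (\<phi> g) M (\<rho> 0) (\<rho> 1) (\<rho> 2) (\<rho> 3) (\<rho> 4) (\<lambda>i. \<rho> (5 + i)))"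
  unfolding witness_def less_Suc_eq_le[symmetric] hom_power[symmetric] mult_2
  by (intro qf_conj qf_all qf_ex qf_imp qf_rdvd qf_square_rel term_diff term_add term_mult_a term_a term_poly term_var term_1)

theorem squaring_definable:
  "pos_ex_definable2 \<M> {(x, y). x \<in> R \<and> y \<in> R \<and> y = x\<^sup>2}"
proof -
  from squaring_characterization obtain f g M where *:
    "\<forall>x\<in>R. \<forall>y\<in>R. y = x\<^sup>2 \<longleftrightarrow> (\<exists>i<L. x = a i \<and> y = (a i)\<^sup>2) \<or>
    (\<exists>u\<in>R. \<exists>u2\<in>R. \<exists>w\<in>R. \<exists>v. (\<forall>i. v i \<in> R) \<and> witness (\<phi> f) (\<phi> g) M x y u u2 w v)" by (elim exE)
  define P where "P \<rho> \<longleftrightarrow> (\<exists>i<L. \<rho> 0 = a i \<and> \<rho> 1 = (a i)\<^sup>2) \<or>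
    witness (\<phi> f) (\<phi> g) M (\<rho> 0) (\<rho> 1) (\<rho> 2) (\<rho> 3) (\<rho> 4) (\<lambda>i. \<rho> (5 + i))" for \<rho>
  have uni: "universe \<M> = R" by (simp add: S_integer_structure_def)
  have "qf_definable \<M> P" unfolding P_def
    by (intro qf_disj qf_ex qf_conj qf_eq term_var term_a qf_witness)
  moreover have "0 \<in> universe \<M>" unfolding uni by (rule RD(2))
  moreover have "y = x\<^sup>2 \<longleftrightarrow> (\<exists>\<rho>. (\<forall>i. \<rho> i \<in> R) \<and> \<rho> 0 = x \<and> \<rho> 1 = y \<and> P \<rho>)" (is "_ \<longleftrightarrow> ?E")
    if x: "x \<in> R" and y: "y \<in> R" for x y
  proof
    assume "y = x\<^sup>2"
    then have "(\<exists>i<L. x = a i \<and> y = (a i)\<^sup>2) \<or>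
      (\<exists>u\<in>R. \<exists>u2\<in>R. \<exists>w\<in>R. \<exists>v. (\<forall>i. v i \<in> R) \<and> witness (\<phi> f) (\<phi> g) M x y u u2 w v)"
      using * x y by blast
    then show ?E
    proof
      assume A: "\<exists>i<L. x = a i \<and> y = (a i)\<^sup>2"
      \<comment> \<open>The first disjunct reads variables 0 and 1 only; the others receive
        \<open>y\<close> as an arbitrary value in the ring.\<close>
      have "P (\<lambda>i. if i = 0 then x else y)" unfolding P_def using A by simp
      then show ?E using x y by (intro exI[of _ "\<lambda>i. if i = 0 then x else y"]) simp
    next
      assume "\<exists>u\<in>R. \<exists>u2\<in>R. \<exists>w\<in>R. \<exists>v. (\<forall>i. v i \<in> R) \<and> witness (\<phi> f) (\<phi> g) M x y u u2 w v"
      then obtain u u2 w v where W: "u \<in> R" "u2 \<in> R" "w \<in> R" "\<forall>i. v i \<in> R" "witness (\<phi> f) (\<phi> g) M x y u u2 w v"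
        by (elim bexE exE conjE) (rule that)
      define \<rho> where "\<rho> i = (if i < 5 then [x, y, u, u2, w] ! i else v (i - 5))" for i
      have \<rho>: "\<rho> 0 = x" "\<rho> 1 = y" "\<rho> 2 = u" "\<rho> 3 = u2" "\<rho> 4 = w" "(\<lambda>i. \<rho> (5 + i)) = v"
        unfolding \<rho>_def by simp_all
      have "\<rho> i \<in> R" for i
      proof (cases "i < 5")
        case True
        then have "[x, y, u, u2, w] ! i \<in> set [x, y, u, u2, w]" by (intro nth_mem) simp
        then show ?thesis using True x y W(1-3) unfolding \<rho>_def by auto
      qed (use W(4) in \<open>simp add: \<rho>_def\<close>)
      moreover have "P \<rho>" unfolding P_def \<rho> using W(5) by blast
      ultimately show ?E using \<rho>(1,2) by blast
    qed
  next
    assume ?E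
    then obtain \<rho> where \<rho>: "\<forall>i. \<rho> i \<in> R" "\<rho> 0 = x" "\<rho> 1 = y" "P \<rho>" by blast
    have "(\<exists>i<L. x = a i \<and> y = (a i)\<^sup>2) \<or> witness (\<phi> f) (\<phi> g) M x y (\<rho> 2) (\<rho> 3) (\<rho> 4) (\<lambda>i. \<rho> (5 + i))"
      using \<rho>(4) unfolding P_def \<rho>(2,3) .
    then have "(\<exists>i<L. x = a i \<and> y = (a i)\<^sup>2) \<or>
      (\<exists>u\<in>R. \<exists>u2\<in>R. \<exists>w\<in>R. \<exists>v. (\<forall>i. v i \<in> R) \<and> witness (\<phi> f) (\<phi> g) M x y u u2 w v)"
      using \<rho>(1) by (metis (no_types, lifting))
    then show "y = x\<^sup>2" using *[rule_format, OF x y] by blast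
  qed
  then have "{(x, y). x \<in> R \<and> y \<in> R \<and> y = x\<^sup>2} = {(x, y). x \<in> universe \<M> \<and> y \<in> universe \<M> \<and>
      (\<exists>\<rho>. (\<forall>i. \<rho> i \<in> universe \<M>) \<and> \<rho> 0 = x \<and> \<rho> 1 = y \<and> P \<rho>)}"
    unfolding uni by (intro Collect_cong) auto
  ultimately show ?thesis by (rule pos_ex_definable2I)
qed

end

text \<open>Coordinates with respect to a basis are fractions of polynomials; the product of their
  denominators serves as \<open>D\<close>.\<close>

lemma finite_extension_function_field:
  fixes \<iota> :: "'p::prime_card mod_ring poly fract \<Rightarrow> 'k::field"
  assumes "field_hom \<iota>" "finite_extension \<iota>"
  shows "\<exists>B. function_field (\<lambda>f. \<iota> (Fract f 1)) B"
proof -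
  interpret field_hom \<iota> by (rule assms(1))
  obtain B where B: "finite_dimensional_vector_space (\<lambda>c x. \<iota> c * x) B"
    using assms(2) unfolding finite_extension_def by blast
  interpret V: finite_dimensional_vector_space "\<lambda>c x. \<iota> c * x" B by (rule B)
  have "function_field (\<lambda>f. \<iota> (Fract f 1)) B"
  proof
    show "\<iota> (Fract (f + g) 1) = \<iota> (Fract f 1) + \<iota> (Fract g 1)" for f g
      by (simp flip: hom_add)
    show "\<iota> (Fract (f * g) 1) = \<iota> (Fract f 1) * \<iota> (Fract g 1)" for f g
      by (simp flip: hom_mult)
    show "\<iota> (Fract 0 1) = 0" "\<iota> (Fract 1 1) = 1"
      by (simp_all add: Zero_fract_def[symmetric] One_fract_def[symmetric])
    show "\<iota> (Fract f 1) = 0 \<Longrightarrow> f = 0" for f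
      by (simp add: Zero_fract_def eq_fract)
    show "finite B" by (rule V.finite_Basis)
    fix y
    have "y \<in> V.span B" using V.span_Basis by simp
    then obtain r where r: "y = (\<Sum>b\<in>B. \<iota> (r b) * b)" unfolding V.span_finite[OF V.finite_Basis] by blast
    have "\<forall>b. \<exists>n d. d \<noteq> 0 \<and> r b = Fract n d" by (metis Fract_cases)
    then obtain n d where nd: "\<And>b. d b \<noteq> 0" "\<And>b. r b = Fract (n b) (d b)" by metis
    define D where "D = (\<Prod>b\<in>B. d b)"
    have "\<iota> (Fract D 1) * (\<iota> (r b) * b) = \<iota> (Fract (n b * (\<Prod>b'\<in>B - {b}. d b')) 1) * b" if b: "b \<in> B" for b
    proof -
      have "D = d b * (\<Prod>b'\<in>B - {b}. d b')" unfolding D_def using V.finite_Basis b by (rule prod.remove)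
      then have "Fract D 1 * r b = Fract (n b * (\<Prod>b'\<in>B - {b}. d b')) 1"
        unfolding nd(2) using nd(1) by (simp add: eq_fract mult_ac)
      then show ?thesis by (metis hom_mult mult.assoc)
    qed
    then have "\<iota> (Fract D 1) * y = (\<Sum>b\<in>B. \<iota> (Fract (n b * (\<Prod>b'\<in>B - {b}. d b')) 1) * b)"
      unfolding r sum_distrib_left by (intro sum.cong refl)
    moreover have "D \<noteq> 0" unfolding D_def using nd(1) V.finite_Basis by simp
    ultimately show "\<exists>D c. D \<noteq> 0 \<and> \<iota> (Fract D 1) * y = (\<Sum>b\<in>B. \<iota> (Fract (c b) 1) * b)"
      by (intro exI[of _ D] exI[of _ "\<lambda>b. n b * (\<Prod>b'\<in>B - {b}. d b')"] conjI)
  qed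
  then show ?thesis by blast
qed

theorem theorem3p15:
  fixes \<iota> :: "'p::prime_card mod_ring poly fract \<Rightarrow> 'k::field"
    and S :: "('k \<Rightarrow> int extended) set"
  assumes "odd CARD('p)"
    and "finite_separable_extension \<iota>"
    and "finite S"
    and "card S \<ge> 2"
    and "\<forall>v\<in>S. is_prime_place v"
    and "\<forall>v. is_prime_place v \<and> lies_above \<iota> v ord_infinity \<longrightarrow> v \<in> S"
  shows "pos_ex_definable2 (S_integer_structure S (\<iota> (Fract [:0, 1:] 1)))
           {(x, y). x \<in> S_integers S \<and> y \<in> S_integers S \<and> y = x\<^sup>2}"
proof -
  have \<iota>: "field_hom \<iota>" "finite_extension \<iota>" using assms(2) unfolding finite_separable_extension_def by auto
  interpret H: field_hom \<iota> by (rule \<iota>(1))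
  let ?\<phi> = "\<lambda>f. \<iota> (Fract f 1)"
  obtain B where B: "function_field ?\<phi> B" using finite_extension_function_field[OF \<iota>] by blast
  interpret F: function_field ?\<phi> B by (rule B)
  \<comment> \<open>At a pole \<open>u\<close> of \<open>t\<close>, a nonzero polynomial
    \<open>f\<close> has order \<open>degree f * ord_at u t\<close>, so \<open>u\<close> restricts
    to a positive multiple of \<open>ord_infinity\<close>. Hence all poles of \<open>t\<close>
    belong to \<open>S\<close>.\<close>
  have above: "lies_above \<iota> u ord_infinity" if u: "is_prime_place u" "ord_at u (?\<phi> [:0, 1:]) < 0" for u
    unfolding lies_above_def
  proof
    fix x :: "'p mod_ring poly fract"
    obtain f g where x: "x = Fract f g" "g \<noteq> 0" by (cases x)
    show "(u (\<iota> x) \<ge> 0 \<longleftrightarrow> ord_infinity x \<ge> 0) \<and> (u (\<iota> x) > 0 \<longleftrightarrow> ord_infinity x > 0)"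
    proof (cases "f = 0")
      case True
      then have "x = 0" using x by (simp add: Zero_fract_def eq_fract)
      then have "u (\<iota> x) = Pinf" using place_0[OF u(1)] by simp
      moreover have "ord_infinity x = Pinf" using \<open>x = 0\<close> by (simp add: ord_infinity_def)
      ultimately show ?thesis by simp
    next
      case False
      have nz: "?\<phi> f \<noteq> 0" "?\<phi> g \<noteq> 0" using False x F.emb_eq_0_iff by blast+
      have "Fract f 1 = x * Fract g 1" using x by (simp add: eq_fract)
      then have "?\<phi> f = \<iota> x * ?\<phi> g" by (simp only: H.hom_mult)
      then have \<iota>x: "\<iota> x = ?\<phi> f / ?\<phi> g" using nz(2) by simp
      have "ord_at u (\<iota> x) = (int (degree f) - int (degree g)) * ord_at u (?\<phi> [:0, 1:])"
        unfolding \<iota>x ord_at_divide[OF u(1) nz] F.ord_emb_neg[OF u False] F.ord_emb_neg[OF u x(2)]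
        by (simp add: left_diff_distrib)
      moreover have "u (\<iota> x) = Fin (ord_at u (\<iota> x))" using place_Fin[OF u(1)] nz unfolding \<iota>x by simp
      moreover have "ord_infinity x = Fin (int (degree g) - int (degree f))"
        unfolding x(1) using ord_infinity_Fract[OF x(2)] False by simp
      ultimately show ?thesis using u(2)
        by (auto simp: zero_extended_def zero_le_mult_iff zero_less_mult_iff)
    qed
  qed
  interpret s_integers ?\<phi> B S
  proof
    show "\<forall>u. is_prime_place u \<longrightarrow> u \<notin> S \<longrightarrow> ord_ge u 0 (?\<phi> [:0, 1:])"
      using above assms(6) unfolding ord_ge_def by (meson not_le)
  qed (use assms in auto)
  show ?thesis by (rule squaring_definable)
qed

end
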